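(* Let $d\geq 1$ and let $E\subset [1,2]$ be nonempty with upper Minkowski dimension $\dim_M(E)=\beta$. Let $m$ be an $a$-admissible bilinear multiplier up to order $1$ on $\mathbb{R}^{2d}$, and assume $2a>d+\beta$. If $s_1,s_2\geq 0$ satisfy $s_1+s_2<\frac{2a-d-\beta}{2}$, then $$\|\mathcal{A}_{m,E}(f,g)\|_{L^2}\lesssim \|f\|_{H^{-s_1}}\|g\|_{H^{-s_2}}.$$ In particular, $\mathcal{A}_{m,E}:L^{2}\times L^{2}\rightarrow L^{2}$ is bounded.
   Context: All functions are on $\mathbb{R}^d$. Operators are initially defined for $f,g\in C_0^\infty(\mathbb{R}^d)$, and $A\lesssim B$ means $A\le CB$ with $C$ independent of $f,g$. The Fourier transform is $\hat f(\xi)=\int f(x)e^{-2\pi i x\cdot\xi}\,dx$. Admissible multipliers: for $k\ge 0$, a bounded function $m:\mathbb{R}^{2d}\to\mathbb{C}$ is $a$-admissible up to order $k$ if $m\in C^k(\mathbb{R}^{2d})$, $a>\frac d2$, and $|\partial^\alpha m(\xi,\eta)|\lesssim_\alpha (1+|\xi|+|\eta|)^{-a}$ for all multi-indices $\alpha$ with $|\alpha|\le k$ and all $\xi,\eta\in\mathbb{R}^d$. For $t>0$, $m_t(\xi,\eta)=m(t\xi,t\eta)$, and $$T_{m}(f,g)(x)=\int_{\mathbb{R}^{2d}}\hat f(\xi)\hat g(\eta)m(\xi,\eta)e^{2\pi i x\cdot(\xi+\eta)}\,d\xi d\eta,\qquad \mathcal{A}_{m,E}(f,g)(x)=\sup_{t\in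 E}|T_{m_t}(f,g)(x)|.$$ Upper Minkowski dimension: $\dim_M(E)=\limsup_{\delta\to0}\frac{\log N(E,\delta)}{\log(1/\delta)}$, where $N(E,\delta)$ is the minimal number of closed intervals of length $\delta$ needed to cover $E$. For $s\ge0$, $\|f\|_{H^{-s}}=\|(1+|\xi|^2)^{-s/2}\hat f(\xi)\|_{L^2_\xi}$. *)

theory Defs
  imports "HOL-Analysis.Analysis"
begin

section \<open>Differentiability classes\<close>

definition partial_deriv ::
    "'a::euclidean_space \<Rightarrow> ('a \<Rightarrow> 'b::real_normed_vector) \<Rightarrow> 'a \<Rightarrow> 'b" where
  "partial_deriv v f x = vector_derivative (\<lambda>t. f (x + t *\<^sub>R v)) (at 0)"

text \<open>Derivatives of order \<open>j\<close> are indexed by lists of \<open>j\<close> basis vectors rather than by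
  multi-indices of weight \<open>j\<close>. On functions of class \<open>C\<^sup>k\<close> with \<open>j \<le> k\<close> partial derivatives
  commute, so this is the same family of functions.\<close>

primrec partial_derivs ::
    "'a::euclidean_space list \<Rightarrow> ('a \<Rightarrow> 'b::real_normed_vector) \<Rightarrow> 'a \<Rightarrow> 'b" where
  "partial_derivs [] f = f"
| "partial_derivs (v # vs) f = partial_deriv v (partial_derivs vs f)"

primrec Ck :: "nat \<Rightarrow> ('a::euclidean_space \<Rightarrow> 'b::real_normed_vector) \<Rightarrow> bool" where
  "Ck 0 f \<longleftrightarrow> continuous_on UNIV f"
| "Ck (Suc k) f \<longleftrightarrow> continuous_on UNIV f \<and>
     (\<forall>v\<in>Basis. (\<forall>x. (\<lambda>t::real. f (x + t *\<^sub>R v)) differentiable (at 0)) \<and> Ck k (partial_deriv v f))"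

definition test_fun :: "('a::euclidean_space \<Rightarrow> complex) \<Rightarrow> bool" where
  "test_fun f \<longleftrightarrow> (\<forall>k. Ck k f) \<and> compact (closure {x. f x \<noteq> 0})"


section \<open>Norms\<close>

text \<open>The case distinction only extends the square root by \<open>sqrt \<infinity> = \<infinity>\<close>.\<close>

definition eL2_norm :: "('a::euclidean_space \<Rightarrow> ennreal) \<Rightarrow> ennreal" where
  "eL2_norm F = (let I = (\<integral>\<^sup>+ x. (F x)\<^sup>2 \<partial>lborel) in
     if I = \<infinity> then \<infinity> else ennreal (sqrt (enn2real I)))"

definition L2_norm :: "('a::euclidean_space \<Rightarrow> 'b::real_normed_vector) \<Rightarrow> ennreal" where
  "L2_norm f = eL2_norm (\<lambda>x. ennreal (norm (f x)))"

definition in_L2 :: "('a::euclidean_space \<Rightarrow> 'b::real_normed_vector) \<Rightarrow> bool" where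
  "in_L2 f \<longleftrightarrow> f \<in> borel_measurable lborel \<and> L2_norm f < \<infinity>"

definition fourier :: "('a::euclidean_space \<Rightarrow> complex) \<Rightarrow> 'a \<Rightarrow> complex" where
  "fourier f \<xi> = (LINT x|lborel. f x * exp (- 2 * of_real pi * \<i> * of_real (x \<bullet> \<xi>)))"

definition neg_sobolev_norm :: "real \<Rightarrow> ('a::euclidean_space \<Rightarrow> complex) \<Rightarrow> ennreal" where
  "neg_sobolev_norm s f = L2_norm (\<lambda>\<xi>. (1 + (norm \<xi>)\<^sup>2) powr (- s / 2) *\<^sub>R fourier f \<xi>)"


section \<open>Bilinear multipliers and maximal operators\<close>

definition admissible ::
    "real \<Rightarrow> nat \<Rightarrow> ('a::euclidean_space \<times> 'a \<Rightarrow> complex) \<Rightarrow> bool" where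
  "admissible a k m \<longleftrightarrow>
     bounded (range m) \<and> Ck k m \<and> a > real DIM('a) / 2 \<and>
     (\<forall>vs. set vs \<subseteq> Basis \<and> length vs \<le> k \<longrightarrow>
        (\<exists>C. \<forall>\<xi> \<eta>. norm (partial_derivs vs m (\<xi>, \<eta>)) \<le> C * (1 + norm \<xi> + norm \<eta>) powr (- a)))"

definition dilate :: "real \<Rightarrow> ('a::euclidean_space \<times> 'a \<Rightarrow> complex) \<Rightarrow> 'a \<times> 'a \<Rightarrow> complex" where
  "dilate t m = (\<lambda>(\<xi>, \<eta>). m (t *\<^sub>R \<xi>, t *\<^sub>R \<eta>))"

definition bilinear_op ::
    "('a::euclidean_space \<times> 'a \<Rightarrow> complex) \<Rightarrow> ('a \<Rightarrow> complex) \<Rightarrow> ('a \<Rightarrow> complex) \<Rightarrow> 'a \<Rightarrow> complex" where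
  "bilinear_op m f g x = (LINT p|lborel. (case p of (\<xi>, \<eta>) \<Rightarrow>
     fourier f \<xi> * fourier g \<eta> * m (\<xi>, \<eta>) * exp (2 * of_real pi * \<i> * of_real (x \<bullet> (\<xi> + \<eta>)))))"

definition maximal_op ::
    "('a::euclidean_space \<times> 'a \<Rightarrow> complex) \<Rightarrow> real set \<Rightarrow>
     ('a \<Rightarrow> complex) \<Rightarrow> ('a \<Rightarrow> complex) \<Rightarrow> 'a \<Rightarrow> ennreal" where
  "maximal_op m E f g x = (SUP t\<in>E. ennreal (norm (bilinear_op (dilate t m) f g x)))"

text \<open>Boundedness \<open>L\<^sup>2 \<times> L\<^sup>2 \<rightarrow> L\<^sup>2\<close> of an operator that is initially defined on pairs of test
  functions: it has a continuous extension to \<open>L\<^sup>2 \<times> L\<^sup>2\<close> which satisfies the norm inequality.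
  Only the values of \<open>A\<close> on test functions matter. The continuity clause makes the extension
  unique, up to null sets, and in particular compatible with almost everywhere equality of the
  arguments.\<close>

definition bounded_L2_L2_L2 ::
    "(('a::euclidean_space \<Rightarrow> complex) \<Rightarrow> ('a \<Rightarrow> complex) \<Rightarrow> 'a \<Rightarrow> ennreal) \<Rightarrow> bool" where
  "bounded_L2_L2_L2 A \<longleftrightarrow>
     (\<exists>(B :: ('a \<Rightarrow> complex) \<Rightarrow> ('a \<Rightarrow> complex) \<Rightarrow> 'a \<Rightarrow> real) (C::real).
        (\<forall>f g. test_fun f \<and> test_fun g \<longrightarrow>
           (AE x in lborel. 0 \<le> B f g x \<and> A f g x = ennreal (B f g x))) \<and>
        (\<forall>f g. in_L2 f \<and> in_L2 g \<longrightarrow>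
           in_L2 (B f g) \<and> L2_norm (B f g) \<le> ennreal C * L2_norm f * L2_norm g) \<and>
        (\<forall>u v f g. (\<forall>n::nat. in_L2 (u n) \<and> in_L2 (v n)) \<and> in_L2 f \<and> in_L2 g \<and>
           (\<lambda>n. L2_norm (\<lambda>x. u n x - f x)) \<longlonglongrightarrow> 0 \<and>
           (\<lambda>n. L2_norm (\<lambda>x. v n x - g x)) \<longlonglongrightarrow> 0 \<longrightarrow>
           (\<lambda>n. L2_norm (\<lambda>x. B (u n) (v n) x - B f g x)) \<longlonglongrightarrow> 0))"


section \<open>Upper Minkowski dimension\<close>

text \<open>Covers by closed intervals of length \<open>\<delta>\<close> are given by the finite set of left endpoints. The
  minimum exists for bounded \<open>E\<close> and \<open>\<delta> > 0\<close>.\<close>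

definition covering_number :: "real set \<Rightarrow> real \<Rightarrow> nat" where
  "covering_number E \<delta> = (LEAST n. \<exists>S. finite S \<and> card S = n \<and> E \<subseteq> (\<Union>c\<in>S. {c..c + \<delta>}))"

definition upper_minkowski_dim :: "real set \<Rightarrow> ereal" where
  "upper_minkowski_dim E =
     Limsup (at_right 0) (\<lambda>\<delta>. ereal (ln (real (covering_number E \<delta>)) / ln (1 / \<delta>)))"

end

theory Submission
  imports Defs "HOL-Probability.Characteristic_Functions" "HOL-Probability.Sinc_Integral"
begin

text \<open>Decompose the frequency plane into the annuli \<open>1 + |\<xi>| + |\<eta>| \<sim> 2\<^sup>j\<close>. On each annulus, Bessel's
  inequality and Cauchy-Schwarz in the fibres \<open>\<xi> + \<eta> = \<zeta>\<close> bound the operator for one fixed \<open>t\<close> by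
  \<open>2\<close> to the power \<open>- j (a - d/2 - s1 - s2)\<close>, and a derivative in \<open>t\<close> costs a factor \<open>2\<^sup>j\<close>. Hence
  the \<open>L\<^sup>2\<close> norm of the supremum over an interval of length \<open>\<sim> 2 powr - j\<close> obeys the same bound. Covering
  \<open>E\<close> by about \<open>2 powr (j \<beta>)\<close> such intervals costs a factor \<open>2 powr (j \<beta> / 2)\<close>, and the sum over \<open>j\<close>
  converges because \<open>\<beta> < 2 a - d - 2 (s1 + s2)\<close>. The extension to \<open>L\<^sup>2 \<times> L\<^sup>2\<close>
  follows from sublinearity and density.\<close>

section \<open>Square integrable functions\<close>

text \<open>On each annulus the square of the supremum over \<open>E\<close> is dominated by a sum,
  over the centres of a cover, of explicit integrals in t. Summing squares is why the covering
  number enters the norm only through its square root. The loss 2^(j d/2) in the bound for fixed t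
  is the root of the volume of the ball that contains the fibre. The loss 2^j of a derivative comes
  from d/dt m(t p) = p . grad m(t p), where the gradient is assumed to obey only the same bound as
  m; intervals of length about 2^(-j) balance it exactly.

  With \<gamma> = 2a - d - \<beta> - 2(s1 + s2) > 0, and for squared norms, a share \<gamma>/4 pays
  for the limsup in the dimension, \<gamma>/2 for summing the annuli by a weighted Cauchy-Schwarz
  inequality, and the remaining \<gamma>/4 is geometric decay.

  The maximal operator is not bilinear, so its extension rests on two-sided sublinearity: the values
  at two pairs of test functions differ by at most the operator applied to differences, which makes
  it Lipschitz on bounded sets.\<close>

abbreviation enorm :: "'b::real_normed_vector \<Rightarrow> ennreal" where
  "enorm x \<equiv> ennreal (norm x)"

text \<open>The squared L2 norm. All estimates run on squares in \<open>ennreal\<close>, so that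
  Tonelli, Fatou and Cauchy-Schwarz apply without finiteness conditions and square roots appear only
  at the end.\<close>

definition energy :: "('a::euclidean_space \<Rightarrow> 'b::real_normed_vector) \<Rightarrow> ennreal" where
  "energy f = (\<integral>\<^sup>+x. (enorm (f x))\<^sup>2 \<partial>lborel)"

abbreviation edist2 :: "('a::euclidean_space \<Rightarrow> 'b::real_normed_vector) \<Rightarrow> ('a \<Rightarrow> 'b) \<Rightarrow> ennreal" where
  "edist2 f g \<equiv> energy (\<lambda>x. f x - g x)"

text \<open>The way back from estimates of energies to estimates of norms.\<close>

lemma ennreal_power2_le_cancel:
  fixes x y :: ennreal
  assumes "x\<^sup>2 \<le> y\<^sup>2"
  shows "x \<le> y"
proof (rule ccontr)
  assume "\<not> x \<le> y"
  then have "y < x" by simp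
  then have y: "y < top" using less_le_trans top_greatest by blast
  have "y\<^sup>2 < x\<^sup>2"
  proof (cases x)
    case (real r)
    from y obtain s where "y = ennreal s" "s \<ge> 0" by (cases y) auto
    with real \<open>y < x\<close> show ?thesis
      by (auto simp: ennreal_power ennreal_less_iff intro!: power_strict_mono)
  next
    case top
    with y show ?thesis by (simp add: power2_eq_square ennreal_top_mult ennreal_mult_less_top)
  qed
  with assms show False by simp
qed

lemma eL2_norm_power2: "(eL2_norm F)\<^sup>2 = (\<integral>\<^sup>+x. (F x)\<^sup>2 \<partial>lborel)"
  by (cases "\<integral>\<^sup>+x. (F x)\<^sup>2 \<partial>lborel") (auto simp: eL2_norm_def Let_def ennreal_power top_power_ennreal)

lemma L2_norm_power2: "(L2_norm f)\<^sup>2 = energy f"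
  by (simp add: L2_norm_def eL2_norm_power2 energy_def)

lemma in_L2_iff: "in_L2 f \<longleftrightarrow> f \<in> borel_measurable lborel \<and> energy f < top"
  using power_less_top_ennreal[of "L2_norm f" 2] by (simp add: in_L2_def L2_norm_power2)

lemma in_L2_measurable: "in_L2 f \<Longrightarrow> f \<in> borel_measurable borel"
  by (simp add: in_L2_iff)

lemma tendsto_L2_norm_0_iff:
  "((\<lambda>n. L2_norm (f n)) \<longlongrightarrow> 0) F \<longleftrightarrow> ((\<lambda>n. energy (f n)) \<longlongrightarrow> 0) F"
proof
  assume L: "((\<lambda>n. L2_norm (f n)) \<longlongrightarrow> 0) F"
  have "((\<lambda>n. L2_norm (f n) * L2_norm (f n)) \<longlongrightarrow> 0 * 0) F"
    by (rule tendsto_mult_ennreal[OF L L]) auto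
  then show "((\<lambda>n. energy (f n)) \<longlongrightarrow> 0) F"
    by (simp flip: L2_norm_power2 add: power2_eq_square)
next
  assume L: "((\<lambda>n. energy (f n)) \<longlongrightarrow> 0) F"
  show "((\<lambda>n. L2_norm (f n)) \<longlongrightarrow> 0) F"
    unfolding order_tendsto_iff
  proof (intro conjI allI impI)
    fix l :: ennreal assume "0 < l"
    then have "\<forall>\<^sub>F n in F. energy (f n) < l\<^sup>2"
      using L by (intro order_tendstoD(2)) (auto simp: power2_eq_square ennreal_zero_less_mult_iff)
    then show "\<forall>\<^sub>F n in F. L2_norm (f n) < l"
    proof eventually_elim
      case (elim n)
      then have "\<not> l\<^sup>2 \<le> (L2_norm (f n))\<^sup>2" by (simp add: L2_norm_power2)
      then show ?case by (meson not_le_imp_less power_mono zero_le)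
    qed
  qed auto
qed

text \<open>(a + b)^2 <= 2 a^2 + 2 b^2 stands in for the triangle inequality of the norm. The
  constants that accumulate are harmless, since only boundedness and convergence to 0 are read
  off.\<close>

lemma energy_add_le:
  fixes f g :: "'a::euclidean_space \<Rightarrow> 'b::{real_normed_vector,second_countable_topology}"
  assumes [measurable]: "f \<in> borel_measurable borel" "g \<in> borel_measurable borel"
  shows "energy (\<lambda>x. f x + g x) \<le> 2 * energy f + 2 * energy g"
proof -
  have "(enorm (f x + g x))\<^sup>2 \<le> 2 * (enorm (f x))\<^sup>2 + 2 * (enorm (g x))\<^sup>2" for x
  proof -
    have "(norm (f x + g x))\<^sup>2 \<le> (norm (f x) + norm (g x))\<^sup>2"
      by (intro power_mono norm_triangle_ineq) auto
    also have "\<dots> \<le> 2 * (norm (f x))\<^sup>2 + 2 * (norm (g x))\<^sup>2"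
      using zero_le_power2[of "norm (f x) - norm (g x)"] by (simp add: power2_eq_square algebra_simps)
    finally have "ennreal ((norm (f x + g x))\<^sup>2) \<le> ennreal (2 * (norm (f x))\<^sup>2 + 2 * (norm (g x))\<^sup>2)"
      by (rule ennreal_leI)
    then show ?thesis by (simp add: ennreal_power ennreal_mult')
  qed
  then have "energy (\<lambda>x. f x + g x) \<le>
      (\<integral>\<^sup>+x. 2 * (enorm (f x))\<^sup>2 + 2 * (enorm (g x))\<^sup>2 \<partial>lborel)"
    unfolding energy_def by (intro nn_integral_mono)
  also have "\<dots> = 2 * energy f + 2 * energy g"
    by (simp add: energy_def nn_integral_add nn_integral_cmult)
  finally show ?thesis .
qed

lemma energy_uminus: "energy (\<lambda>x. - f x) = energy f"
  by (simp add: energy_def)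

lemma energy_minus_commute: "edist2 f g = edist2 g f"
  by (simp add: energy_def norm_minus_commute)

lemma energy_diff_triangle:
  fixes f g h :: "'a::euclidean_space \<Rightarrow> 'b::{real_normed_vector,second_countable_topology}"
  assumes [measurable]: "f \<in> borel_measurable borel" "g \<in> borel_measurable borel" "h \<in> borel_measurable borel"
  shows "edist2 f h \<le> 2 * edist2 f g + 2 * edist2 g h"
  using energy_add_le[of "\<lambda>x. f x - g x" "\<lambda>x. g x - h x"]
    by (simp add: borel_measurable_diff[OF assms(1,2)] borel_measurable_diff[OF assms(2,3)])

lemma in_L2_diff:
  fixes f g :: "'a::euclidean_space \<Rightarrow> 'b::{real_normed_vector,second_countable_topology}"
  assumes "in_L2 f" "in_L2 g" shows "in_L2 (\<lambda>x. f x - g x)"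
proof -
  note [measurable] = assms[THEN in_L2_measurable]
  have "edist2 f g \<le> 2 * energy f + 2 * energy g"
    using energy_add_le[of f "\<lambda>x. - g x"] assms[THEN in_L2_measurable] by (simp add: energy_uminus)
  also have "\<dots> < top" using assms by (simp add: in_L2_iff ennreal_mult_less_top)
  finally show ?thesis by (simp add: in_L2_iff)
qed

lemma energy_eq_0_AE:
  assumes [measurable]: "f \<in> borel_measurable borel" and "energy f = 0"
  shows "AE x in lborel. f x = 0"
  using assms(2) unfolding energy_def by (subst (asm) nn_integral_0_iff_AE) auto

text \<open>Riesz-Fischer with a rate. The weighted series of 4^n |F(n+1) - F(n)|^2 has finite
  integral because 4/8 < 1, so almost everywhere the increments are O(2^(-n)) and the sequence
  converges; Fatou transfers the rate to the limit. The prescribed rate saves the passage to a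
  subsequence.\<close>

lemma L2_complete_rate:
  fixes F :: "nat \<Rightarrow> 'a::euclidean_space \<Rightarrow> real" and K :: real
  assumes [measurable]: "\<And>n. F n \<in> borel_measurable borel"
    and "K \<ge> 0"
    and cauchy: "\<And>n k. n \<le> k \<Longrightarrow> edist2 (F k) (F n) \<le> ennreal (K * (1/8) ^ n)"
  shows "\<exists>G. G \<in> borel_measurable borel \<and> (\<forall>n. edist2 G (F n) \<le> ennreal (K * (1/8) ^ n))"
proof -
  \<comment> \<open>\<open>lim\<close> is total: where the sequence diverges, a null set,
    \<open>G\<close> has an arbitrary value but stays measurable.\<close>
  define G where "G = (\<lambda>x. lim (\<lambda>n. F n x))"
  have [measurable]: "G \<in> borel_measurable borel" unfolding G_def by measurable
  define S where "S x = (\<Sum>n. ennreal (4 ^ n) * (enorm (F (Suc n) x - F n x))\<^sup>2)" for x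
  have [measurable]: "S \<in> borel_measurable borel" unfolding S_def by measurable
  have "(\<integral>\<^sup>+x. S x \<partial>lborel) = (\<Sum>n. ennreal (4 ^ n) * edist2 (F (Suc n)) (F n))"
    unfolding S_def energy_def by (subst nn_integral_suminf) (auto simp: nn_integral_cmult)
  also have "\<dots> \<le> (\<Sum>n. ennreal (K * (1/2) ^ n))"
  proof (intro suminf_le summableI)
    fix n
    have "ennreal (4 ^ n) * edist2 (F (Suc n)) (F n) \<le> ennreal (4 ^ n) * ennreal (K * (1/8) ^ n)"
      by (intro mult_left_mono cauchy) auto
    also have "\<dots> = ennreal (4 ^ n * (K * (1/8) ^ n))"
      using \<open>K \<ge> 0\<close> by (simp add: ennreal_mult)
    also have "4 ^ n * (K * (1/8) ^ n) = K * (4 * (1/8)) ^ n"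
      by (simp only: power_mult_distrib) simp
    also have "K * (4 * (1/8)) ^ n = K * (1/2::real) ^ n" by simp
    finally show "ennreal (4 ^ n) * edist2 (F (Suc n)) (F n) \<le> ennreal (K * (1/2) ^ n)" .
  qed
  also have "\<dots> = ennreal (\<Sum>n. K * (1/2) ^ n)"
    using \<open>K \<ge> 0\<close> by (intro suminf_ennreal2) (auto intro!: summable_mult summable_geometric)
  finally have "(\<integral>\<^sup>+x. S x \<partial>lborel) < top"
    by (meson ennreal_less_top order.strict_trans1)
  then have "AE x in lborel. S x < top"
    using nn_integral_PInf_AE[of S lborel] by (simp add: less_top)
  moreover have "(\<lambda>n. F n x) \<longlonglongrightarrow> G x" if "S x < top" for x
  proof -
    define s where "s = enn2real (S x)"
    have s: "S x = ennreal s" "s \<ge> 0" using that by (auto simp: s_def less_top)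
    have D: "norm (F (Suc n) x - F n x) \<le> sqrt s * (1/2) ^ n" for n
    proof -
      have "(\<Sum>i\<in>{n}. ennreal (4 ^ i) * (enorm (F (Suc i) x - F i x))\<^sup>2) \<le> S x"
        unfolding S_def by (rule sum_le_suminf) auto
      then have "ennreal (4 ^ n * (norm (F (Suc n) x - F n x))\<^sup>2) \<le> ennreal s"
        using s by (simp add: ennreal_mult ennreal_power)
      then have le: "4 ^ n * (norm (F (Suc n) x - F n x))\<^sup>2 \<le> s"
        using s by (subst (asm) ennreal_le_iff) auto
      have "(2 ^ n * norm (F (Suc n) x - F n x))\<^sup>2 \<le> s"
      proof -
        have "((2::real) ^ n)\<^sup>2 = 4 ^ n"
          by (simp add: power2_eq_square flip: power_mult_distrib)
        with le show ?thesis by (simp add: power_mult_distrib)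
      qed
      then have "2 ^ n * norm (F (Suc n) x - F n x) \<le> sqrt s" by (rule real_le_rsqrt)
      then show ?thesis by (simp add: field_simps power_one_over)
    qed
    have "summable (\<lambda>n. F (Suc n) x - F n x)"
      by (rule summable_comparison_test'[of "\<lambda>n. sqrt s * (1/2) ^ n" 0])
         (use D in \<open>auto intro!: summable_mult summable_geometric\<close>)
    then have "(\<lambda>n. \<Sum>i<n. F (Suc i) x - F i x) \<longlonglongrightarrow> (\<Sum>n. F (Suc n) x - F n x)"
      by (rule summable_LIMSEQ)
    then have "(\<lambda>n. F n x - F 0 x) \<longlonglongrightarrow> (\<Sum>n. F (Suc n) x - F n x)"
      unfolding sum_lessThan_telescope[of "\<lambda>i. F i x"] .
    from tendsto_add[OF this tendsto_const[of "F 0 x"]] have "convergent (\<lambda>n. F n x)"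
      by (auto simp: convergent_def)
    then show ?thesis by (simp add: G_def convergent_LIMSEQ_iff)
  qed
  ultimately have lim: "AE x in lborel. (\<lambda>n. F n x) \<longlonglongrightarrow> G x" by auto
  have "edist2 G (F n) \<le> ennreal (K * (1/8) ^ n)" for n
  proof -
    \<comment> \<open>Fatou in k with n fixed; the Cauchy bound depends on the smaller index
      only.\<close>
    have "edist2 G (F n) = (\<integral>\<^sup>+x. liminf (\<lambda>k. (enorm (F k x - F n x))\<^sup>2) \<partial>lborel)"
      unfolding energy_def
    proof (intro nn_integral_cong_AE, use lim in eventually_elim)
      case (elim x)
      have "(\<lambda>k. ennreal ((norm (F k x - F n x))\<^sup>2)) \<longlonglongrightarrow> ennreal ((norm (G x - F n x))\<^sup>2)"
        by (intro tendsto_intros elim)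
      then have "liminf (\<lambda>k. ennreal ((norm (F k x - F n x))\<^sup>2)) = ennreal ((norm (G x - F n x))\<^sup>2)"
        by (rule lim_imp_Liminf[rotated]) simp
      then show ?case by (simp add: ennreal_power)
    qed
    also have "\<dots> \<le> liminf (\<lambda>k. edist2 (F k) (F n))"
      unfolding energy_def by (intro nn_integral_liminf) measurable
    also have "\<dots> \<le> liminf (\<lambda>k. ennreal (K * (1/8) ^ n))"
      by (intro Liminf_mono eventually_sequentiallyI[of n] cauchy)
    also have "\<dots> = ennreal (K * (1/8) ^ n)" by (simp add: Liminf_const)
    finally show ?thesis .
  qed
  then show ?thesis by (intro exI[of _ G]) auto
qed

section \<open>Bessel's inequality for the Fourier transform\<close>

abbreviation wave :: "real \<Rightarrow> complex" where
  "wave r \<equiv> exp (2 * of_real pi * \<i> * of_real r)"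

abbreviation wave_neg :: "real \<Rightarrow> complex" where
  "wave_neg r \<equiv> exp (- 2 * of_real pi * \<i> * of_real r)"

text \<open>\<open>lborel\<close> is the image of the product of one-dimensional Lebesgue measures
  under the coordinate map, so tensor products integrate factor by factor.\<close>

lemma integral_lborel_prod:
  fixes f :: "'a::euclidean_space \<Rightarrow> real \<Rightarrow> complex"
  assumes "\<And>b. b \<in> Basis \<Longrightarrow> integrable lborel (f b)"
  shows "(LINT x|lborel. (\<Prod>b\<in>Basis. f b (x \<bullet> b))) = (\<Prod>b\<in>Basis. LINT t|lborel. f b t)"
    and "integrable lborel (\<lambda>x. \<Prod>b\<in>Basis. f b (x \<bullet> b))"
proof -
  interpret product_sigma_finite "\<lambda>_::'a. lborel :: real measure" ..
  have meas: "\<And>b. b \<in> Basis \<Longrightarrow> f b \<in> borel_measurable borel"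
    using assms borel_measurable_integrable by fastforce
  have [measurable]: "(\<lambda>x. \<Prod>b\<in>Basis. f b (x \<bullet> b)) \<in> borel_measurable borel"
    by (intro borel_measurable_prod measurable_compose[OF _ meas]) auto
  have comp: "(\<lambda>g. \<Prod>b\<in>Basis. f b ((\<Sum>c\<in>Basis. g c *\<^sub>R c) \<bullet> b)) = (\<lambda>g. \<Prod>b\<in>Basis. f b (g b))"
    by (intro ext prod.cong) (auto simp: inner_sum_left inner_Basis if_distrib sum.If_cases cong: if_cong)
  show "(LINT x|lborel. (\<Prod>b\<in>Basis. f b (x \<bullet> b))) = (\<Prod>b\<in>Basis. LINT t|lborel. f b t)"
    by (subst lborel_eq, subst integral_distr) (auto simp: comp intro!: product_integral_prod assms)
  show "integrable lborel (\<lambda>x. \<Prod>b\<in>Basis. f b (x \<bullet> b))"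
    by (subst lborel_eq, subst integrable_distr_eq) (auto simp: comp intro!: product_integrable_prod assms)
qed

text \<open>This is the characteristic function of the standard normal law after the substitution x
  -> \<epsilon> x, with t = -2 \<pi> s/\<epsilon>. Writing the value as a normal density of
  deviation \<epsilon>/(2 \<pi>) makes its total mass 1 available at once.\<close>

lemma normal_transform:
  assumes "\<epsilon> > 0"
  shows "(LINT x|lborel. wave_neg (s * x) * complex_of_real (exp (- (\<epsilon> * x)\<^sup>2 / 2)))
           = of_real (normal_density 0 (\<epsilon> / (2 * pi)) s)" (is "?I = _")
    and "integrable lborel (\<lambda>x. wave_neg (s * x) * complex_of_real (exp (- (\<epsilon> * x)\<^sup>2 / 2)))"
proof -
  define t where "t = - 2 * pi * s / \<epsilon>"
  let ?f = "\<lambda>x. std_normal_density x *\<^sub>R iexp (t * x)"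
  have i: "integrable lborel ?f"
    by (rule Bochner_Integration.integrable_bound[OF integrable_normal_moment[of 1 0 0]]) (auto simp: normal_density_nonneg)
  have "(LINT x|lborel. ?f x) = of_real (exp (- (t^2) / 2))"
    using fun_cong[OF char_std_normal_distribution, of t]
    by (simp add: char_def integral_density normal_density_nonneg)
  moreover have "(LINT x|lborel. ?f x) = \<epsilon> *\<^sub>R (LINT x|lborel. ?f (0 + \<epsilon> * x))"
    using assms by (subst lborel_integral_real_affine[of \<epsilon> _ 0]) auto
  moreover have eq: "?f (0 + \<epsilon> * x) = complex_of_real (1 / sqrt (2 * pi)) * (wave_neg (s * x) * complex_of_real (exp (- (\<epsilon> * x)\<^sup>2 / 2)))" for x
    using assms by (simp add: std_normal_density_def t_def scaleR_conv_of_real algebra_simps)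
  ultimately have *: "of_real \<epsilon> * (complex_of_real (1 / sqrt (2 * pi)) * ?I) = of_real (exp (- (t^2) / 2))"
    by (simp add: scaleR_conv_of_real)
  have "sqrt (2 * pi * (\<epsilon> / (2 * pi))\<^sup>2) = sqrt (2 * pi) * (\<epsilon> / (2 * pi))"
    using assms by (simp add: real_sqrt_mult)
  also have "\<dots> = \<epsilon> / sqrt (2 * pi)"
    by (metis divide_divide_eq_right mult.commute pi_ge_zero real_div_sqrt times_divide_eq_right mult_nonneg_nonneg zero_le_numeral)
  finally have sq: "sqrt (2 * pi * (\<epsilon> / (2 * pi))\<^sup>2) = \<epsilon> / sqrt (2 * pi)" .
  have "(s - 0)\<^sup>2 / (2 * (\<epsilon> / (2 * pi))\<^sup>2) = t\<^sup>2 / 2"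
    using assms by (simp add: t_def field_simps power2_eq_square)
  then have nd: "normal_density 0 (\<epsilon> / (2 * pi)) s = sqrt (2 * pi) / \<epsilon> * exp (- (t^2) / 2)"
    unfolding normal_density_def sq by simp
  have "?I = of_real (sqrt (2 * pi) / \<epsilon>) * (of_real \<epsilon> * (complex_of_real (1 / sqrt (2 * pi)) * ?I))"
    using assms by (simp add: field_simps)
  also have "\<dots> = of_real (normal_density 0 (\<epsilon> / (2 * pi)) s)"
    unfolding * nd by simp
  finally show "?I = of_real (normal_density 0 (\<epsilon> / (2 * pi)) s)" .
  have "integrable lborel (\<lambda>x. ?f (0 + \<epsilon> * x))"
    using i assms by (subst lborel_integrable_real_affine_iff) auto
  from integrable_mult_right[OF this[unfolded eq], of "complex_of_real (sqrt (2 * pi))"]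
  show "integrable lborel (\<lambda>x. wave_neg (s * x) * complex_of_real (exp (- (\<epsilon> * x)\<^sup>2 / 2)))"
    by simp
qed

definition gauss :: "real \<Rightarrow> 'a::euclidean_space \<Rightarrow> real" where
  "gauss \<sigma> y = (\<Prod>b\<in>Basis. normal_density 0 \<sigma> (y \<bullet> b))"

lemma gauss_nonneg: "0 \<le> gauss \<sigma> y"
  by (simp add: gauss_def prod_nonneg normal_density_nonneg)

lemma gauss_minus: "gauss \<sigma> (x - y) = gauss \<sigma> (y - x)"
  by (simp add: gauss_def normal_density_def inner_diff_left power2_commute)

lemma measurable_gauss [measurable]: "gauss \<sigma> \<in> borel_measurable borel"
  unfolding gauss_def by measurable

lemma nn_integral_gauss:
  assumes "\<sigma> > 0"
  shows "(\<integral>\<^sup>+x. ennreal (gauss \<sigma> (x::'a::euclidean_space)) \<partial>lborel) = 1"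
proof -
  have "(\<integral>\<^sup>+x. ennreal (gauss \<sigma> (x::'a)) \<partial>lborel)
      = (\<integral>\<^sup>+x. (\<Prod>b\<in>Basis. ennreal (normal_density 0 \<sigma> ((x::'a) \<bullet> b))) \<partial>lborel)"
    by (simp add: gauss_def prod_ennreal normal_density_nonneg)
  also have "\<dots> = (\<Prod>b\<in>(Basis::'a set). (\<integral>\<^sup>+x. ennreal (normal_density 0 \<sigma> x) \<partial>lborel))"
    by (subst nn_integral_lborel_prod) (auto simp: normal_density_nonneg)
  also have "(\<integral>\<^sup>+x. ennreal (normal_density 0 \<sigma> x) \<partial>lborel) = 1"
    using assms by (subst nn_integral_eq_integral) (auto simp: normal_density_nonneg)
  finally show ?thesis by simp
qed

lemma nn_integral_lborel_translate:
  fixes f :: "'a::euclidean_space \<Rightarrow> ennreal"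
  assumes [measurable]: "f \<in> borel_measurable borel"
  shows "(\<integral>\<^sup>+x. f (x - c) \<partial>lborel) = (\<integral>\<^sup>+x. f x \<partial>lborel)"
proof -
  have "(\<integral>\<^sup>+x. f x \<partial>lborel) = (\<integral>\<^sup>+x. f x \<partial>distr lborel borel ((+) (- c)))"
    by (simp add: lborel_distr_plus)
  also have "\<dots> = (\<integral>\<^sup>+x. f (x - c) \<partial>lborel)"
    by (subst nn_integral_distr) auto
  finally show ?thesis by simp
qed

text \<open>Phase and weight both factor over the coordinates, because the inner product and the
  squared norm are sums over the basis.\<close>

lemma gauss_transform:
  fixes y :: "'a::euclidean_space"
  assumes "\<epsilon> > 0"
  shows "(LINT x|lborel. wave_neg (y \<bullet> x) * complex_of_real (exp (- (\<epsilon> * norm x)\<^sup>2 / 2)))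
           = of_real (gauss (\<epsilon> / (2 * pi)) y)"
    and "integrable lborel (\<lambda>x. wave_neg (y \<bullet> x) * complex_of_real (exp (- (\<epsilon> * norm x)\<^sup>2 / 2)))"
proof -
  have eq: "wave_neg (y \<bullet> x) * complex_of_real (exp (- (\<epsilon> * norm x)\<^sup>2 / 2)) =
    (\<Prod>b\<in>Basis. wave_neg ((y \<bullet> b) * (x \<bullet> b)) * complex_of_real (exp (- (\<epsilon> * (x \<bullet> b))\<^sup>2 / 2)))" for x
  proof -
    have "wave_neg (y \<bullet> x) = (\<Prod>b\<in>Basis. wave_neg ((y \<bullet> b) * (x \<bullet> b)))"
      by (subst exp_sum[symmetric]) (auto simp: euclidean_inner[of y x] sum_distrib_left sum_negf)
    moreover have "exp (- (\<epsilon> * norm x)\<^sup>2 / 2) = (\<Prod>b\<in>Basis. exp (- (\<epsilon> * (x \<bullet> b))\<^sup>2 / 2))"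
    proof -
      have "(norm x)\<^sup>2 = (\<Sum>b\<in>Basis. (x \<bullet> b)\<^sup>2)"
        unfolding power2_norm_eq_inner by (subst euclidean_inner) (simp add: power2_eq_square)
      then have "- (\<epsilon> * norm x)\<^sup>2 / 2 = (\<Sum>b\<in>Basis. - (\<epsilon> * (x \<bullet> b))\<^sup>2 / 2)"
        by (simp add: power_mult_distrib sum_distrib_left sum_negf sum_divide_distrib)
      then show ?thesis by (simp add: exp_sum)
    qed
    ultimately show ?thesis by (simp add: prod.distrib)
  qed
  show "(LINT x|lborel. wave_neg (y \<bullet> x) * complex_of_real (exp (- (\<epsilon> * norm x)\<^sup>2 / 2)))
           = of_real (gauss (\<epsilon> / (2 * pi)) y)"
    unfolding eq by (subst integral_lborel_prod(1)) (use normal_transform[OF assms] in \<open>auto simp: gauss_def\<close>)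
  show "integrable lborel (\<lambda>x. wave_neg (y \<bullet> x) * complex_of_real (exp (- (\<epsilon> * norm x)\<^sup>2 / 2)))"
    unfolding eq by (rule integral_lborel_prod(2)) (rule normal_transform[OF assms])
qed

text \<open>No integrability is assumed: the Bochner integral of a non-integrable function is 0 by
  convention.\<close>

lemma ennreal_norm_integral_le:
  fixes f :: "'a \<Rightarrow> 'b::{banach, second_countable_topology}"
  shows "enorm (LINT x|M. f x) \<le> (\<integral>\<^sup>+x. enorm (f x) \<partial>M)"
  by (cases "integrable M f") (auto intro: integral_norm_bound_ennreal simp: not_integrable_integral_eq)

lemma norm_wave [simp]: "norm (exp (- 2 * of_real pi * \<i> * of_real r)) = 1" "norm (exp (2 * of_real pi * \<i> * of_real r)) = 1"
  using norm_exp_i_times[of "- 2 * pi * r"] norm_exp_i_times[of "2 * pi * r"] by (simp_all add: algebra_simps)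

lemma norm_fourier_le:
  assumes "integrable lborel u"
  shows "norm (fourier u x) \<le> (LINT x|lborel. norm (u x))"
proof -
  have "norm (fourier u x) \<le> (LINT y|lborel. norm (u y * wave_neg (y \<bullet> x)))"
    unfolding fourier_def by (rule integral_norm_bound)
  then show ?thesis by (simp add: norm_mult)
qed

lemma borel_measurable_cnj [measurable]:
  "f \<in> borel_measurable M \<Longrightarrow> (\<lambda>x. cnj (f x)) \<in> borel_measurable M"
  by (rule borel_measurable_continuous_on[where f=cnj]) (intro continuous_intros)

lemma measurable_fourier [measurable]:
  assumes [measurable]: "u \<in> borel_measurable borel"
  shows "fourier u \<in> borel_measurable borel"
  unfolding fourier_def by measurable

text \<open>The Gaussian factor makes Fubini applicable; the right-hand side then follows from Schur's test,
  since the transform of the Gaussian is again a nonnegative kernel of integral one.\<close>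

lemma bessel_regularised:
  fixes u :: "'a::euclidean_space \<Rightarrow> complex"
  assumes u: "integrable lborel u" and "\<epsilon> > 0"
  shows "(\<integral>\<^sup>+x. ennreal ((norm (fourier u x))\<^sup>2 * exp (- (\<epsilon> * norm x)\<^sup>2 / 2)) \<partial>lborel) \<le> energy u"
proof -
  have [measurable]: "u \<in> borel_measurable borel" using u by auto
  define w where "w x = exp (- (\<epsilon> * norm x)\<^sup>2 / 2)" for x :: 'a
  have [measurable]: "w \<in> borel_measurable borel" unfolding w_def by measurable
  have w: "integrable lborel w"
    using integrable_norm[OF gauss_transform(2)[OF assms(2), of "0::'a"]] by (simp add: w_def[abs_def] norm_mult)
  define e where "e x y = wave_neg (x \<bullet> y)" for x y :: 'a
  have [measurable]: "(\<lambda>x. e (f x) (g x)) \<in> borel_measurable M"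
    if [measurable]: "f \<in> borel_measurable M" "g \<in> borel_measurable M" for f g and M :: "('a \<times> 'a) measure"
    unfolding e_def by measurable
  have e_norm [simp]: "norm (e x y) = 1" for x y unfolding e_def by simp
  define B where "B = (LINT x|lborel. norm (u x))"
  have B: "norm (fourier u x) \<le> B" for x using norm_fourier_le[OF u] by (simp add: B_def)
  have B0: "0 \<le> B" unfolding B_def by simp
  define G where "G x = gauss (\<epsilon> / (2 * pi)) x" for x :: 'a
  have [measurable]: "G \<in> borel_measurable borel" unfolding G_def by measurable
  have G0: "G x \<ge> 0" for x by (simp add: G_def gauss_nonneg)
  \<comment> \<open>One dominating function for both uses of Fubini: phases have modulus 1, and the
    transform left over in the first use is at most \<open>B\<close>.\<close>
  have int2: "integrable (lborel \<Otimes>\<^sub>M lborel) (\<lambda>(x::'a, y::'a). complex_of_real (w x) * u y)"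
    by (intro lborel_pair.Fubini_integrable) (auto intro!: integrable_mult_right integrable_mult_left u w simp: norm_mult)
  \<comment> \<open>Expanding |fourier u|^2 gives the phase \<open>e (\<xi> - \<eta>) x\<close>,
    whose integral in x against the Gaussian weight is the kernel
    \<open>G (\<xi> - \<eta>)\<close>.\<close>
  have C: "(LINT x|lborel. fourier u x * cnj (fourier u x) * complex_of_real (w x))
      = (LINT \<xi>|lborel. u \<xi> * (LINT \<eta>|lborel. cnj (u \<eta>) * complex_of_real (G (\<xi> - \<eta>))))"
  proof -
    have "(LINT x|lborel. fourier u x * cnj (fourier u x) * complex_of_real (w x))
       = (LINT x|lborel. LINT \<xi>|lborel. u \<xi> * e \<xi> x * cnj (fourier u x) * complex_of_real (w x))"
      by (intro Bochner_Integration.integral_cong refl, subst integral_mult_left_zero, subst integral_mult_left_zero)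
         (simp add: fourier_def e_def)
    also have "\<dots> = (LINT \<xi>|lborel. LINT x|lborel. u \<xi> * e \<xi> x * cnj (fourier u x) * complex_of_real (w x))"
    proof (rule lborel_pair.Fubini_integral[symmetric])
      show "integrable (lborel \<Otimes>\<^sub>M lborel) (\<lambda>(x, \<xi>). u \<xi> * e \<xi> x * cnj (fourier u x) * complex_of_real (w x))"
      proof (rule Bochner_Integration.integrable_bound[OF integrable_mult_right[OF int2, of "of_real B"]])
        have [measurable]: "fourier u \<in> borel_measurable borel" by measurable
        show "(\<lambda>(x, \<xi>). u \<xi> * e \<xi> x * cnj (fourier u x) * complex_of_real (w x)) \<in> borel_measurable (lborel \<Otimes>\<^sub>M lborel)"
          by simp
        have "norm (u b) * norm (fourier u a) * \<bar>w a\<bar> \<le> norm (u b) * B * \<bar>w a\<bar>" for a b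
          by (intro mult_right_mono mult_left_mono B) auto
        then show "AE p in lborel \<Otimes>\<^sub>M lborel. norm (case p of (x, \<xi>) \<Rightarrow> u \<xi> * e \<xi> x * cnj (fourier u x) * complex_of_real (w x))
            \<le> norm (complex_of_real B * (case p of (x, y) \<Rightarrow> complex_of_real (w x) * u y))"
          by (auto simp: norm_mult B0 mult_ac intro!: AE_I2)
      qed
    qed
    also have "\<dots> = (LINT \<xi>|lborel. u \<xi> * (LINT x|lborel. e \<xi> x * cnj (fourier u x) * complex_of_real (w x)))"
      by (simp add: mult.assoc)
    also have "\<dots> = (LINT \<xi>|lborel. u \<xi> * (LINT \<eta>|lborel. cnj (u \<eta>) * complex_of_real (G (\<xi> - \<eta>))))"
    proof (rule Bochner_Integration.integral_cong[OF refl], rule arg_cong2[where f="(*)", OF refl])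
      fix \<xi> :: 'a
      have "(LINT x|lborel. e \<xi> x * cnj (fourier u x) * complex_of_real (w x))
         = (LINT x|lborel. LINT \<eta>|lborel. e \<xi> x * cnj (u \<eta> * e \<eta> x) * complex_of_real (w x))"
      proof (intro Bochner_Integration.integral_cong refl)
        fix x
        have "cnj (fourier u x) = (LINT \<eta>|lborel. cnj (u \<eta> * e \<eta> x))"
          unfolding fourier_def e_def by (rule Bochner_Integration.integral_cnj[symmetric])
        then show "e \<xi> x * cnj (fourier u x) * complex_of_real (w x) = (LINT \<eta>|lborel. e \<xi> x * cnj (u \<eta> * e \<eta> x) * complex_of_real (w x))"
          by (simp only: integral_mult_left_zero integral_mult_right_zero)
      qed
      also have "\<dots> = (LINT \<eta>|lborel. LINT x|lborel. e \<xi> x * cnj (u \<eta> * e \<eta> x) * complex_of_real (w x))"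
      proof (rule lborel_pair.Fubini_integral[symmetric])
        show "integrable (lborel \<Otimes>\<^sub>M lborel) (\<lambda>(x, \<eta>). e \<xi> x * cnj (u \<eta> * e \<eta> x) * complex_of_real (w x))"
          by (rule Bochner_Integration.integrable_bound[OF int2]) (auto simp: norm_mult)
      qed
      also have "\<dots> = (LINT \<eta>|lborel. cnj (u \<eta>) * (LINT x|lborel. e (\<xi> - \<eta>) x * complex_of_real (w x)))"
      proof (intro Bochner_Integration.integral_cong refl)
        fix \<eta> :: 'a
        have "e \<xi> x * cnj (e \<eta> x) = e (\<xi> - \<eta>) x" for x
          by (simp add: e_def exp_cnj inner_diff_left algebra_simps flip: exp_add)
        then have "e \<xi> x * cnj (u \<eta> * e \<eta> x) * complex_of_real (w x) = cnj (u \<eta>) * (e (\<xi> - \<eta>) x * complex_of_real (w x))" for x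
          by (metis (no_types, lifting) complex_cnj_mult mult.assoc mult.left_commute)
        then show "(LINT x|lborel. e \<xi> x * cnj (u \<eta> * e \<eta> x) * complex_of_real (w x)) = cnj (u \<eta>) * (LINT x|lborel. e (\<xi> - \<eta>) x * complex_of_real (w x))"
          by (simp only: integral_mult_right_zero)
      qed
      also have "\<dots> = (LINT \<eta>|lborel. cnj (u \<eta>) * complex_of_real (G (\<xi> - \<eta>)))"
        unfolding e_def w_def G_def gauss_transform(1)[OF assms(2)] ..
      finally show "(LINT x|lborel. e \<xi> x * cnj (fourier u x) * complex_of_real (w x)) = (LINT \<eta>|lborel. cnj (u \<eta>) * complex_of_real (G (\<xi> - \<eta>)))" .
    qed
    finally show ?thesis .
  qed
  have "(\<integral>\<^sup>+x. ennreal ((norm (fourier u x))\<^sup>2 * w x) \<partial>lborel) = ennreal (LINT x|lborel. (norm (fourier u x))\<^sup>2 * w x)"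
  proof (rule nn_integral_eq_integral)
    show "integrable lborel (\<lambda>x. (norm (fourier u x))\<^sup>2 * w x)"
      by (rule Bochner_Integration.integrable_bound[OF integrable_mult_right[OF w, of "B\<^sup>2"]])
         (auto simp: abs_mult w_def intro!: mult_right_mono power_mono B)
  qed (simp add: w_def)
  also have "(LINT x|lborel. (norm (fourier u x))\<^sup>2 * w x) = norm (LINT x|lborel. fourier u x * cnj (fourier u x) * complex_of_real (w x))"
  proof -
    have "fourier u x * cnj (fourier u x) * complex_of_real (w x) = of_real ((norm (fourier u x))\<^sup>2 * w x)" for x
      by (simp only: of_real_mult complex_norm_square)
    then show ?thesis by (simp add: w_def del: of_real_mult)
  qed
  also have "ennreal \<dots> \<le> (\<integral>\<^sup>+\<xi>. \<integral>\<^sup>+\<eta>. enorm (u \<xi>) * (enorm (u \<eta>) * ennreal (G (\<xi> - \<eta>))) \<partial>lborel \<partial>lborel)"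
  proof -
    have "enorm (LINT \<xi>|lborel. u \<xi> * (LINT \<eta>|lborel. cnj (u \<eta>) * complex_of_real (G (\<xi> - \<eta>))))
      \<le> (\<integral>\<^sup>+\<xi>. enorm (u \<xi>) * enorm (LINT \<eta>|lborel. cnj (u \<eta>) * complex_of_real (G (\<xi> - \<eta>))) \<partial>lborel)"
      by (rule order.trans[OF ennreal_norm_integral_le]) (simp add: norm_mult ennreal_mult)
    also have "\<dots> \<le> (\<integral>\<^sup>+\<xi>. enorm (u \<xi>) * (\<integral>\<^sup>+\<eta>. (enorm (u \<eta>) * ennreal (G (\<xi> - \<eta>))) \<partial>lborel) \<partial>lborel)"
      by (intro nn_integral_mono mult_left_mono order.trans[OF ennreal_norm_integral_le])
         (auto simp: norm_mult ennreal_mult G0)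
    finally show ?thesis unfolding C by (simp add: nn_integral_cmult)
  qed
  \<comment> \<open>Schur's test through 2 a b <= a^2 + b^2. The kernel is even and has mass 1 in
    each variable, so each half yields half of \<open>energy u\<close>.\<close>
  also have "\<dots> \<le> (\<integral>\<^sup>+\<xi>. \<integral>\<^sup>+\<eta>. ennreal (1/2) * (enorm (u \<xi>))\<^sup>2 * ennreal (G (\<xi> - \<eta>)) +
       ennreal (1/2) * (enorm (u \<eta>))\<^sup>2 * ennreal (G (\<xi> - \<eta>)) \<partial>lborel \<partial>lborel)"
  proof (intro nn_integral_mono)
    fix \<xi> \<eta> :: 'a
    have "norm (u \<xi>) * norm (u \<eta>) \<le> 1/2 * (norm (u \<xi>))\<^sup>2 + 1/2 * (norm (u \<eta>))\<^sup>2"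
      using zero_le_power2[of "norm (u \<xi>) - norm (u \<eta>)"] by (simp add: power2_eq_square algebra_simps)
    then have "norm (u \<xi>) * (norm (u \<eta>) * G (\<xi> - \<eta>)) \<le> 1/2 * (norm (u \<xi>))\<^sup>2 * G (\<xi> - \<eta>) + 1/2 * (norm (u \<eta>))\<^sup>2 * G (\<xi> - \<eta>)"
      using mult_right_mono[OF _ G0[of "\<xi> - \<eta>"]] by (fastforce simp: algebra_simps)
    note le = this
    show "enorm (u \<xi>) * (enorm (u \<eta>) * ennreal (G (\<xi> - \<eta>)))
       \<le> ennreal (1/2) * (enorm (u \<xi>))\<^sup>2 * ennreal (G (\<xi> - \<eta>)) + ennreal (1/2) * (enorm (u \<eta>))\<^sup>2 * ennreal (G (\<xi> - \<eta>))"
    proof -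
      have *: "ennreal q * (ennreal r)\<^sup>2 * ennreal s = ennreal (q * r\<^sup>2 * s)" if "q \<ge> 0" "r \<ge> 0" "s \<ge> 0" for q r s
        using that by (simp add: ennreal_mult ennreal_power)
      show ?thesis
        using ennreal_leI[OF le] by (simp add: * G0 ennreal_mult ennreal_plus[symmetric] del: ennreal_plus ennreal_half)
    qed
  qed
  also have "\<dots> = (\<integral>\<^sup>+\<xi>. \<integral>\<^sup>+\<eta>. ennreal (1/2) * (enorm (u \<xi>))\<^sup>2 * ennreal (G (\<eta> - \<xi>)) \<partial>lborel \<partial>lborel)
     + (\<integral>\<^sup>+\<eta>. \<integral>\<^sup>+\<xi>. ennreal (1/2) * (enorm (u \<eta>))\<^sup>2 * ennreal (G (\<xi> - \<eta>)) \<partial>lborel \<partial>lborel)"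
  proof -
    have "(\<integral>\<^sup>+\<xi>. \<integral>\<^sup>+\<eta>. ennreal (1/2) * (enorm (u \<eta>))\<^sup>2 * ennreal (G (\<xi> - \<eta>)) \<partial>lborel \<partial>lborel)
      = (\<integral>\<^sup>+\<eta>. \<integral>\<^sup>+\<xi>. ennreal (1/2) * (enorm (u \<eta>))\<^sup>2 * ennreal (G (\<xi> - \<eta>)) \<partial>lborel \<partial>lborel)"
      by (rule lborel_pair.Fubini') measurable
    moreover have "G (\<xi> - \<eta>) = G (\<eta> - \<xi>)" for \<xi> \<eta> unfolding G_def by (rule gauss_minus)
    then have "(\<integral>\<^sup>+\<xi>. \<integral>\<^sup>+\<eta>. ennreal (1/2) * (enorm (u \<xi>))\<^sup>2 * ennreal (G (\<xi> - \<eta>)) \<partial>lborel \<partial>lborel)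
      = (\<integral>\<^sup>+\<xi>. \<integral>\<^sup>+\<eta>. ennreal (1/2) * (enorm (u \<xi>))\<^sup>2 * ennreal (G (\<eta> - \<xi>)) \<partial>lborel \<partial>lborel)"
      by (intro nn_integral_cong) (rule arg_cong)
    ultimately show ?thesis by (simp add: nn_integral_add)
  qed
  also have "\<dots> = ennreal (1/2) * energy u + ennreal (1/2) * energy u"
  proof -
    have "(\<integral>\<^sup>+\<eta>. \<integral>\<^sup>+\<xi>. ennreal (1/2) * (enorm (u \<eta>))\<^sup>2 * ennreal (G (\<xi> - \<eta>)) \<partial>lborel \<partial>lborel) = ennreal (1/2) * energy u"
    proof -
      have "(\<integral>\<^sup>+\<xi>. ennreal (G (\<xi> - \<eta>)) \<partial>lborel) = 1" for \<eta>
        using assms(2) nn_integral_lborel_translate[of "\<lambda>x. ennreal (G x)" \<eta>] by (simp add: G_def nn_integral_gauss)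
      then have "(\<integral>\<^sup>+\<xi>. ennreal (1/2) * (enorm (u \<eta>))\<^sup>2 * ennreal (G (\<xi> - \<eta>)) \<partial>lborel) = ennreal (1/2) * (enorm (u \<eta>))\<^sup>2" for \<eta>
        by (subst nn_integral_cmult) auto
      then show ?thesis unfolding energy_def by (simp add: nn_integral_cmult del: ennreal_half)
    qed
    then show ?thesis by simp
  qed
  also have "\<dots> = energy u"
  proof -
    have "ennreal (1/2) + ennreal (1/2) = 1"
      by (subst ennreal_plus[symmetric]) auto
    then show ?thesis by (metis distrib_right mult_1)
  qed
  finally show ?thesis by (simp add: w_def)
qed

text \<open>The regularised bound does not depend on \<epsilon>. Along \<epsilon> = 1/(n+1) the
  weight tends to 1 pointwise, and Fatou removes it.\<close>

lemma bessel:
  fixes u :: "'a::euclidean_space \<Rightarrow> complex"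
  assumes u: "integrable lborel u"
  shows "energy (fourier u) \<le> energy u"
proof -
  have [measurable]: "u \<in> borel_measurable borel" using u by auto
  define h where "h n x = ennreal ((norm (fourier u x))\<^sup>2 * exp (- (1 / real (Suc n) * norm x)\<^sup>2 / 2))" for n x
  have lim: "(\<lambda>n. h n x) \<longlonglongrightarrow> (enorm (fourier u x))\<^sup>2" for x
  proof -
    have "(\<lambda>n. 1 / real (Suc n)) \<longlonglongrightarrow> 0"
      using LIMSEQ_inverse_real_of_nat by (simp add: inverse_eq_divide)
    then have "(\<lambda>n. (1 / real (Suc n) * norm x)) \<longlonglongrightarrow> 0 * norm x"
      by (rule tendsto_mult[OF _ tendsto_const])
    moreover have "(\<lambda>n. c * exp (- (r n)\<^sup>2 / 2)) \<longlonglongrightarrow> c * exp (- l\<^sup>2 / 2)" if "r \<longlonglongrightarrow> l"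
      for c l :: real and r :: "nat \<Rightarrow> real"
      using that by (intro tendsto_intros) auto
    ultimately have "(\<lambda>n. (norm (fourier u x))\<^sup>2 * exp (- (1 / real (Suc n) * norm x)\<^sup>2 / 2)) \<longlonglongrightarrow> (norm (fourier u x))\<^sup>2 * exp (- (0 * norm x)\<^sup>2 / 2)"
      by blast
    from tendsto_ennrealI[OF this] have "(\<lambda>n. h n x) \<longlonglongrightarrow> ennreal ((norm (fourier u x))\<^sup>2)"
      unfolding h_def by simp
    then show ?thesis by (simp add: ennreal_power)
  qed
  have "energy (fourier u) = (\<integral>\<^sup>+x. liminf (\<lambda>n. h n x) \<partial>lborel)"
    unfolding energy_def by (intro nn_integral_cong) (simp add: lim_imp_Liminf[OF _ lim])
  also have "\<dots> \<le> liminf (\<lambda>n. \<integral>\<^sup>+x. h n x \<partial>lborel)"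
    by (intro nn_integral_liminf) (auto simp: h_def)
  also have "\<dots> \<le> liminf (\<lambda>n::nat. energy u)"
    unfolding h_def by (intro Liminf_mono always_eventually allI bessel_regularised u) auto
  also have "\<dots> = energy u" by (simp add: Liminf_const)
  finally show ?thesis .
qed

section \<open>Test functions\<close>

lemma has_vector_derivative_quotient:
  fixes g :: "real \<Rightarrow> 'b::real_normed_vector"
  assumes "(g has_vector_derivative d) (at 0)"
  shows "((\<lambda>s. (g s - g 0) /\<^sub>R s) \<longlongrightarrow> d) (at 0)"
proof -
  have "((\<lambda>y. (g y - g 0 - y *\<^sub>R d) /\<^sub>R \<bar>y\<bar>) \<longlongrightarrow> 0) (at 0)"
    using assms by (simp add: has_vector_derivative_def has_derivative_at_within)
  then have "((\<lambda>y. norm ((g y - g 0 - y *\<^sub>R d) /\<^sub>R \<bar>y\<bar>)) \<longlongrightarrow> 0) (at 0)"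
    by (rule tendsto_norm_zero)
  moreover have "\<forall>\<^sub>F y in at 0. norm ((g y - g 0 - y *\<^sub>R d) /\<^sub>R \<bar>y\<bar>) = norm ((g y - g 0) /\<^sub>R y - d)"
    unfolding eventually_at_filter
  proof (intro always_eventually allI impI)
    fix y :: real assume "y \<noteq> 0"
    then have "(g y - g 0) /\<^sub>R y - d = (g y - g 0 - y *\<^sub>R d) /\<^sub>R y"
      by (simp add: scaleR_diff_right)
    then show "norm ((g y - g 0 - y *\<^sub>R d) /\<^sub>R \<bar>y\<bar>) = norm ((g y - g 0) /\<^sub>R y - d)" by simp
  qed
  ultimately have "((\<lambda>y. norm ((g y - g 0) /\<^sub>R y - d)) \<longlongrightarrow> 0) (at 0)"
    by (rule Lim_transform_eventually)
  then show ?thesis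
    by (simp add: tendsto_norm_zero_iff LIM_zero_iff)
qed

text \<open>Differentiability is assumed only at parameter 0, but from every base point; moving the
  base point to x + t v gives it at every t.\<close>

lemma has_vector_derivative_partial_deriv:
  assumes "\<And>x. (\<lambda>t::real. f (x + t *\<^sub>R v)) differentiable (at 0)"
  shows "((\<lambda>s. f (x + s *\<^sub>R v)) has_vector_derivative partial_deriv v f (x + t *\<^sub>R v)) (at t)"
proof -
  have *: "((\<lambda>s. f ((x + t *\<^sub>R v) + s *\<^sub>R v)) has_vector_derivative partial_deriv v f (x + t *\<^sub>R v)) (at (t - t))"
    using assms[of "x + t *\<^sub>R v"] unfolding partial_deriv_def by (simp add: vector_derivative_works)
  have "((\<lambda>s. s - t) has_vector_derivative 1) (at t)"
    by (auto intro!: derivative_eq_intros)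
  from vector_diff_chain_at[OF this *]
  show ?thesis by (simp add: o_def algebra_simps)
qed

lemma Ck_has_vector_derivative:
  assumes "Ck (Suc k) f" "v \<in> Basis"
  shows "((\<lambda>s. f (x + s *\<^sub>R v)) has_vector_derivative partial_deriv v f (x + t *\<^sub>R v)) (at t)"
  using assms by (intro has_vector_derivative_partial_deriv) auto

lemma Ck_SucI:
  assumes "continuous_on UNIV f"
    and der: "\<And>v x. v \<in> Basis \<Longrightarrow> ((\<lambda>t. f (x + t *\<^sub>R v)) has_vector_derivative f' v x) (at 0)"
    and "\<And>v. v \<in> Basis \<Longrightarrow> Ck k (f' v)"
  shows "Ck (Suc k) f"
proof -
  have "partial_deriv v f = f' v" if "v \<in> Basis" for v
    using der[OF that] by (auto simp: partial_deriv_def vector_derivative_at)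
  with assms show ?thesis
    by (auto simp: differentiable_def has_vector_derivative_def)
qed

lemma Ck_Suc_partial:
  assumes "Ck (Suc k) f" "v \<in> Basis"
  shows "((\<lambda>t. f (x + t *\<^sub>R v)) has_vector_derivative partial_deriv v f x) (at 0)"
  using Ck_has_vector_derivative[OF assms, of x 0] by simp

lemma Ck_continuous: "Ck k f \<Longrightarrow> continuous_on UNIV f"
  by (cases k) auto

lemma Ck_Suc_imp: "Ck (Suc k) f \<Longrightarrow> Ck k f"
  by (induction k arbitrary: f) (auto simp: Ck_continuous)

lemma Ck_const: "Ck k (\<lambda>x. c)"
proof (induction k arbitrary: c)
  case (Suc k)
  show ?case by (rule Ck_SucI[where f'="\<lambda>v x. 0"]) (auto intro: Suc)
qed auto

lemma Ck_add: "Ck k f \<Longrightarrow> Ck k g \<Longrightarrow> Ck k (\<lambda>x. f x + g x)"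
proof (induction k arbitrary: f g)
  case (Suc k)
  have 1: "continuous_on UNIV f" "continuous_on UNIV g" using Suc.prems by (auto intro: Ck_continuous)
  show ?case
  proof (rule Ck_SucI[where f'="\<lambda>v x. partial_deriv v f x + partial_deriv v g x"])
    show "continuous_on UNIV (\<lambda>x. f x + g x)" using 1 by (intro continuous_intros)
    fix v :: 'a assume v: "v \<in> Basis"
    show "((\<lambda>t. f (x + t *\<^sub>R v) + g (x + t *\<^sub>R v)) has_vector_derivative partial_deriv v f x + partial_deriv v g x) (at 0)" for x
      using Ck_Suc_partial[OF Suc.prems(1) v] Ck_Suc_partial[OF Suc.prems(2) v] by (rule has_vector_derivative_add)
    show "Ck k (\<lambda>x. partial_deriv v f x + partial_deriv v g x)"
      using Suc.prems v by (intro Suc.IH) auto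
  qed
qed (auto intro!: continuous_intros)

lemma Ck_mult:
  fixes f g :: "'a::euclidean_space \<Rightarrow> 'b::real_normed_algebra"
  shows "Ck k f \<Longrightarrow> Ck k g \<Longrightarrow> Ck k (\<lambda>x. f x * g x)"
proof (induction k arbitrary: f g)
  case (Suc k)
  have 1: "continuous_on UNIV f" "continuous_on UNIV g" using Suc.prems by (auto intro: Ck_continuous)
  show ?case
  proof (rule Ck_SucI[where f'="\<lambda>v x. f x * partial_deriv v g x + partial_deriv v f x * g x"])
    show "continuous_on UNIV (\<lambda>x. f x * g x)" using 1 by (intro continuous_intros)
    fix v :: 'a assume v: "v \<in> Basis"
    show "((\<lambda>t. f (x + t *\<^sub>R v) * g (x + t *\<^sub>R v)) has_vector_derivative f x * partial_deriv v g x + partial_deriv v f x * g x) (at 0)" for x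
      using has_vector_derivative_mult[OF Ck_Suc_partial[OF Suc.prems(1) v] Ck_Suc_partial[OF Suc.prems(2) v], of x x] by simp
    show "Ck k (\<lambda>x. f x * partial_deriv v g x + partial_deriv v f x * g x)"
      using Suc.prems v Suc.prems[THEN Ck_Suc_imp] by (intro Ck_add Suc.IH) auto
  qed
qed (auto intro!: continuous_intros)

lemma Ck_prod:
  fixes f :: "'i \<Rightarrow> 'a::euclidean_space \<Rightarrow> complex"
  assumes "\<And>i. i \<in> I \<Longrightarrow> Ck k (f i)"
  shows "Ck k (\<lambda>x. \<Prod>i\<in>I. f i x)"
  using assms by (induction I rule: infinite_finite_induct) (auto intro: Ck_const Ck_mult)

section \<open>Smooth functions of compact support\<close>

lemma test_funI:
  assumes "\<And>k. Ck k f" "\<And>x. f x \<noteq> 0 \<Longrightarrow> norm x \<le> R"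
  shows "test_fun f"
  using assms by (auto simp: test_fun_def compact_closure bounded_iff)

lemma test_fun_support:
  assumes "test_fun f" obtains R where "R \<ge> 0" "\<And>x. norm x > R \<Longrightarrow> f x = 0"
proof -
  from assms obtain R where "\<And>x. f x \<noteq> 0 \<Longrightarrow> norm x \<le> R"
    by (auto simp: test_fun_def compact_closure bounded_iff)
  then show ?thesis by (intro that[of "max 0 R"]) fastforce+
qed

lemma test_fun_Ck: "test_fun f \<Longrightarrow> Ck k f"
  by (simp add: test_fun_def)

lemma test_fun_add:
  assumes "test_fun f" "test_fun g" shows "test_fun (\<lambda>x. f x + g x)"
proof -
  obtain R S where R: "\<And>x. norm x > R \<Longrightarrow> f x = 0" and S: "\<And>x. norm x > S \<Longrightarrow> g x = 0"
    by (meson assms test_fun_support)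
  show ?thesis
  proof (rule test_funI)
    show "Ck k (\<lambda>x. f x + g x)" for k using assms by (intro Ck_add test_fun_Ck)
    fix x assume "f x + g x \<noteq> 0" then show "norm x \<le> max R S" using R[of x] S[of x] by fastforce
  qed
qed

lemma test_fun_cmult:
  assumes "test_fun f" shows "test_fun (\<lambda>x. c * f x)"
proof -
  obtain R where R: "\<And>x. norm x > R \<Longrightarrow> f x = 0" by (meson assms test_fun_support)
  show ?thesis
  proof (rule test_funI)
    show "Ck k (\<lambda>x. c * f x)" for k using assms by (intro Ck_mult Ck_const test_fun_Ck)
    fix x assume "c * f x \<noteq> 0" then show "norm x \<le> R" using R[of x] by fastforce
  qed
qed

lemma test_fun_diff:
  assumes "test_fun f" "test_fun g" shows "test_fun (\<lambda>x. f x - g x)"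
  using test_fun_add[OF assms(1) test_fun_cmult[OF assms(2), of "-1"]] by simp

text \<open>Off the closed ball of radius \<open>R\<close> the function vanishes for all small t
  along the line, so the derivative is 0 there and the support does not grow.\<close>

lemma test_fun_partial_deriv:
  assumes "test_fun f" "v \<in> Basis" shows "test_fun (partial_deriv v f)"
proof -
  obtain R where R: "\<And>x. norm x > R \<Longrightarrow> f x = 0" by (meson assms test_fun_support)
  show ?thesis
  proof (rule test_funI)
    show "Ck k (partial_deriv v f)" for k using test_fun_Ck[OF assms(1), of "Suc k"] assms(2) by auto
    fix x assume nz: "partial_deriv v f x \<noteq> 0"
    show "norm x \<le> R"
    proof (rule ccontr)
      assume "\<not> norm x \<le> R"
      then have "\<forall>\<^sub>F t in at 0. norm (x + t *\<^sub>R v) > R"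
        by (intro order_tendstoD(1)[of _ "norm (x + 0 *\<^sub>R v)"] tendsto_intros) auto
      then have "\<forall>\<^sub>F t in at 0. f (x + t *\<^sub>R v) = 0"
        by eventually_elim (rule R)
      then have "\<forall>\<^sub>F t in nhds 0. f (x + t *\<^sub>R v) = 0"
        using R[of x] \<open>\<not> norm x \<le> R\<close> by (auto simp: eventually_nhds_conv_at)
      then have "((\<lambda>t. f (x + t *\<^sub>R v)) has_vector_derivative 0) (at 0)"
        by (subst has_vector_derivative_cong_ev[where g="\<lambda>_. 0"])
           (use R[of x] \<open>\<not> norm x \<le> R\<close> in \<open>auto elim: eventually_mono\<close>)
      then show False using nz by (simp add: partial_deriv_def vector_derivative_at)
    qed
  qed
qed

lemma test_fun_measurable:
  assumes "test_fun f" shows "f \<in> borel_measurable borel"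
  using test_fun_Ck[OF assms, of 0] by (simp add: borel_measurable_continuous_onI)

lemma test_fun_bounded:
  assumes "test_fun f" obtains B where "B \<ge> 0" "\<And>x. norm (f x) \<le> B"
proof -
  obtain R where R: "R \<ge> 0" "\<And>x. norm x > R \<Longrightarrow> f x = 0" by (meson assms test_fun_support)
  have "continuous_on (cball 0 R) f"
    using test_fun_Ck[OF assms, of 0] by (auto intro: continuous_on_subset)
  then have "bounded (f ` cball 0 R)"
    by (intro compact_imp_bounded compact_continuous_image) auto
  then obtain B where B: "\<And>x. x \<in> cball 0 R \<Longrightarrow> norm (f x) \<le> B"
    unfolding bounded_iff by blast
  have "norm (f x) \<le> max 0 B" for x
    using B[of x] R(2)[of x] by (cases "norm x \<le> R") auto
  then show ?thesis by (intro that[of "max 0 B"]) auto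
qed

lemma integrable_cball_indicator: "integrable lborel (\<lambda>x::'a::euclidean_space. B * indicator (cball 0 R) x :: real)"
  by (intro integrable_mult_right integrable_real_indicator) (use emeasure_bounded_finite[of "cball (0::'a) R"] in auto)

lemma test_fun_integrable:
  assumes "test_fun f" shows "integrable lborel f"
proof -
  obtain R where R: "R \<ge> 0" "\<And>x. norm x > R \<Longrightarrow> f x = 0" by (meson assms test_fun_support)
  obtain B where B: "B \<ge> 0" "\<And>x. norm (f x) \<le> B" by (meson assms test_fun_bounded)
  show ?thesis
    by (rule Bochner_Integration.integrable_bound[OF integrable_cball_indicator[of B R]])
       (use R B test_fun_measurable[OF assms] in \<open>auto simp: indicator_def not_le intro!: AE_I2\<close>)
qed

lemma test_fun_in_L2:
  assumes "test_fun f" shows "in_L2 f"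
proof -
  obtain B where B: "B \<ge> 0" "\<And>x. norm (f x) \<le> B" by (meson assms test_fun_bounded)
  have "energy f \<le> (\<integral>\<^sup>+x. ennreal B * enorm (f x) \<partial>lborel)"
    unfolding energy_def power2_eq_square by (intro nn_integral_mono mult_right_mono ennreal_leI B) auto
  also have "\<dots> < top"
    using test_fun_integrable[OF assms] test_fun_measurable[OF assms]
    by (simp add: nn_integral_cmult ennreal_mult_less_top integrable_iff_bounded)
  finally show ?thesis using test_fun_measurable[OF assms] by (simp add: in_L2_iff)
qed

section \<open>Decay of the Fourier transform of a test function\<close>

lemma integral_lborel_translate:
  fixes f :: "'a::euclidean_space \<Rightarrow> complex"
  assumes [measurable]: "f \<in> borel_measurable borel"
  shows "(LINT x|lborel. f (x + c)) = (LINT x|lborel. f x)"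
proof -
  have "(LINT x|lborel. f x) = (LINT x|distr lborel borel ((+) c). f x)"
    by (simp add: lborel_distr_plus)
  also have "\<dots> = (LINT x|lborel. f (x + c))"
    by (subst integral_distr) (auto simp: add.commute)
  finally show ?thesis by simp
qed

lemma integrable_mult_exp:
  assumes "integrable lborel f"
  shows "integrable lborel (\<lambda>x::'a::euclidean_space. f x * wave_neg (x \<bullet> \<xi>))"
  by (rule Bochner_Integration.integrable_bound[OF assms]) (use assms in \<open>auto simp: norm_mult\<close>)

lemma fourier_diff:
  assumes "integrable lborel f" "integrable lborel g"
  shows "fourier (\<lambda>x. f x - g x) \<xi> = fourier f \<xi> - fourier g \<xi>"
  unfolding fourier_def using assms[THEN integrable_mult_exp] by (simp add: left_diff_distrib)

text \<open>Obtained by passing to the limit in difference quotients, which needs no Fubini argument.\<close>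

lemma fourier_partial_deriv:
  assumes f: "test_fun f" and v: "v \<in> Basis"
  shows "fourier (partial_deriv v f) \<xi> = 2 * of_real pi * \<i> * of_real (v \<bullet> \<xi>) * fourier f \<xi>"
proof -
  define h where "h n = 1 / real (Suc n)" for n
  have h: "h n > 0" "h n \<le> 1" for n by (auto simp: h_def)
  have h0: "h \<longlonglongrightarrow> 0" unfolding h_def using LIMSEQ_inverse_real_of_nat by (simp add: inverse_eq_divide)
  then have h0': "filterlim h (at 0) sequentially"
    by (rule filterlim_atI) (simp add: h_def)
  note [measurable] = test_fun_measurable[OF f] test_fun_measurable[OF test_fun_partial_deriv[OF f v]]
  define E where "E x = wave_neg (x \<bullet> \<xi>)" for x
  have [measurable]: "E \<in> borel_measurable borel" unfolding E_def by measurable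
  have E [simp]: "norm (E x) = 1" for x unfolding E_def by simp
  define D where "D n x = (f (x + h n *\<^sub>R v) - f x) /\<^sub>R h n" for n x
  obtain R where R: "R \<ge> 0" "\<And>x. norm x > R \<Longrightarrow> f x = 0" by (meson f test_fun_support)
  obtain B where B: "B \<ge> 0" "\<And>x. norm (partial_deriv v f x) \<le> B" by (meson test_fun_partial_deriv[OF f v] test_fun_bounded)
  \<comment> \<open>Mean value inequality inside the ball. Since \<open>h n\<close> is at most 1,
    the quotients vanish outside radius \<open>R + 1\<close>, which gives one integrable majorant
    for all n.\<close>
  have Dbound: "norm (D n x) \<le> B * indicator (cball 0 (R + 1)) x" for n x
  proof (cases "norm x \<le> R + 1")
    case True
    have "norm (f (x + h n *\<^sub>R v) - f (x + 0 *\<^sub>R v)) \<le> B * norm (h n - 0)"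
      by (rule differentiable_bound[of UNIV _ "\<lambda>t s. s *\<^sub>R partial_deriv v f (x + t *\<^sub>R v)"])
         (use Ck_has_vector_derivative[OF test_fun_Ck[OF f] v] B in
           \<open>auto simp: has_vector_derivative_def intro!: onorm_le simp: mult.commute[of B] mult_left_mono\<close>)
    then have "norm (f (x + h n *\<^sub>R v) - f x) / h n \<le> B"
      using h(1)[of n] by (simp add: divide_le_eq)
    with True h(1)[of n] show ?thesis by (simp add: D_def divide_inverse mult.commute)
  next
    case False
    have "norm x \<le> norm (x + h n *\<^sub>R v) + norm (h n *\<^sub>R v)"
      using norm_triangle_ineq4[of "x + h n *\<^sub>R v" "h n *\<^sub>R v"] by simp
    also have "norm (h n *\<^sub>R v) \<le> 1" using h[of n] v by simp
    finally have "norm (x + h n *\<^sub>R v) > R" using False by simp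
    with False R(2)[of x] R(2)[of "x + h n *\<^sub>R v"] show ?thesis by (simp add: D_def)
  qed
  have lim1: "(\<lambda>n. LINT x|lborel. D n x * E x) \<longlonglongrightarrow> (LINT x|lborel. partial_deriv v f x * E x)"
  proof (rule integral_dominated_convergence[OF _ _ integrable_cball_indicator[of B "R + 1"]])
    show "AE x in lborel. (\<lambda>n. D n x * E x) \<longlonglongrightarrow> partial_deriv v f x * E x"
    proof (intro AE_I2 tendsto_intros)
      fix x
      have "((\<lambda>s. (f (x + s *\<^sub>R v) - f x) /\<^sub>R s) \<longlongrightarrow> partial_deriv v f x) (at 0)"
        using has_vector_derivative_quotient[OF Ck_Suc_partial[OF test_fun_Ck[OF f] v, of x]] by simp
      from filterlim_compose[OF this h0'] show "(\<lambda>n. D n x) \<longlonglongrightarrow> partial_deriv v f x"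
        unfolding D_def .
    qed
    show "AE x in lborel. norm (D n x * E x) \<le> B * indicator (cball 0 (R + 1)) x" for n
      using Dbound by (auto simp: norm_mult)
  qed (auto simp: D_def)
  \<comment> \<open>Translation by h v multiplies the transform by exp(2 \<pi> i h v . \<xi>), so
    the difference quotient becomes a scalar difference quotient of the exponential.\<close>
  have tr: "(LINT x|lborel. D n x * E x) = (exp (2 * of_real pi * \<i> * of_real (v \<bullet> \<xi>) * of_real (h n)) - 1) / of_real (h n) * fourier f \<xi>" for n
  proof -
    define c where "c = exp (2 * of_real pi * \<i> * of_real (v \<bullet> \<xi>) * of_real (h n))"
    have "c * E (x + h n *\<^sub>R v) = E x" for x
      by (simp add: E_def c_def inner_add_left algebra_simps flip: exp_add)
    then have cE: "c * (f (x + h n *\<^sub>R v) * E (x + h n *\<^sub>R v)) = f (x + h n *\<^sub>R v) * E x" for x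
      by (simp add: mult.left_commute)
    have "D n x * E x = (f (x + h n *\<^sub>R v) * E x - f x * E x) / of_real (h n)" for x
      by (simp add: D_def scaleR_conv_of_real divide_inverse algebra_simps)
    then have eq: "D n x * E x = (c * (f (x + h n *\<^sub>R v) * E (x + h n *\<^sub>R v)) - f x * E x) / of_real (h n)" for x
      by (simp only: cE)
    have i: "integrable lborel (\<lambda>x. f x * E x)"
      unfolding E_def by (rule integrable_mult_exp[OF test_fun_integrable[OF f]])
    have i2: "integrable lborel (\<lambda>x. f (x + h n *\<^sub>R v) * E (x + h n *\<^sub>R v))"
    proof -
      have "integrable (distr lborel borel ((+) (h n *\<^sub>R v))) (\<lambda>x. f x * E x)"
        using i by (simp add: lborel_distr_plus)
      then show ?thesis by (subst (asm) integrable_distr_eq) (auto simp: add.commute)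
    qed
    show ?thesis
    proof -
      have F: "fourier f \<xi> = (LINT x|lborel. f x * E x)" by (simp add: fourier_def E_def)
      have tr: "(LINT x|lborel. f (x + h n *\<^sub>R v) * E (x + h n *\<^sub>R v)) = fourier f \<xi>"
        unfolding F by (rule integral_lborel_translate) measurable
      have "(LINT x|lborel. D n x * E x) = (c * fourier f \<xi> - fourier f \<xi>) / of_real (h n)"
        unfolding eq integral_divide_zero
        by (subst Bochner_Integration.integral_diff) (use i i2 tr F in auto)
      then show ?thesis by (simp add: c_def left_diff_distrib)
    qed
  qed
  have "(\<lambda>n. (exp (2 * of_real pi * \<i> * of_real (v \<bullet> \<xi>) * of_real (h n)) - 1) / of_real (h n) * fourier f \<xi>)
     \<longlonglongrightarrow> (2 * of_real pi * \<i> * of_real (v \<bullet> \<xi>)) * fourier f \<xi>"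
  proof (intro tendsto_mult tendsto_const)
    define w where "w = 2 * of_real pi * \<i> * complex_of_real (v \<bullet> \<xi>)"
    have "((\<lambda>z. exp (w * z)) has_field_derivative w) (at 0)"
      by (auto intro!: derivative_eq_intros)
    then have "((\<lambda>z. (exp (w * z) - 1) / z) \<longlongrightarrow> w) (at 0)"
      by (simp add: has_field_derivative_iff)
    moreover have "filterlim (\<lambda>n. complex_of_real (h n)) (at 0) sequentially"
      using tendsto_of_real[OF h0, where 'a=complex] h(1)[THEN less_imp_neq]
      by (intro filterlim_atI) (auto dest: sym)
    ultimately show "(\<lambda>n. (exp (w * of_real (h n)) - 1) / of_real (h n)) \<longlonglongrightarrow> w"
      by (rule filterlim_compose)
  qed
  with lim1 have "(LINT x|lborel. partial_deriv v f x * E x) = 2 * of_real pi * \<i> * of_real (v \<bullet> \<xi>) * fourier f \<xi>"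
    unfolding tr by (rule LIMSEQ_unique)
  then show ?thesis by (simp add: fourier_def E_def)
qed

text \<open>Each derivative of \<open>f\<close> in direction \<open>v\<close> produces a factor 2
  \<pi> i (v . \<xi>), and the derivative is again a test function; hence the induction with
  \<open>f\<close> arbitrary.\<close>

lemma fourier_coordinate_decay:
  assumes "test_fun f" "v \<in> Basis"
  shows "\<exists>C. \<forall>\<xi>. \<bar>\<xi> \<bullet> v\<bar> ^ k * norm (fourier f \<xi>) \<le> C"
  using assms(1)
proof (induction k arbitrary: f)
  case 0
  then show ?case using norm_fourier_le[OF test_fun_integrable] by auto
next
  case (Suc k)
  from Suc.IH[OF test_fun_partial_deriv[OF Suc.prems assms(2)]]
  obtain C where C: "\<And>\<xi>. \<bar>\<xi> \<bullet> v\<bar> ^ k * norm (fourier (partial_deriv v f) \<xi>) \<le> C" by blast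
  have "\<bar>\<xi> \<bullet> v\<bar> ^ Suc k * norm (fourier f \<xi>) \<le> C / (2 * pi)" for \<xi>
  proof -
    have "norm (fourier (partial_deriv v f) \<xi>) = 2 * pi * \<bar>\<xi> \<bullet> v\<bar> * norm (fourier f \<xi>)"
      unfolding fourier_partial_deriv[OF Suc.prems assms(2)] by (simp add: norm_mult inner_commute)
    then have "\<bar>\<xi> \<bullet> v\<bar> ^ Suc k * norm (fourier f \<xi>) = \<bar>\<xi> \<bullet> v\<bar> ^ k * norm (fourier (partial_deriv v f) \<xi>) / (2 * pi)"
      by simp
    with C[of \<xi>] show ?thesis by (simp add: divide_right_mono)
  qed
  then show ?case by blast
qed

text \<open>A tensor weight stays integrable in every dimension. The detour through complex values
  fits \<open>integral_lborel_prod\<close>, whose factors are complex.\<close>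

lemma integrable_prod_inverse_square:
  "integrable lborel (\<lambda>x::'a::euclidean_space. \<Prod>b\<in>Basis. inverse (1 + (x \<bullet> b)\<^sup>2))"
proof -
  have "integrable lborel (\<lambda>x::real. inverse (1 + x\<^sup>2))"
    using integrable_inverse_1_plus_square by (simp add: set_integrable_def)
  then have "integrable lborel (\<lambda>x::'a. \<Prod>b\<in>Basis. complex_of_real (inverse (1 + (x \<bullet> b)\<^sup>2)))"
    by (intro integral_lborel_prod(2)[where f="\<lambda>b t. complex_of_real (inverse (1 + t\<^sup>2))"]) (rule integrable_of_real)
  from integrable_Re[OF this] show ?thesis unfolding of_real_prod[symmetric] Re_complex_of_real .
qed

text \<open>The product of the 1 + \<xi>_b^2 is at most (1 + x^2)^d <= 2^d (1 + x^(2d)), where x is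
  the largest coordinate in modulus. So decay of order 2d along single coordinates dominates the
  transform by the integrable tensor weight.\<close>

lemma fourier_test_fun_integrable:
  fixes f :: "'a::euclidean_space \<Rightarrow> complex"
  assumes f: "test_fun f"
  shows "integrable lborel (fourier f)"
proof -
  let ?d = "DIM('a)"
  obtain C0 where C0: "\<And>\<xi>. norm (fourier f \<xi>) \<le> C0"
    using norm_fourier_le[OF test_fun_integrable[OF f]] by blast
  have "\<forall>b\<in>Basis. \<exists>C. \<forall>\<xi>. \<bar>\<xi> \<bullet> b\<bar> ^ (2 * ?d) * norm (fourier f \<xi>) \<le> C"
    using fourier_coordinate_decay[OF f] by blast
  then obtain C where C: "\<And>b \<xi>. b \<in> Basis \<Longrightarrow> \<bar>\<xi> \<bullet> b\<bar> ^ (2 * ?d) * norm (fourier f \<xi>) \<le> C b"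
    by (metis bchoice)
  have C_nonneg: "0 \<le> C b" if "b \<in> Basis" for b
    using order.trans[OF _ C[OF that, of 0]] by simp
  define K where "K = 2 ^ ?d * (C0 + (\<Sum>b\<in>Basis. C b))"
  have bound: "norm (fourier f \<xi>) \<le> K * (\<Prod>b\<in>Basis. inverse (1 + (\<xi> \<bullet> b)\<^sup>2))" for \<xi>
  proof -
    \<comment> \<open>The largest coordinate depends on \<xi>; the sum of all the constants
      \<open>C b\<close> in \<open>K\<close> makes the bound uniform.\<close>
    obtain b0 :: 'a where b0: "b0 \<in> Basis" "\<And>b. b \<in> Basis \<Longrightarrow> \<bar>\<xi> \<bullet> b\<bar> \<le> \<bar>\<xi> \<bullet> b0\<bar>"
    proof -
      have "Max ((\<lambda>b. \<bar>\<xi> \<bullet> b\<bar>) ` Basis) \<in> (\<lambda>b. \<bar>\<xi> \<bullet> b\<bar>) ` Basis" by (intro Max_in) auto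
      then obtain b0 :: 'a where "b0 \<in> Basis" "Max ((\<lambda>b. \<bar>\<xi> \<bullet> b\<bar>) ` Basis) = \<bar>\<xi> \<bullet> b0\<bar>" by (rule imageE) simp
      moreover have "\<bar>\<xi> \<bullet> b\<bar> \<le> Max ((\<lambda>b. \<bar>\<xi> \<bullet> b\<bar>) ` Basis)" if "b \<in> Basis" for b using that by simp
      ultimately show ?thesis using that by metis
    qed
    let ?x = "\<bar>\<xi> \<bullet> b0\<bar>" and ?N = "norm (fourier f \<xi>)"
    have "(\<Prod>b\<in>(Basis::'a set). 1 + (\<xi> \<bullet> b)\<^sup>2) \<le> (\<Prod>b\<in>(Basis::'a set). 1 + ?x\<^sup>2)"
      using b0(2) by (intro prod_mono) (auto simp: abs_le_square_iff)
    also have "\<dots> = (1 + ?x\<^sup>2) ^ ?d" by simp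
    also have "\<dots> \<le> 2 ^ ?d * (1 + ?x ^ (2 * ?d))"
    proof (cases "?x \<le> 1")
      case True
      then have "(1 + ?x\<^sup>2) ^ ?d \<le> 2 ^ ?d" by (intro power_mono) (auto simp: power_le_one abs_square_le_1)
      also have "\<dots> \<le> 2 ^ ?d * (1 + ?x ^ (2 * ?d))" by simp
      finally show ?thesis .
    next
      case False
      then have "1 \<le> ?x\<^sup>2" by (intro one_le_power) auto
      then have "(1 + ?x\<^sup>2) ^ ?d \<le> (2 * ?x\<^sup>2) ^ ?d" by (intro power_mono) auto
      also have "\<dots> = 2 ^ ?d * ?x ^ (2 * ?d)" by (simp add: power_mult_distrib power_mult)
      also have "\<dots> \<le> 2 ^ ?d * (1 + ?x ^ (2 * ?d))" by simp
      finally show ?thesis .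
    qed
    finally have "(\<Prod>b\<in>Basis. 1 + (\<xi> \<bullet> b)\<^sup>2) * ?N \<le> 2 ^ ?d * (1 + ?x ^ (2 * ?d)) * ?N"
      by (intro mult_right_mono) auto
    also have "\<dots> = 2 ^ ?d * (?N + ?x ^ (2 * ?d) * ?N)" by (simp add: algebra_simps)
    also have "\<dots> \<le> 2 ^ ?d * (C0 + (\<Sum>b\<in>Basis. C b))"
      using C0[of \<xi>] C[OF b0(1), of \<xi>] member_le_sum[OF b0(1), of C] C_nonneg
      by (intro mult_left_mono add_mono) (auto intro: order.trans)
    finally have le: "(\<Prod>b\<in>Basis. 1 + (\<xi> \<bullet> b)\<^sup>2) * ?N \<le> K" by (simp add: K_def)
    have pos: "(\<Prod>b\<in>Basis. 1 + (\<xi> \<bullet> b)\<^sup>2) > 0"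
      by (intro prod_pos) (auto intro: add_pos_nonneg)
    have "?N \<le> K / (\<Prod>b\<in>Basis. 1 + (\<xi> \<bullet> b)\<^sup>2)" using le pos by (simp add: field_simps)
    then show ?thesis by (simp add: divide_inverse prod_inversef[symmetric])
  qed
  show ?thesis
  proof (rule Bochner_Integration.integrable_bound[OF integrable_mult_right[OF integrable_prod_inverse_square, of K]])
    show "fourier f \<in> borel_measurable lborel" using test_fun_measurable[OF f] by (simp add: measurable_fourier)
    show "AE \<xi> in lborel. norm (fourier f \<xi>) \<le> norm (K * (\<Prod>b\<in>Basis. inverse (1 + (\<xi> \<bullet> b)\<^sup>2)))"
      using order.trans[OF bound abs_ge_self] by simp
  qed
qed

section \<open>Density of test functions in \<open>L\<^sup>2\<close>\<close>

text \<open>The functions \<open>p(1/x) exp(-1/x)\<close> on the positive half line: this class is closed under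
  differentiation, and \<open>flat 1 (n x)\<close> tends to the indicator of the half line.\<close>

definition flat :: "real poly \<Rightarrow> real \<Rightarrow> real" where
  "flat p x = (if x > 0 then poly p (1 / x) * exp (- (1 / x)) else 0)"

lemma poly_exp_tendsto_0: "((\<lambda>y::real. poly p y * exp (- y)) \<longlongrightarrow> 0) at_top"
proof -
  have "((\<lambda>y. \<Sum>i\<le>degree p. coeff p i * (y ^ i / exp y)) \<longlongrightarrow> (\<Sum>i\<le>degree p. coeff p i * 0)) at_top"
    by (intro tendsto_intros tendsto_power_div_exp_0)
  then show ?thesis
    by (simp add: poly_altdef sum_distrib_right exp_minus divide_inverse mult.assoc)
qed

text \<open>For x > 0 the derivative of p(1/x) exp(-1/x) is x^(-2) (p - p')(1/x) exp(-1/x), and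
  \<open>[:0, 0, 1:]\<close> evaluated at 1/x is x^(-2). At 0 the right difference quotient is the
  function of the same kind with polynomial \<open>pCons 0 p\<close>, which tends to 0 since exp(-y)
  beats every polynomial as y = 1/x grows.\<close>

lemma flat_has_derivative:
  "(flat p has_real_derivative flat ([:0, 0, 1:] * (p - pderiv p)) x) (at x)"
proof -
  consider "x > 0" | "x < 0" | "x = 0" by linarith
  then show ?thesis
  proof cases
    case 1
    have "((\<lambda>x. poly p (1 / x) * exp (- (1 / x))) has_real_derivative flat ([:0, 0, 1:] * (p - pderiv p)) x) (at x)"
      using 1 by (auto intro!: derivative_eq_intros poly_DERIV[THEN DERIV_chain2] simp: flat_def power2_eq_square algebra_simps)
    then show ?thesis
      by (rule has_field_derivative_transform_within_open[of _ _ _ "{0<..}"]) (use 1 in \<open>auto simp: flat_def\<close>)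
  next
    case 2
    have "((\<lambda>x. 0) has_real_derivative flat ([:0, 0, 1:] * (p - pderiv p)) x) (at x)"
      using 2 by (simp add: flat_def)
    then show ?thesis
      by (rule has_field_derivative_transform_within_open[of _ _ _ "{..<0}"]) (use 2 in \<open>auto simp: flat_def\<close>)
  next
    case 3
    have "((\<lambda>y. flat p y / y) \<longlongrightarrow> 0) (at_right 0)"
    proof (rule Lim_transform_eventually)
      show "((\<lambda>y. poly (pCons 0 p) (inverse y) * exp (- inverse y)) \<longlongrightarrow> 0) (at_right 0)"
        by (rule filterlim_compose[OF poly_exp_tendsto_0 filterlim_inverse_at_top_right])
      show "\<forall>\<^sub>F y in at_right 0. poly (pCons 0 p) (inverse y) * exp (- inverse y) = flat p y / y"
        by (simp add: eventually_at_filter flat_def divide_inverse)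
    qed
    moreover have "((\<lambda>y. flat p y / y) \<longlongrightarrow> 0) (at_left 0)"
      by (rule Lim_transform_eventually[OF tendsto_const]) (simp add: eventually_at_filter flat_def)
    ultimately have "((\<lambda>y. flat p y / y) \<longlongrightarrow> 0) (at 0)"
      by (simp add: filterlim_at_split)
    with 3 show ?thesis by (simp add: has_field_derivative_iff flat_def)
  qed
qed

lemma flat_0: "x \<le> 0 \<Longrightarrow> flat p x = 0" by (simp add: flat_def)

lemma flat_1_bounds: "0 \<le> flat 1 x" "flat 1 x \<le> 1" by (auto simp: flat_def)

lemma flat_1_tendsto:
  assumes "t > 0" shows "(\<lambda>n. flat 1 (real (Suc n) * t)) \<longlonglongrightarrow> 1"
proof -
  have "(\<lambda>n. 1 / real (Suc n)) \<longlonglongrightarrow> 0"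
    using LIMSEQ_inverse_real_of_nat by (simp add: inverse_eq_divide)
  from tendsto_mult[OF this tendsto_const[of "1 / t"]]
  have "(\<lambda>n. 1 / (real (Suc n) * t)) \<longlonglongrightarrow> 0" by simp
  then have "(\<lambda>n. exp (- (1 / (real (Suc n) * t)))) \<longlonglongrightarrow> exp (- 0)"
    by (intro tendsto_exp tendsto_minus)
  moreover have "real (Suc n) * t > 0" for n using assms by simp
  ultimately show ?thesis by (simp add: flat_def)
qed

lemma Ck_flat_affine:
  fixes b :: "'a::euclidean_space"
  shows "Ck k (\<lambda>x. complex_of_real (flat p (c * (x \<bullet> b) + d)))"
proof (induction k arbitrary: p)
  have cont: "continuous_on UNIV (\<lambda>x::'a. complex_of_real (flat p (c * (x \<bullet> b) + d)))" for p
  proof (intro continuous_intros)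
    have "continuous_on UNIV (flat p)"
      using flat_has_derivative by (meson DERIV_isCont continuous_at_imp_continuous_on)
    then show "continuous_on UNIV (\<lambda>x::'a. flat p (c * (x \<bullet> b) + d))"
      by (rule continuous_on_compose2) (auto intro!: continuous_intros)
  qed
  { case 0 show ?case using cont by simp }
  case (Suc k)
  show ?case
  proof (rule Ck_SucI[OF cont])
    fix v x :: 'a
    let ?q = "[:0, 0, 1:] * (p - pderiv p)"
    have "((\<lambda>t. flat p (c * ((x + t *\<^sub>R v) \<bullet> b) + d)) has_real_derivative flat ?q (c * (x \<bullet> b) + d) * (c * (v \<bullet> b))) (at 0)"
    proof (rule DERIV_chain2[where g="\<lambda>t. c * ((x + t *\<^sub>R v) \<bullet> b) + d", OF flat_has_derivative, THEN DERIV_cong])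
      show "((\<lambda>t. c * ((x + t *\<^sub>R v) \<bullet> b) + d) has_real_derivative (c * (v \<bullet> b))) (at 0)"
        by (auto intro!: derivative_eq_intros simp: inner_add_left)
    qed simp
    then have "((\<lambda>t. complex_of_real (flat p (c * ((x + t *\<^sub>R v) \<bullet> b) + d))) has_vector_derivative
        complex_of_real (flat ?q (c * (x \<bullet> b) + d) * (c * (v \<bullet> b)))) (at 0)"
      by (intro has_vector_derivative_of_real) (simp add: has_real_derivative_iff_has_vector_derivative)
    then show "((\<lambda>t. complex_of_real (flat p (c * ((x + t *\<^sub>R v) \<bullet> b) + d))) has_vector_derivative
        complex_of_real (flat ?q (c * (x \<bullet> b) + d)) * complex_of_real (c * (v \<bullet> b))) (at 0)" by simp
    show "Ck k (\<lambda>x. complex_of_real (flat ?q (c * (x \<bullet> b) + d)) * complex_of_real (c * (v \<bullet> b)))"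
      by (intro Ck_mult Ck_const Suc)
  qed
qed

text \<open>Membership in the L2 closure of the test functions, as a predicate that can be carried
  through sums, scalars, limits and an induction over Borel sets.\<close>

definition L2_approx :: "('a::euclidean_space \<Rightarrow> complex) \<Rightarrow> bool" where
  "L2_approx f \<longleftrightarrow> in_L2 f \<and> (\<forall>e>0. \<exists>\<phi>. test_fun \<phi> \<and> edist2 \<phi> f < ennreal e)"

lemma L2_approxI_limit:
  assumes "in_L2 f" "\<And>n. L2_approx (g n)" "(\<lambda>n. edist2 (g n) f) \<longlonglongrightarrow> 0"
  shows "L2_approx f"
  unfolding L2_approx_def
proof (intro conjI allI impI assms)
  fix e :: real assume e: "e > 0"
  \<comment> \<open>Two errors of e/8, each doubled by the substitute for the triangle inequality,
    leave e/2 < e.\<close>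
  then have "\<forall>\<^sub>F n in sequentially. edist2 (g n) f < ennreal (e/8)"
    by (intro order_tendstoD(2)[OF assms(3)]) auto
  then obtain n where n: "edist2 (g n) f < ennreal (e/8)"
    by (auto simp: eventually_sequentially)
  obtain \<phi> where \<phi>: "test_fun \<phi>" "edist2 \<phi> (g n) < ennreal (e/8)"
    using assms(2)[of n] e unfolding L2_approx_def by (meson divide_pos_pos zero_less_numeral)
  have [measurable]: "f \<in> borel_measurable borel" "g n \<in> borel_measurable borel" "\<phi> \<in> borel_measurable borel"
    using assms(1) assms(2)[of n] \<phi>(1) by (auto simp: L2_approx_def in_L2_measurable test_fun_measurable)
  have "edist2 \<phi> f \<le> 2 * edist2 \<phi> (g n) + 2 * edist2 (g n) f"
    by (rule energy_diff_triangle) auto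
  also have "\<dots> \<le> 2 * ennreal (e/8) + 2 * ennreal (e/8)"
    using n \<phi>(2) by (intro add_mono mult_left_mono less_imp_le) auto
  also have "\<dots> = ennreal (e/2)"
    using e by (simp add: ennreal_mult'[symmetric] ennreal_plus[symmetric] flip: ennreal_numeral del: ennreal_plus)
  also have "\<dots> < ennreal e" using e by (intro ennreal_lessI) auto
  finally show "\<exists>\<phi>. test_fun \<phi> \<and> edist2 \<phi> f < ennreal e" using \<phi>(1) by blast
qed

section \<open>Closure properties of the approximable functions\<close>

lemma energy_cmult: "energy (\<lambda>x. c * f x :: complex) = ennreal ((norm c)\<^sup>2) * energy f" if "f \<in> borel_measurable borel"
  using that by (simp add: energy_def norm_mult ennreal_mult power_mult_distrib ennreal_power nn_integral_cmult)

lemma L2_approx_test_fun: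
  assumes "test_fun f" shows "L2_approx f"
  using assms by (auto simp: L2_approx_def test_fun_in_L2 energy_def intro!: exI[of _ f])

lemma L2_approx_sequence:
  assumes "L2_approx f"
  obtains \<phi> where "\<And>n. test_fun (\<phi> n)" "(\<lambda>n. edist2 (\<phi> n) f) \<longlonglongrightarrow> 0"
proof -
  have "\<exists>\<phi>. \<forall>n. test_fun (\<phi> n) \<and> edist2 (\<phi> n) f < ennreal (inverse (real (Suc n)))"
    using assms by (intro choice allI) (auto simp: L2_approx_def)
  then obtain \<phi> where \<phi>: "\<And>n. test_fun (\<phi> n)" "\<And>n. edist2 (\<phi> n) f < ennreal (inverse (real (Suc n)))" by blast
  have "(\<lambda>n. edist2 (\<phi> n) f) \<longlonglongrightarrow> 0"
  proof (rule tendsto_sandwich[of "\<lambda>_. 0"])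
    show "(\<lambda>n. ennreal (inverse (real (Suc n)))) \<longlonglongrightarrow> 0"
      using tendsto_ennrealI[OF LIMSEQ_inverse_real_of_nat] by simp
    show "\<forall>\<^sub>F n in sequentially. edist2 (\<phi> n) f \<le> ennreal (inverse (real (Suc n)))"
      using less_imp_le[OF \<phi>(2)] by (intro always_eventually allI)
  qed auto
  with \<phi>(1) that show ?thesis by blast
qed

lemma L2_approx_add:
  assumes "L2_approx f" "L2_approx g" shows "L2_approx (\<lambda>x. f x + g x)"
proof -
  obtain \<phi> where \<phi>: "\<And>n. test_fun (\<phi> n)" "(\<lambda>n. edist2 (\<phi> n) f) \<longlonglongrightarrow> 0"
    using L2_approx_sequence[OF assms(1)] by blast
  obtain \<psi> where \<psi>: "\<And>n. test_fun (\<psi> n)" "(\<lambda>n. edist2 (\<psi> n) g) \<longlonglongrightarrow> 0"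
    using L2_approx_sequence[OF assms(2)] by blast
  have L2: "in_L2 f" "in_L2 g" using assms by (auto simp: L2_approx_def)
  note [measurable] = L2[THEN in_L2_measurable] test_fun_measurable[OF \<phi>(1)] test_fun_measurable[OF \<psi>(1)]
  show ?thesis
  proof (rule L2_approxI_limit)
    have "in_L2 (\<lambda>x. f x - (- g x))"
      using L2 by (intro in_L2_diff) (auto simp: in_L2_iff energy_uminus)
    then show "in_L2 (\<lambda>x. f x + g x)" by simp
    show "L2_approx (\<lambda>x. \<phi> n x + \<psi> n x)" for n
      by (intro L2_approx_test_fun test_fun_add \<phi> \<psi>)
    show "(\<lambda>n. energy (\<lambda>x. \<phi> n x + \<psi> n x - (f x + g x))) \<longlonglongrightarrow> 0"
    proof (rule tendsto_sandwich[of "\<lambda>_. 0"])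
      show "\<forall>\<^sub>F n in sequentially. energy (\<lambda>x. \<phi> n x + \<psi> n x - (f x + g x)) \<le> 2 * edist2 (\<phi> n) f + 2 * edist2 (\<psi> n) g"
      proof (intro always_eventually allI)
        fix n
        have "(\<lambda>x. \<phi> n x + \<psi> n x - (f x + g x)) = (\<lambda>x. (\<phi> n x - f x) + (\<psi> n x - g x))" by (auto simp: algebra_simps)
        then show "energy (\<lambda>x. \<phi> n x + \<psi> n x - (f x + g x)) \<le> 2 * edist2 (\<phi> n) f + 2 * edist2 (\<psi> n) g"
          by (simp only:) (rule energy_add_le; measurable)
      qed
      have "(\<lambda>n. 2 * edist2 (\<phi> n) f + 2 * edist2 (\<psi> n) g) \<longlonglongrightarrow> 2 * 0 + 2 * 0"
        by (intro tendsto_add tendsto_mult_ennreal tendsto_const \<phi> \<psi>) auto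
      then show "(\<lambda>n. 2 * edist2 (\<phi> n) f + 2 * edist2 (\<psi> n) g) \<longlonglongrightarrow> 0" by simp
    qed auto
  qed
qed

lemma L2_approx_cmult:
  assumes "L2_approx f" shows "L2_approx (\<lambda>x. c * f x)"
proof -
  obtain \<phi> where \<phi>: "\<And>n. test_fun (\<phi> n)" "(\<lambda>n. edist2 (\<phi> n) f) \<longlonglongrightarrow> 0"
    using L2_approx_sequence[OF assms(1)] by blast
  have L2: "in_L2 f" using assms by (auto simp: L2_approx_def)
  note [measurable] = L2[THEN in_L2_measurable] test_fun_measurable[OF \<phi>(1)]
  show ?thesis
  proof (rule L2_approxI_limit)
    show "in_L2 (\<lambda>x. c * f x)"
      using L2 by (auto simp: in_L2_iff energy_cmult ennreal_mult_less_top)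
    show "L2_approx (\<lambda>x. c * \<phi> n x)" for n
      by (intro L2_approx_test_fun test_fun_cmult \<phi>)
    have "energy (\<lambda>x. c * \<phi> n x - c * f x) = ennreal ((norm c)\<^sup>2) * edist2 (\<phi> n) f" for n
      by (simp add: energy_cmult flip: right_diff_distrib)
    moreover have "(\<lambda>n. ennreal ((norm c)\<^sup>2) * edist2 (\<phi> n) f) \<longlonglongrightarrow> ennreal ((norm c)\<^sup>2) * 0"
      by (intro tendsto_mult_ennreal tendsto_const \<phi>) auto
    ultimately show "(\<lambda>n. energy (\<lambda>x. c * \<phi> n x - c * f x)) \<longlonglongrightarrow> 0" by simp
  qed
qed

lemma test_fun_0: "test_fun (\<lambda>x. 0)"
  by (rule test_funI[where R=0]) (auto intro: Ck_const)

lemma L2_approx_sum: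
  assumes "\<And>i. i \<in> I \<Longrightarrow> L2_approx (f i)" shows "L2_approx (\<lambda>x. \<Sum>i\<in>I. f i x)"
  using assms by (induction I rule: infinite_finite_induct)
    (auto intro: L2_approx_add L2_approx_test_fun test_fun_0)

lemma energy_dominated_tendsto_0:
  fixes f :: "'a::euclidean_space \<Rightarrow> complex"
  assumes [measurable]: "\<And>n. s n \<in> borel_measurable borel" "f \<in> borel_measurable borel" "w \<in> borel_measurable borel"
    and bound: "\<And>n x. norm (s n x - f x) \<le> w x"
    and fin: "(\<integral>\<^sup>+x. (ennreal (w x))\<^sup>2 \<partial>lborel) < top"
    and lim: "\<And>x. (\<lambda>n. s n x) \<longlonglongrightarrow> f x"
  shows "(\<lambda>n. edist2 (s n) f) \<longlonglongrightarrow> 0"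
proof -
  have "(\<lambda>n. \<integral>\<^sup>+x. (enorm (s n x - f x))\<^sup>2 \<partial>lborel) \<longlonglongrightarrow> (\<integral>\<^sup>+x. (0::ennreal) \<partial>(lborel::'a measure))"
  proof (rule nn_integral_dominated_convergence[where w="\<lambda>x. (ennreal (w x))\<^sup>2"])
    show "AE x in lborel. (enorm (s n x - f x))\<^sup>2 \<le> (ennreal (w x))\<^sup>2" for n
      by (intro AE_I2 power_mono ennreal_leI bound) auto
    show "AE x in lborel. (\<lambda>n. (enorm (s n x - f x))\<^sup>2) \<longlonglongrightarrow> 0"
    proof (rule AE_I2)
      fix x
      have "(\<lambda>n. (norm (s n x - f x))\<^sup>2) \<longlonglongrightarrow> (norm (f x - f x))\<^sup>2"
        by (intro tendsto_intros lim)
      from tendsto_ennrealI[OF this] show "(\<lambda>n. (enorm (s n x - f x))\<^sup>2) \<longlonglongrightarrow> 0"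
        by (simp add: ennreal_power)
    qed
  qed (use fin in \<open>auto simp: less_top\<close>)
  then show ?thesis by (simp add: energy_def)
qed

section \<open>From boxes to Borel sets to square integrable functions\<close>

lemma indicator_norm_power2: "(enorm (indicator A x :: complex))\<^sup>2 = indicator A x"
  by (simp add: indicator_def)

lemma in_L2_indicator_box:
  assumes "A \<in> sets borel" shows "in_L2 (\<lambda>x. indicator (A \<inter> box l u) x :: complex)"
proof -
  have "energy (\<lambda>x. indicator (A \<inter> box l u) x :: complex) = emeasure lborel (A \<inter> box l u)"
    using assms by (simp add: energy_def indicator_norm_power2)
  also have "\<dots> \<le> emeasure lborel (box l u)" by (intro emeasure_mono) auto
  also have "\<dots> < top" using emeasure_bounded_finite[OF bounded_box] by simp
  finally show ?thesis using assms by (simp add: in_L2_iff)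
qed

lemma nn_integral_indicator_box_finite: "(\<integral>\<^sup>+x. (ennreal (indicator (box l u) x))\<^sup>2 \<partial>lborel) < top"
proof -
  have "(\<integral>\<^sup>+x. (ennreal (indicator (box l u) x))\<^sup>2 \<partial>lborel) = (\<integral>\<^sup>+x. indicator (box l u) x \<partial>lborel)"
    by (intro nn_integral_cong) (simp add: indicator_def)
  then show ?thesis using emeasure_bounded_finite[OF bounded_box, of l u] by simp
qed

text \<open>Every face of the box contributes a factor \<open>flat 1\<close> of n+1 times the signed
  distance to it. The product vanishes off the open box, lies in [0, 1] and tends to 1 at each
  interior point, so convergence holds everywhere.\<close>

lemma L2_approx_box: "L2_approx (\<lambda>x::'a::euclidean_space. indicator (box l u) x)"
proof (rule L2_approxI_limit)
  define \<phi> where "\<phi> n x = (\<Prod>b\<in>Basis. complex_of_real (flat 1 (real (Suc n) * (x \<bullet> b - l \<bullet> b))) *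
      complex_of_real (flat 1 (real (Suc n) * (u \<bullet> b - x \<bullet> b))))" for n and x :: 'a
  have zero: "\<phi> n x = 0" if "x \<notin> box l u" for n x
  proof -
    obtain b where "b \<in> Basis" "x \<bullet> b - l \<bullet> b \<le> 0 \<or> u \<bullet> b - x \<bullet> b \<le> 0"
      using \<open>x \<notin> box l u\<close> by (auto simp: mem_box not_less)
    then have "flat 1 (real (Suc n) * (x \<bullet> b - l \<bullet> b)) = 0 \<or> flat 1 (real (Suc n) * (u \<bullet> b - x \<bullet> b)) = 0"
      by (metis flat_0 mult_nonneg_nonpos of_nat_0_le_iff)
    with \<open>b \<in> Basis\<close> show ?thesis unfolding \<phi>_def by (intro prod_zero) auto
  qed
  obtain R where R: "\<And>x. x \<in> box l u \<Longrightarrow> norm x \<le> R" using bounded_box[of l u] unfolding bounded_iff by blast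
  have test: "test_fun (\<phi> n)" for n
  proof (rule test_funI)
    show "norm x \<le> R" if "\<phi> n x \<noteq> 0" for x using zero that R by blast
    show "Ck k (\<phi> n)" for k
      unfolding \<phi>_def
    proof (intro Ck_prod Ck_mult)
      fix b :: 'a
      show "Ck k (\<lambda>x. complex_of_real (flat 1 (real (Suc n) * (x \<bullet> b - l \<bullet> b))))"
        using Ck_flat_affine[of k 1 "real (Suc n)" b "- real (Suc n) * (l \<bullet> b)"] by (simp add: algebra_simps)
      show "Ck k (\<lambda>x. complex_of_real (flat 1 (real (Suc n) * (u \<bullet> b - x \<bullet> b))))"
        using Ck_flat_affine[of k 1 "- real (Suc n)" b "real (Suc n) * (u \<bullet> b)"] by (simp add: algebra_simps)
    qed
  qed
  show "L2_approx (\<phi> n)" for n by (rule L2_approx_test_fun[OF test])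
  show "in_L2 (\<lambda>x::'a. indicator (box l u) x :: complex)" using in_L2_indicator_box[of UNIV l u] by simp
  show "(\<lambda>n. edist2 (\<phi> n) (indicator (box l u))) \<longlonglongrightarrow> 0"
  proof (rule energy_dominated_tendsto_0[where w="\<lambda>x. 2 * indicator (box l u) x"])
    show "\<phi> n \<in> borel_measurable borel" for n by (rule test_fun_measurable[OF test])
    have "norm (\<phi> n x) \<le> 1" for n x
      unfolding \<phi>_def prod_norm[symmetric]
      by (intro prod_le_1) (auto simp: norm_mult flat_1_bounds intro!: mult_le_one)
    then show "norm (\<phi> n x - indicator (box l u) x) \<le> 2 * indicator (box l u) x" for n x
      using zero[of x n] norm_triangle_ineq4[of "\<phi> n x" 1] by (cases "x \<in> box l u") (auto intro: order.trans)
    show "(\<lambda>n. \<phi> n x) \<longlonglongrightarrow> indicator (box l u) x" for x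
    proof (cases "x \<in> box l u")
      case True
      have "(\<lambda>n. \<phi> n x) \<longlonglongrightarrow> (\<Prod>b\<in>(Basis::'a set). complex_of_real 1 * complex_of_real 1)"
        unfolding \<phi>_def
        by (intro tendsto_prod tendsto_mult tendsto_of_real flat_1_tendsto) (use True in \<open>auto simp: mem_box\<close>)
      with True show ?thesis by simp
    qed (simp add: zero)
    have "(\<integral>\<^sup>+x. (ennreal (2 * indicator (box l u) x))\<^sup>2 \<partial>lborel) = 4 * (\<integral>\<^sup>+x. (ennreal (indicator (box l u) x))\<^sup>2 \<partial>(lborel::'a measure))"
      by (subst nn_integral_cmult[symmetric]) (auto intro!: nn_integral_cong simp: indicator_def power2_eq_square)
    then show "(\<integral>\<^sup>+x. (ennreal (2 * indicator (box l u) x))\<^sup>2 \<partial>(lborel::'a measure)) < top"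
      using nn_integral_indicator_box_finite[of l u] by (simp add: ennreal_mult_less_top)
  qed auto
qed

text \<open>Dynkin's argument: open boxes are stable under intersection and generate the Borel sets,
  and the sets with approximable indicator are closed under complement and disjoint countable union.
  Intersecting with a fixed box keeps complements in L2.\<close>

lemma L2_approx_indicator:
  fixes A :: "'a::euclidean_space set"
  assumes "A \<in> sets borel"
  shows "L2_approx (\<lambda>x. indicator (A \<inter> box l u) x)"
proof -
  have stable: "Int_stable (range (\<lambda>(a, b). box a b :: 'a set))"
    by (auto simp: Int_stable_def box_Int_box)
  have closed: "range (\<lambda>(a, b). box a b :: 'a set) \<subseteq> Pow UNIV" by auto
  have gen: "sets (borel :: 'a measure) = sigma_sets UNIV (range (\<lambda>(a, b). box a b))"
    by (simp add: borel_eq_box)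
  have "A \<in> sigma_sets UNIV (range (\<lambda>(a, b). box a b))" using assms gen by simp
  then show ?thesis
  proof (induction rule: sigma_sets_induct_disjoint[OF stable closed, consumes 1, case_names basic empty compl union])
    case (basic A)
    then show ?case by (auto simp: box_Int_box intro: L2_approx_box)
  next
    case empty
    then show ?case by (auto intro: L2_approx_test_fun test_fun_0)
  next
    case (compl A)
    have "(\<lambda>x. indicator ((UNIV - A) \<inter> box l u) x :: complex) = (\<lambda>x. indicator (box l u) x + (-1) * indicator (A \<inter> box l u) x)"
      by (auto simp: indicator_def)
    then show ?case using compl by (simp only:) (intro L2_approx_add L2_approx_cmult L2_approx_box)
  next
    case (union A)
    have meas: "A i \<in> sets borel" for i using union(2) gen by auto
    show ?case
    proof (rule L2_approxI_limit)
      show "in_L2 (\<lambda>x. indicator (\<Union> (range A) \<inter> box l u) x :: complex)"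
        by (intro in_L2_indicator_box) (auto intro: meas)
      show "L2_approx (\<lambda>x. indicator ((\<Union>i<n. A i) \<inter> box l u) x)" for n :: nat
      proof (induction n)
        case (Suc n)
        have "(\<Union>i<n. A i) \<inter> A n = {}" using union(1) by (auto simp: disjoint_family_on_def) (metis disjoint_iff less_irrefl)
        then have "(\<lambda>x. indicator ((\<Union>i<Suc n. A i) \<inter> box l u) x :: complex) = (\<lambda>x. indicator ((\<Union>i<n. A i) \<inter> box l u) x + indicator (A n \<inter> box l u) x)"
          by (auto simp: indicator_def lessThan_Suc fun_eq_iff)
        then show ?case by (simp only:) (intro L2_approx_add Suc union)
      qed (auto intro: L2_approx_test_fun test_fun_0)
      show "(\<lambda>n. energy (\<lambda>x. indicator ((\<Union>i<n. A i) \<inter> box l u) x - indicator (\<Union> (range A) \<inter> box l u) x :: complex)) \<longlonglongrightarrow> 0"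
      proof (rule energy_dominated_tendsto_0[where w="\<lambda>x. indicator (box l u) x"])
        show "(\<lambda>n. indicator ((\<Union>i<n. A i) \<inter> box l u) x :: complex) \<longlonglongrightarrow> indicator (\<Union> (range A) \<inter> box l u) x" for x
          using tendsto_mult[OF LIMSEQ_indicator_UN[of A x] tendsto_const[of "indicator (box l u) x"]]
          by (simp add: indicator_inter_arith)
        show "(\<lambda>x. indicator ((\<Union>i<n. A i) \<inter> box l u) x :: complex) \<in> borel_measurable borel" for n
          using meas by (intro borel_measurable_indicator) auto
        show "(\<lambda>x. indicator (\<Union> (range A) \<inter> box l u) x :: complex) \<in> borel_measurable borel"
          using meas by (intro borel_measurable_indicator) auto
        show "norm (indicator ((\<Union>i<n. A i) \<inter> box l u) x - indicator (\<Union> (range A) \<inter> box l u) x :: complex)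
            \<le> indicator (box l u) x" for n x
          by (auto simp: indicator_def)
      qed (use nn_integral_indicator_box_finite in auto)
    qed
  qed
qed

text \<open>Simple functions cut off to growing boxes are finite combinations of indicators of
  bounded Borel sets. They converge pointwise, and bounding the simple functions by 2 |f| puts the
  error below 3 |f|.\<close>

lemma L2_approx_in_L2:
  fixes f :: "'a::euclidean_space \<Rightarrow> complex"
  assumes "in_L2 f"
  shows "L2_approx f"
proof -
  have [measurable]: "f \<in> borel_measurable borel" by (rule in_L2_measurable[OF assms])
  from borel_measurable_implies_sequence_metric[of f lborel 0] obtain s where
    s: "\<And>i. simple_function lborel (s i)" and
    lim: "\<And>x. (\<lambda>i. s i x) \<longlonglongrightarrow> f x" and
    bound: "\<And>i x. norm (s i x) \<le> 2 * norm (f x)"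
    by (auto simp: dist_norm)
  define Q where "Q n = box (- (real n *\<^sub>R One)) (real n *\<^sub>R One :: 'a)" for n
  have [measurable]: "s i \<in> borel_measurable borel" for i using borel_measurable_simple_function[OF s] by simp
  show ?thesis
  proof (rule L2_approxI_limit[OF assms])
    fix n
    have "s n x * indicator (Q n) x = (\<Sum>y\<in>s n ` UNIV. y * indicator (s n -` {y} \<inter> Q n) x)" for x
      using simple_functionD(1)[OF s[of n]] by (subst sum.remove[of _ "s n x"]) (auto simp: indicator_def intro!: sum.neutral)
    moreover have "L2_approx (\<lambda>x. (\<Sum>y\<in>s n ` UNIV. y * indicator (s n -` {y} \<inter> Q n) x))"
      unfolding Q_def by (intro L2_approx_sum L2_approx_cmult L2_approx_indicator)
      (use simple_functionD(2)[OF s[of n]] in simp)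
    ultimately show "L2_approx (\<lambda>x. s n x * indicator (Q n) x)" by simp
  next
    show "(\<lambda>n. energy (\<lambda>x. s n x * indicator (Q n) x - f x)) \<longlonglongrightarrow> 0"
    proof (rule energy_dominated_tendsto_0[where w="\<lambda>x. 3 * norm (f x)"])
      show "(\<lambda>x. s n x * indicator (Q n) x) \<in> borel_measurable borel" for n unfolding Q_def by measurable
      show "norm (s n x * indicator (Q n) x - f x) \<le> 3 * norm (f x)" for n x
        using norm_triangle_ineq4[of "s n x" "f x"] bound[of n x] by (auto simp: indicator_def)
      have "(\<integral>\<^sup>+x. (ennreal (3 * norm (f x)))\<^sup>2 \<partial>lborel) = 9 * energy f"
        unfolding energy_def by (subst nn_integral_cmult[symmetric]) (auto simp: ennreal_mult power_mult_distrib)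
      then show "(\<integral>\<^sup>+x. (ennreal (3 * norm (f x)))\<^sup>2 \<partial>lborel) < top"
        using assms by (simp add: in_L2_iff ennreal_mult_less_top)
      show "(\<lambda>n. s n x * indicator (Q n) x) \<longlonglongrightarrow> f x" for x
      proof (rule Lim_transform_eventually[OF lim])
        obtain N :: nat where N: "norm x < real N" using reals_Archimedean2 by blast
        have "x \<in> Q n" if "n \<ge> N" for n
          using N that Basis_le_norm[of _ x] by (fastforce simp: Q_def mem_box abs_less_iff)
        then show "\<forall>\<^sub>F n in sequentially. s n x = s n x * indicator (Q n) x"
          by (auto simp: eventually_sequentially intro!: exI[of _ N])
      qed
    qed auto
  qed
qed

section \<open>Bilinear Fourier integrals\<close>

text \<open>The inverse Fourier transform in 2d variables, evaluated on the diagonal (x, x). The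
  operators, their frequency pieces and their t-derivatives all have this form.\<close>

definition inv_fourier2 :: "('a::euclidean_space \<times> 'a \<Rightarrow> complex) \<Rightarrow> 'a \<Rightarrow> complex" where
  "inv_fourier2 P x = (LINT p|lborel. P p * wave (x \<bullet> (fst p + snd p)))"

text \<open>\<open>W\<close> carries the inputs and the frequency cut-off, \<open>M\<close> the
  dependence on t.\<close>

abbreviation product_mult ::
    "('a::euclidean_space \<times> 'a \<Rightarrow> complex) \<Rightarrow> ('a \<times> 'a \<Rightarrow> complex) \<Rightarrow> 'a \<Rightarrow> complex" where
  "product_mult W M \<equiv> inv_fourier2 (\<lambda>p. W p * M p)"

abbreviation bilinear_mult ::
    "('a::euclidean_space \<times> 'a \<Rightarrow> complex) \<Rightarrow> ('a \<Rightarrow> complex) \<Rightarrow> ('a \<Rightarrow> complex) \<Rightarrow> 'a \<Rightarrow> complex" where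
  "bilinear_mult M U V \<equiv> product_mult (\<lambda>p. U (fst p) * V (snd p)) M"

abbreviation maximal_mult ::
    "('a::euclidean_space \<times> 'a \<Rightarrow> complex) \<Rightarrow> real set \<Rightarrow> ('a \<Rightarrow> complex) \<Rightarrow> ('a \<Rightarrow> complex) \<Rightarrow> 'a \<Rightarrow> ennreal" where
  "maximal_mult m E U V x \<equiv> (SUP t\<in>E. enorm (bilinear_mult (dilate t m) U V x))"

lemma bilinear_op_eq:
  "bilinear_op m f g = inv_fourier2 (\<lambda>p. fourier f (fst p) * fourier g (snd p) * m p)"
  by (simp add: bilinear_op_def inv_fourier2_def case_prod_beta fun_eq_iff)

lemma borel_measurable_fst_snd [measurable]:
  "(fst :: 'a::second_countable_topology \<times> 'b::second_countable_topology \<Rightarrow> 'a) \<in> borel_measurable borel"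
  "(snd :: 'a \<times> 'b \<Rightarrow> 'b) \<in> borel_measurable borel"
  by (auto intro!: borel_measurable_continuous_onI continuous_intros)

lemma integrable_tensor:
  fixes U :: "'a::euclidean_space \<Rightarrow> complex" and V :: "'b::euclidean_space \<Rightarrow> complex"
  assumes "integrable lborel U" "integrable lborel V"
  shows "integrable lborel (\<lambda>p. U (fst p) * V (snd p))"
proof -
  have [measurable]: "U \<in> borel_measurable borel" "V \<in> borel_measurable borel" using assms by auto
  have "integrable (lborel \<Otimes>\<^sub>M lborel) (\<lambda>(x, y). U x * V y)"
    by (intro lborel_pair.Fubini_integrable) (auto intro!: integrable_mult_right integrable_mult_left assms simp: norm_mult)
  then show ?thesis unfolding lborel_prod split_beta' .
qed

lemma integrable_tensor_bounded:
  fixes U V :: "'a::euclidean_space \<Rightarrow> complex"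
  assumes "integrable lborel U" "integrable lborel V"
    and "M \<in> borel_measurable borel" "\<And>p. norm (M p) \<le> K"
  shows "integrable lborel (\<lambda>p. U (fst p) * V (snd p) * M p)"
proof (rule Bochner_Integration.integrable_bound[OF integrable_mult_right[OF integrable_tensor[OF assms(1,2)], of "of_real K"]])
  have [measurable]: "U \<in> borel_measurable borel" "V \<in> borel_measurable borel" "M \<in> borel_measurable borel" using assms by auto
  have "(\<lambda>p. U (fst p) * V (snd p)) \<in> borel_measurable lborel" using integrable_tensor[OF assms(1,2)] by auto
  then show "(\<lambda>p. U (fst p) * V (snd p) * M p) \<in> borel_measurable lborel" by simp
  have "0 \<le> K" using order.trans[OF norm_ge_zero assms(4)] .
  then show "AE p in lborel. norm (U (fst p) * V (snd p) * M p) \<le> norm (of_real K * (U (fst p) * V (snd p)))"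
    using assms(4) by (auto simp: norm_mult mult.commute[of K] intro!: mult_left_mono AE_I2)
qed

text \<open>Dominated convergence with majorant |P|. Continuity in x for each t is what makes the
  supremum over an arbitrary \<open>E\<close> measurable.\<close>

lemma continuous_inv_fourier2:
  fixes P :: "'a::euclidean_space \<times> 'a \<Rightarrow> complex"
  assumes "integrable lborel P"
  shows "continuous_on UNIV (inv_fourier2 P)"
proof -
  have [measurable]: "P \<in> borel_measurable borel" using assms by auto
  have "inv_fourier2 P \<midarrow>x\<rightarrow> inv_fourier2 P x" for x
    unfolding tendsto_at_iff_sequentially
  proof (intro allI impI, unfold o_def)
    fix X :: "nat \<Rightarrow> 'a" assume X: "X \<longlonglongrightarrow> x"
    show "(\<lambda>n. inv_fourier2 P (X n)) \<longlonglongrightarrow> inv_fourier2 P x"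
      unfolding inv_fourier2_def
    proof (rule integral_dominated_convergence[where w="\<lambda>p. norm (P p)"])
      show "AE p in lborel. (\<lambda>n. P p * wave (X n \<bullet> (fst p + snd p)))
         \<longlonglongrightarrow> P p * wave (x \<bullet> (fst p + snd p))"
        using X by (intro AE_I2 tendsto_intros)
    qed (use assms in \<open>auto simp: norm_mult\<close>)
  qed
  then show ?thesis by (simp add: continuous_on_def)
qed

section \<open>Fibre integrals over \<xi> + \<eta> = \<zeta>\<close>

lemma energy_cnj: "energy (\<lambda>x. cnj (f x)) = energy f"
  by (simp add: energy_def)

text \<open>The change of variables (\<xi>, \<eta>) -> (\<xi>, \<xi> + \<eta>) preserves measure:
  for fixed \<xi> it is a translation of the inner variable, and Tonelli does the rest.\<close>

lemma integrable_shear: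
  fixes P :: "'a::euclidean_space \<times> 'a \<Rightarrow> complex"
  assumes "integrable lborel P"
  shows "integrable (lborel \<Otimes>\<^sub>M lborel) (\<lambda>(\<xi>, \<zeta>). P (\<xi>, \<zeta> - \<xi>))"
proof (rule integrableI_bounded)
  have [measurable]: "P \<in> borel_measurable borel" using assms by auto
  have P': "integrable (lborel \<Otimes>\<^sub>M lborel) P" using assms by (simp add: lborel_prod)
  then have [measurable]: "P \<in> borel_measurable (borel \<Otimes>\<^sub>M borel)"
    by (simp add: borel_prod)
  show "(\<lambda>(\<xi>, \<zeta>). P (\<xi>, \<zeta> - \<xi>)) \<in> borel_measurable (lborel \<Otimes>\<^sub>M lborel)" by measurable
  have "(\<integral>\<^sup>+ p. enorm (case p of (\<xi>, \<zeta>) \<Rightarrow> P (\<xi>, \<zeta> - \<xi>)) \<partial>(lborel \<Otimes>\<^sub>M lborel))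
      = (\<integral>\<^sup>+\<xi>. \<integral>\<^sup>+\<zeta>. enorm (P (\<xi>, \<zeta> - \<xi>)) \<partial>lborel \<partial>lborel)"
    by (subst lborel.nn_integral_fst[symmetric]) auto
  also have "\<dots> = (\<integral>\<^sup>+\<xi>. \<integral>\<^sup>+\<zeta>. enorm (P (\<xi>, \<zeta>)) \<partial>lborel \<partial>lborel)"
    by (intro nn_integral_cong nn_integral_lborel_translate[where f="\<lambda>\<zeta>. enorm (P (_, \<zeta>))"]) measurable
  also have "\<dots> = (\<integral>\<^sup>+ p. enorm (P p) \<partial>(lborel \<Otimes>\<^sub>M lborel))"
    by (subst lborel.nn_integral_fst[symmetric]) auto
  also have "\<dots> < \<infinity>" using P' by (simp add: integrable_iff_bounded)
  finally show "(\<integral>\<^sup>+ p. enorm (case p of (\<xi>, \<zeta>) \<Rightarrow> P (\<xi>, \<zeta> - \<xi>)) \<partial>(lborel \<Otimes>\<^sub>M lborel)) < \<infinity>" .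
qed

text \<open>The phase depends on \<xi> + \<eta> only, so integrating along the fibres first leaves
  an inverse transform in d variables. Conjugating twice turns it into a forward transform, to which
  \<open>bessel\<close> applies.\<close>

lemma inv_fourier2_eq_fourier:
  fixes P :: "'a::euclidean_space \<times> 'a \<Rightarrow> complex"
  assumes P: "integrable lborel P"
  defines "F \<equiv> (\<lambda>\<zeta>. LINT \<xi>|lborel. P (\<xi>, \<zeta> - \<xi>))"
  shows "integrable lborel F" and "inv_fourier2 P x = cnj (fourier (\<lambda>\<zeta>. cnj (F \<zeta>)) x)"
proof -
  have P': "integrable (lborel \<Otimes>\<^sub>M lborel) P" using P by (simp add: lborel_prod)
  have [measurable]: "P \<in> borel_measurable (borel \<Otimes>\<^sub>M borel)"
    using P by (simp add: borel_prod)
  show "integrable lborel F"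
    unfolding F_def using lborel_pair.integrable_snd[OF integrable_shear[OF P]] by simp
  define e where "e \<zeta> = wave (x \<bullet> \<zeta>)" for \<zeta>
  have [measurable]: "e \<in> borel_measurable borel" unfolding e_def by measurable
  have e [simp]: "norm (e \<zeta>) = 1" for \<zeta> unfolding e_def by simp
  have Pe: "integrable lborel (\<lambda>p. P p * e (fst p + snd p))"
  proof (rule Bochner_Integration.integrable_bound[OF P])
    have "(\<lambda>p. P p * e (fst p + snd p)) \<in> borel_measurable (borel \<Otimes>\<^sub>M borel)" by measurable
    then show "(\<lambda>p. P p * e (fst p + snd p)) \<in> borel_measurable lborel" by (simp add: borel_prod)
  qed (auto simp: norm_mult)
  then have Pe': "integrable (lborel \<Otimes>\<^sub>M lborel) (\<lambda>(\<xi>, \<eta>). P (\<xi>, \<eta>) * e (\<xi> + \<eta>))"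
    unfolding lborel_prod split_beta' by simp
  have "inv_fourier2 P x = (LINT p|(lborel \<Otimes>\<^sub>M lborel). (case p of (\<xi>, \<eta>) \<Rightarrow> P (\<xi>, \<eta>) * e (\<xi> + \<eta>)))"
    by (simp add: inv_fourier2_def e_def lborel_prod case_prod_beta)
  also have "\<dots> = (LINT \<xi>|lborel. LINT \<eta>|lborel. P (\<xi>, \<eta>) * e (\<xi> + \<eta>))"
    using lborel_pair.integral_fst'[OF Pe'] by simp
  also have "\<dots> = (LINT \<xi>|lborel. LINT \<zeta>|lborel. P (\<xi>, \<zeta> - \<xi>) * e \<zeta>)"
  proof (rule Bochner_Integration.integral_cong[OF refl])
    fix \<xi> :: 'a
    show "(LINT \<eta>|lborel. P (\<xi>, \<eta>) * e (\<xi> + \<eta>)) = (LINT \<zeta>|lborel. P (\<xi>, \<zeta> - \<xi>) * e \<zeta>)"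
      using integral_lborel_translate[of "\<lambda>\<eta>. P (\<xi>, \<eta>) * e (\<xi> + \<eta>)" "- \<xi>"] by simp
  qed
  also have "\<dots> = (LINT \<zeta>|lborel. LINT \<xi>|lborel. P (\<xi>, \<zeta> - \<xi>) * e \<zeta>)"
  proof (rule lborel_pair.Fubini_integral[symmetric])
    show "integrable (lborel \<Otimes>\<^sub>M lborel) (\<lambda>(\<xi>, \<zeta>). P (\<xi>, \<zeta> - \<xi>) * e \<zeta>)"
      by (rule Bochner_Integration.integrable_bound[OF integrable_shear[OF P]]) (auto simp: norm_mult)
  qed
  also have "\<dots> = (LINT \<zeta>|lborel. F \<zeta> * e \<zeta>)"
    unfolding F_def by simp
  also have "\<dots> = cnj (LINT \<zeta>|lborel. cnj (F \<zeta> * e \<zeta>))"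
    by (subst Bochner_Integration.integral_cnj) simp
  also have "cnj (e \<zeta>) = wave_neg (\<zeta> \<bullet> x)" for \<zeta>
    by (simp add: e_def exp_cnj inner_commute)
  then have "cnj (LINT \<zeta>|lborel. cnj (F \<zeta> * e \<zeta>)) = cnj (fourier (\<lambda>\<zeta>. cnj (F \<zeta>)) x)"
    unfolding fourier_def by simp
  finally show "inv_fourier2 P x = cnj (fourier (\<lambda>\<zeta>. cnj (F \<zeta>)) x)" .
qed

text \<open>After Bessel, Cauchy-Schwarz in the fibre pairs the weighted indicator of the ball with
  \<open>u \<xi> * v (\<zeta> - \<xi>)\<close>. The first factor gives the volume of the ball; the
  second, integrated over \<zeta>, is the integral of a convolution and so splits into a
  product.\<close>

lemma energy_inv_fourier2:
  fixes P :: "'a::euclidean_space \<times> 'a \<Rightarrow> complex" and u v :: "'a \<Rightarrow> ennreal" and K :: ennreal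
  assumes P: "integrable lborel P"
    and [measurable]: "u \<in> borel_measurable borel" "v \<in> borel_measurable borel"
    and bound: "\<And>\<xi> \<eta>. enorm (P (\<xi>, \<eta>)) \<le> K * indicator (cball 0 R) \<xi> * (u \<xi> * v \<eta>)"
  shows "energy (inv_fourier2 P) \<le>
    K\<^sup>2 * emeasure lborel (cball (0::'a) R) * (\<integral>\<^sup>+\<xi>. (u \<xi>)\<^sup>2 \<partial>lborel) * (\<integral>\<^sup>+\<eta>. (v \<eta>)\<^sup>2 \<partial>lborel)"
proof -
  define F where "F \<zeta> = (LINT \<xi>|lborel. P (\<xi>, \<zeta> - \<xi>))" for \<zeta>
  note F = inv_fourier2_eq_fourier[OF P, folded F_def]
  let ?w = "\<lambda>\<xi>::'a. K * indicator (cball 0 R) \<xi>"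
  have [measurable]: "cball (0::'a) R \<in> sets borel" by simp
  have w: "?w \<in> borel_measurable (borel :: 'a measure)" by measurable
  have "energy (inv_fourier2 P) = energy (\<lambda>x. cnj (fourier (\<lambda>\<zeta>. cnj (F \<zeta>)) x))"
    using F(2) by presburger
  also have "\<dots> \<le> energy (\<lambda>\<zeta>. cnj (F \<zeta>))"
    unfolding energy_cnj[of "fourier _"] by (rule bessel) (use F(1) in auto)
  also have "\<dots> = energy F" by (rule energy_cnj)
  also have "\<dots> \<le> (\<integral>\<^sup>+\<zeta>. (\<integral>\<^sup>+\<xi>. ?w \<xi> * (u \<xi> * v (\<zeta> - \<xi>)) \<partial>lborel)\<^sup>2 \<partial>lborel)"
    unfolding energy_def F_def
    by (intro nn_integral_mono power_mono order.trans[OF ennreal_norm_integral_le] bound) auto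
  also have "\<dots> \<le> (\<integral>\<^sup>+\<zeta>. (\<integral>\<^sup>+\<xi>. (?w \<xi>)\<^sup>2 \<partial>lborel) * (\<integral>\<^sup>+\<xi>. (u \<xi> * v (\<zeta> - \<xi>))\<^sup>2 \<partial>lborel) \<partial>lborel)"
  proof (rule nn_integral_mono)
    fix \<zeta> :: 'a
    show "(\<integral>\<^sup>+\<xi>. ?w \<xi> * (u \<xi> * v (\<zeta> - \<xi>)) \<partial>lborel)\<^sup>2 \<le> (\<integral>\<^sup>+\<xi>. (?w \<xi>)\<^sup>2 \<partial>lborel) * (\<integral>\<^sup>+\<xi>. (u \<xi> * v (\<zeta> - \<xi>))\<^sup>2 \<partial>lborel)"
      using Cauchy_Schwarz_nn_integral[of ?w lborel "\<lambda>\<xi>. u \<xi> * v (\<zeta> - \<xi>)"] w by simp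
  qed
  also have "\<dots> = (\<integral>\<^sup>+\<xi>. (?w \<xi>)\<^sup>2 \<partial>lborel) * (\<integral>\<^sup>+\<zeta>. \<integral>\<^sup>+\<xi>. (u \<xi> * v (\<zeta> - \<xi>))\<^sup>2 \<partial>lborel \<partial>lborel)"
    by (rule nn_integral_cmult) measurable
  also have "(\<integral>\<^sup>+\<xi>. (?w \<xi>)\<^sup>2 \<partial>(lborel::'a measure)) = K\<^sup>2 * emeasure lborel (cball (0::'a) R)"
  proof -
    have "(?w \<xi>)\<^sup>2 = K\<^sup>2 * indicator (cball 0 R) \<xi>" for \<xi> :: 'a by (simp add: indicator_def)
    then show ?thesis by (simp add: nn_integral_cmult)
  qed
  also have "(\<integral>\<^sup>+\<zeta>. \<integral>\<^sup>+\<xi>. (u \<xi> * v (\<zeta> - \<xi>))\<^sup>2 \<partial>lborel \<partial>lborel)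
     = (\<integral>\<^sup>+\<xi>. \<integral>\<^sup>+\<zeta>. (u \<xi> * v (\<zeta> - \<xi>))\<^sup>2 \<partial>lborel \<partial>lborel)"
    by (rule lborel_pair.Fubini') measurable
  also have "\<dots> = (\<integral>\<^sup>+\<xi>. (u \<xi>)\<^sup>2 * (\<integral>\<^sup>+\<zeta>. (v \<zeta>)\<^sup>2 \<partial>lborel) \<partial>lborel)"
  proof (rule nn_integral_cong)
    fix \<xi> :: 'a
    show "(\<integral>\<^sup>+\<zeta>. (u \<xi> * v (\<zeta> - \<xi>))\<^sup>2 \<partial>lborel) = (u \<xi>)\<^sup>2 * (\<integral>\<^sup>+\<zeta>. (v \<zeta>)\<^sup>2 \<partial>lborel)"
      using nn_integral_lborel_translate[of "\<lambda>\<zeta>. (v \<zeta>)\<^sup>2" \<xi>]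
      by (simp add: power_mult_distrib nn_integral_cmult)
  qed
  also have "\<dots> = (\<integral>\<^sup>+\<xi>. (u \<xi>)\<^sup>2 \<partial>lborel) * (\<integral>\<^sup>+\<zeta>. (v \<zeta>)\<^sup>2 \<partial>lborel)"
    by (rule nn_integral_multc) measurable
  finally show ?thesis by (simp add: mult.assoc)
qed

section \<open>Radial derivatives and coverings\<close>

text \<open>The coordinates are changed one at a time, by induction over the set of directions;
  continuity of the partial derivatives controls each new increment.\<close>

lemma partial_increment_bound:
  fixes m :: "'a::euclidean_space \<Rightarrow> 'b::real_normed_vector"
  assumes m: "Ck 1 m" and B: "finite B" "B \<subseteq> Basis" and "e > 0"
  shows "\<exists>d>0. \<forall>c. (\<forall>b\<in>B. \<bar>c b\<bar> < d) \<longrightarrow>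
     norm (m (x + (\<Sum>b\<in>B. c b *\<^sub>R b)) - m x - (\<Sum>b\<in>B. c b *\<^sub>R partial_deriv b m x)) \<le> e * (\<Sum>b\<in>B. \<bar>c b\<bar>)"
  using B
proof (induction B rule: finite_induct)
  case empty
  then show ?case by (auto intro: exI[of _ 1])
next
  case (insert b0 B)
  then obtain d where d: "d > 0" "\<And>c. (\<forall>b\<in>B. \<bar>c b\<bar> < d) \<Longrightarrow>
     norm (m (x + (\<Sum>b\<in>B. c b *\<^sub>R b)) - m x - (\<Sum>b\<in>B. c b *\<^sub>R partial_deriv b m x)) \<le> e * (\<Sum>b\<in>B. \<bar>c b\<bar>)"
    by auto
  have b0: "b0 \<in> Basis" and B: "B \<subseteq> Basis" using insert by auto
  have "continuous_on UNIV (partial_deriv b0 m)" using m b0 by simp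
  then obtain \<eta> where \<eta>: "\<eta> > 0" "\<And>z. norm (z - x) < \<eta> \<Longrightarrow> norm (partial_deriv b0 m z - partial_deriv b0 m x) < e"
    using \<open>e > 0\<close> by (force simp: continuous_on_iff dist_norm)
  \<comment> \<open>The directions already moved contribute at most \<open>card B * d'\<close> and
    the new one less than \<open>d'\<close>, so the whole segment stays within \<eta> of x.\<close>
  define d' where "d' = min d (\<eta> / (real (card B) + 1))"
  show ?case
  proof (intro exI[of _ d'] conjI allI impI)
    show "d' > 0" using d \<eta> by (simp add: d'_def add_nonneg_pos)
    fix c :: "'a \<Rightarrow> real" assume c: "\<forall>b\<in>insert b0 B. \<bar>c b\<bar> < d'"
    define w where "w = x + (\<Sum>b\<in>B. c b *\<^sub>R b)"
    have wx: "norm (w - x) \<le> real (card B) * d'"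
    proof -
      have "norm (w - x) \<le> (\<Sum>b\<in>B. norm (c b *\<^sub>R b))" unfolding w_def using norm_sum[of "\<lambda>b. c b *\<^sub>R b" B] by simp
      also have "\<dots> \<le> (\<Sum>b\<in>B. d')" using c B by (intro sum_mono) (auto intro!: less_imp_le)
      finally show ?thesis by simp
    qed
    have near: "norm (partial_deriv b0 m (w + s *\<^sub>R b0) - partial_deriv b0 m x) \<le> e" if "\<bar>s\<bar> \<le> \<bar>c b0\<bar>" for s :: real
    proof -
      have "norm (w + s *\<^sub>R b0 - x) \<le> norm (w - x) + \<bar>s\<bar>"
        using norm_triangle_ineq[of "w - x" "s *\<^sub>R b0"] b0 by (simp add: algebra_simps)
      also have "\<dots> < real (card B) * d' + d'" using wx that c by fastforce
      also have "\<dots> = (real (card B) + 1) * d'" by (simp add: algebra_simps)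
      also have "\<dots> \<le> (real (card B) + 1) * (\<eta> / (real (card B) + 1))" by (intro mult_left_mono) (auto simp: d'_def)
      also have "\<dots> = \<eta>" by (simp add: add_nonneg_eq_0_iff)
      finally show ?thesis using \<eta>(2) by (simp add: less_imp_le)
    qed
    \<comment> \<open>Mean value inequality for m minus its linear part along \<open>b0\<close>: the
      derivative of this function is a difference of partial derivatives, at most e by
      \<open>near\<close>.\<close>
    have "norm ((m (w + c b0 *\<^sub>R b0) - c b0 *\<^sub>R partial_deriv b0 m x) - (m (w + 0 *\<^sub>R b0) - 0 *\<^sub>R partial_deriv b0 m x)) \<le> e * norm (c b0 - 0)"
    proof (rule differentiable_bound[of "cball 0 \<bar>c b0\<bar>" "\<lambda>s. m (w + s *\<^sub>R b0) - s *\<^sub>R partial_deriv b0 m x"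
          "\<lambda>s h. h *\<^sub>R (partial_deriv b0 m (w + s *\<^sub>R b0) - partial_deriv b0 m x)"])
      fix s :: real assume s: "s \<in> cball 0 \<bar>c b0\<bar>"
      have "((\<lambda>s. m (w + s *\<^sub>R b0) - s *\<^sub>R partial_deriv b0 m x) has_vector_derivative
          partial_deriv b0 m (w + s *\<^sub>R b0) - 1 *\<^sub>R partial_deriv b0 m x) (at s)"
        using m b0 by (auto intro!: derivative_eq_intros Ck_has_vector_derivative[where k=0])
      then show "((\<lambda>s. m (w + s *\<^sub>R b0) - s *\<^sub>R partial_deriv b0 m x) has_derivative
          (\<lambda>h. h *\<^sub>R (partial_deriv b0 m (w + s *\<^sub>R b0) - partial_deriv b0 m x))) (at s within cball 0 \<bar>c b0\<bar>)"
        by (simp add: has_vector_derivative_def has_derivative_at_withinI)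
      show "onorm (\<lambda>h. h *\<^sub>R (partial_deriv b0 m (w + s *\<^sub>R b0) - partial_deriv b0 m x)) \<le> e"
        using near[of s] s by (intro onorm_le) (auto simp: mult.commute[of e] intro!: mult_left_mono)
    qed auto
    then have step: "norm (m (w + c b0 *\<^sub>R b0) - m w - c b0 *\<^sub>R partial_deriv b0 m x) \<le> e * \<bar>c b0\<bar>"
      by (simp add: algebra_simps)
    have "norm (m w - m x - (\<Sum>b\<in>B. c b *\<^sub>R partial_deriv b m x)) \<le> e * (\<Sum>b\<in>B. \<bar>c b\<bar>)"
      unfolding w_def using c by (intro d(2)) (auto simp: d'_def)
    note add_mono[OF step this]
    moreover have "x + (\<Sum>b\<in>insert b0 B. c b *\<^sub>R b) = w + c b0 *\<^sub>R b0" using insert by (simp add: w_def)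
    moreover have "m (w + c b0 *\<^sub>R b0) - m x - (\<Sum>b\<in>insert b0 B. c b *\<^sub>R partial_deriv b m x) =
       (m (w + c b0 *\<^sub>R b0) - m w - c b0 *\<^sub>R partial_deriv b0 m x) + (m w - m x - (\<Sum>b\<in>B. c b *\<^sub>R partial_deriv b m x))"
      using insert by simp
    ultimately show "norm (m (x + (\<Sum>b\<in>insert b0 B. c b *\<^sub>R b)) - m x - (\<Sum>b\<in>insert b0 B. c b *\<^sub>R partial_deriv b m x))
        \<le> e * (\<Sum>b\<in>insert b0 B. \<bar>c b\<bar>)"
      using insert by (metis (no_types, lifting) distrib_left norm_triangle_le sum.insert)
  qed
qed

text \<open>\<open>Ck\<close> speaks of coordinate directions only, whereas t -> m(t p) moves in the
  direction p. Continuity of the partial derivatives yields total differentiability; the tolerance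
  e/D absorbs the sum of the D coordinates, each at most the norm.\<close>

lemma Ck_1_has_derivative:
  fixes m :: "'a::euclidean_space \<Rightarrow> 'b::real_normed_vector"
  assumes m: "Ck 1 m"
  shows "(m has_derivative (\<lambda>h. \<Sum>b\<in>Basis. (h \<bullet> b) *\<^sub>R partial_deriv b m x)) (at x)"
  unfolding has_derivative_at_alt
proof (intro conjI allI impI)
  show "bounded_linear (\<lambda>h. \<Sum>b\<in>Basis. (h \<bullet> b) *\<^sub>R partial_deriv b m x)"
    by (intro bounded_linear_sum bounded_linear_scaleR_const bounded_linear_inner_left)
  fix e :: real assume e: "e > 0"
  define D where "D = real DIM('a)"
  have D: "D > 0" by (simp add: D_def)
  obtain d where d: "d > 0" "\<And>c. (\<forall>b\<in>Basis. \<bar>c b\<bar> < d) \<Longrightarrow>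
     norm (m (x + (\<Sum>b\<in>Basis. c b *\<^sub>R b)) - m x - (\<Sum>b\<in>Basis. c b *\<^sub>R partial_deriv b m x)) \<le> e / D * (\<Sum>b\<in>Basis. \<bar>c b\<bar>)"
    using partial_increment_bound[OF m finite_Basis order_refl, of "e / D" x] e D by auto
  show "\<exists>d>0. \<forall>y. norm (y - x) < d \<longrightarrow> norm (m y - m x - (\<Sum>b\<in>Basis. ((y - x) \<bullet> b) *\<^sub>R partial_deriv b m x)) \<le> e * norm (y - x)"
  proof (intro exI[of _ d] conjI allI impI d)
    fix y assume y: "norm (y - x) < d"
    have "norm (m (x + (\<Sum>b\<in>Basis. ((y - x) \<bullet> b) *\<^sub>R b)) - m x - (\<Sum>b\<in>Basis. ((y - x) \<bullet> b) *\<^sub>R partial_deriv b m x))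
        \<le> e / D * (\<Sum>b\<in>Basis. \<bar>(y - x) \<bullet> b\<bar>)"
      using y Basis_le_norm[of _ "y - x"] by (intro d(2)) (auto intro: le_less_trans)
    also have "\<dots> \<le> e / D * (\<Sum>b\<in>(Basis :: 'a set). norm (y - x))"
      using e D by (intro mult_left_mono sum_mono) (auto simp: Basis_le_norm)
    also have "\<dots> = e * norm (y - x)" using D by (simp add: D_def)
    also have "x + (\<Sum>b\<in>Basis. ((y - x) \<bullet> b) *\<^sub>R b) = y" unfolding euclidean_representation by simp
    finally show "norm (m y - m x - (\<Sum>b\<in>Basis. ((y - x) \<bullet> b) *\<^sub>R partial_deriv b m x)) \<le> e * norm (y - x)" .
  qed
qed

text \<open>p . grad m(t p), the derivative of t -> m(t p). Its factor p, of size about 2^j on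
  annulus j, is the price of a derivative in t.\<close>

definition radial_deriv :: "('a::euclidean_space \<Rightarrow> 'b::real_normed_vector) \<Rightarrow> real \<Rightarrow> 'a \<Rightarrow> 'b" where
  "radial_deriv m t p = (\<Sum>b\<in>Basis. (p \<bullet> b) *\<^sub>R partial_deriv b m (t *\<^sub>R p))"

lemma has_vector_derivative_radial:
  fixes m :: "'a::euclidean_space \<Rightarrow> 'b::real_normed_vector"
  assumes m: "Ck 1 m"
  shows "((\<lambda>t. m (t *\<^sub>R p)) has_vector_derivative radial_deriv m t p) (at t)"
proof -
  have "((\<lambda>t. t *\<^sub>R p) has_derivative (\<lambda>h. h *\<^sub>R p)) (at t)"
    by (auto intro!: derivative_eq_intros)
  from has_derivative_compose[OF this Ck_1_has_derivative[OF m]]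
  show ?thesis
    unfolding has_vector_derivative_def radial_deriv_def
    by (simp add: scaleR_sum_right)
qed

text \<open>Joint continuity in (t, p) serves both the fundamental theorem of calculus in t and the
  joint measurability behind Fubini.\<close>

lemma continuous_radial_deriv:
  fixes m :: "'a::euclidean_space \<Rightarrow> 'b::real_normed_vector"
  assumes m: "Ck 1 m"
  shows "continuous_on UNIV (\<lambda>q. radial_deriv m (fst q) (snd q))"
  unfolding radial_deriv_def
proof (intro continuous_intros)
  fix b :: 'a assume "b \<in> Basis"
  then have "continuous_on UNIV (partial_deriv b m)" using m by simp
  then show "continuous_on UNIV (\<lambda>q. partial_deriv b m (fst q *\<^sub>R snd q))"
    by (rule continuous_on_compose2) (auto intro!: continuous_intros)
qed

text \<open>Recentring every useful interval of a minimal cover at a point of \<open>E\<close> at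
  most doubles its length and does not raise the number. Centres in \<open>E\<close> are at least 1,
  which keeps the nearby dilation parameters away from 0.\<close>

lemma covering_exists:
  fixes E :: "real set"
  assumes "E \<subseteq> {1..2}" "\<delta> > 0"
  shows "\<exists>S. finite S \<and> S \<subseteq> E \<and> card S \<le> covering_number E \<delta> \<and> E \<subseteq> (\<Union>c\<in>S. {c - \<delta>..c + \<delta>})"
proof -
  \<comment> \<open>Equally spaced intervals cover [1, 2], so the \<open>LEAST\<close> that defines
    the covering number is attained.\<close>
  have "\<exists>n S. finite S \<and> card S = n \<and> E \<subseteq> (\<Union>c\<in>S. {c..c + \<delta>})"
  proof -
    obtain N :: nat where N: "1 / \<delta> < real N" using reals_Archimedean2 by blast
    have "E \<subseteq> (\<Union>c\<in>(\<lambda>k. 1 + real k * \<delta>) ` {..N}. {c..c + \<delta>})"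
    proof
      fix t assume "t \<in> E"
      then have t: "1 \<le> t" "t \<le> 2" using assms by auto
      define k where "k = nat \<lfloor>(t - 1) / \<delta>\<rfloor>"
      have nn: "0 \<le> (t - 1) / \<delta>" using t assms by simp
      then have k: "real k \<le> (t - 1) / \<delta>" "(t - 1) / \<delta> < real k + 1"
        unfolding k_def by (auto simp: of_nat_nat)
      have "(t - 1) / \<delta> \<le> 1 / \<delta>" using t assms by (intro divide_right_mono) auto
      with k N have "k \<le> N" by linarith
      moreover have "t \<in> {1 + real k * \<delta>..1 + real k * \<delta> + \<delta>}"
        using k assms(2) by (simp add: field_simps)
      ultimately show "t \<in> (\<Union>c\<in>(\<lambda>k. 1 + real k * \<delta>) ` {..N}. {c..c + \<delta>})" by blast
    qed
    then show ?thesis by (intro exI[of _ "card ((\<lambda>k. 1 + real k * \<delta>) ` {..N})"] exI[of _ "(\<lambda>k. 1 + real k * \<delta>) ` {..N}"]) auto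
  qed
  from LeastI_ex[OF this] obtain S where S: "finite S" "card S = covering_number E \<delta>" "E \<subseteq> (\<Union>c\<in>S. {c..c + \<delta>})"
    unfolding covering_number_def by blast
  \<comment> \<open>Intervals that miss \<open>E\<close> are dropped, so that a point of
    \<open>E\<close> can be chosen in each one left.\<close>
  define S0 where "S0 = {c \<in> S. E \<inter> {c..c + \<delta>} \<noteq> {}}"
  define p where "p c = (SOME t. t \<in> E \<inter> {c..c + \<delta>})" for c
  have p: "p c \<in> E \<inter> {c..c + \<delta>}" if "c \<in> S0" for c
    using that unfolding p_def S0_def by (metis (mono_tags, lifting) ex_in_conv mem_Collect_eq someI_ex)
  show ?thesis
  proof (intro exI[of _ "p ` S0"] conjI)
    have "finite S0" "S0 \<subseteq> S" using S by (auto simp: S0_def)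
    then show "finite (p ` S0)" "card (p ` S0) \<le> covering_number E \<delta>"
      using S card_image_le[of S0 p] card_mono[of S S0] by auto
    show "p ` S0 \<subseteq> E" using p by auto
    show "E \<subseteq> (\<Union>c\<in>p ` S0. {c - \<delta>..c + \<delta>})"
    proof
      fix t assume t: "t \<in> E"
      then obtain c where c: "c \<in> S" "t \<in> {c..c + \<delta>}" using S by blast
      then have "c \<in> S0" using t by (auto simp: S0_def)
      moreover from p[OF this] c have "t \<in> {p c - \<delta>..p c + \<delta>}" by auto
      ultimately show "t \<in> (\<Union>c\<in>p ` S0. {c - \<delta>..c + \<delta>})" by blast
    qed
  qed
qed

text \<open>The limsup bounds the covering numbers from some index \<open>J\<close> on. The finitely
  many earlier ones go into the constant.\<close>

lemma covering_number_le:
  fixes E :: "real set"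
  assumes "upper_minkowski_dim E = ereal \<beta>" "\<epsilon> > 0"
  shows "\<exists>C\<ge>0. \<forall>j. real (covering_number E (1 / (2 * 2 ^ j))) \<le> C * (2 ^ j) powr (\<beta> + \<epsilon>)"
proof -
  have "Limsup (at_right 0) (\<lambda>\<delta>. ereal (ln (real (covering_number E \<delta>)) / ln (1 / \<delta>))) < ereal (\<beta> + \<epsilon>)"
    using assms by (simp add: upper_minkowski_dim_def)
  then have ev: "\<forall>\<^sub>F \<delta> in at_right 0. ereal (ln (real (covering_number E \<delta>)) / ln (1 / \<delta>)) < ereal (\<beta> + \<epsilon>)"
    by (rule Limsup_lessD)
  have "(\<lambda>j. (1/2::real) * (1/2) ^ j) \<longlonglongrightarrow> 1/2 * 0"
    by (intro tendsto_mult tendsto_const LIMSEQ_power_zero) auto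
  then have "(\<lambda>j. 1 / (2 * 2 ^ j) :: real) \<longlonglongrightarrow> 0" by (simp add: power_one_over)
  then have "filterlim (\<lambda>j. 1 / (2 * 2 ^ j) :: real) (at_right 0) sequentially"
    by (simp add: filterlim_at)
  from eventually_compose_filterlim[OF ev this]
  obtain J where J: "\<And>j. j \<ge> J \<Longrightarrow> ln (real (covering_number E (1 / (2 * 2 ^ j)))) / ln (2 * 2 ^ j) < \<beta> + \<epsilon>"
    by (auto simp: eventually_sequentially)
  let ?N = "\<lambda>j. real (covering_number E (1 / (2 * 2 ^ j)))"
  have big: "?N j \<le> 2 powr (\<beta> + \<epsilon>) * (2 ^ j) powr (\<beta> + \<epsilon>)" if "j \<ge> J" for j
  \<comment> \<open>Exponentiating the logarithm recovers the covering number only when it is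
    positive.\<close>
  proof (cases "?N j = 0")
    case False
    have "ln (2 * 2 ^ j :: real) > 0" by (intro ln_gt_zero) (simp add: one_less_power less_le_trans[of 1 2])
    with J[OF that] have "ln (?N j) < (\<beta> + \<epsilon>) * ln (2 * 2 ^ j)" by (simp add: divide_less_eq)
    then have "exp (ln (?N j)) \<le> exp ((\<beta> + \<epsilon>) * ln (2 * 2 ^ j))" by simp
    also have "exp ((\<beta> + \<epsilon>) * ln (2 * 2 ^ j)) = (2 * 2 ^ j) powr (\<beta> + \<epsilon>)" by (simp add: powr_def)
    finally show ?thesis using False by (simp add: powr_mult)
  qed simp
  \<comment> \<open>The first summand comes from \<open>2 * 2 ^ j\<close> against
    \<open>2 ^ j\<close>; the sum dominates every ratio with index below \<open>J\<close>.\<close>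
  define C where "C = 2 powr (\<beta> + \<epsilon>) + (\<Sum>j<J. ?N j / (2 ^ j) powr (\<beta> + \<epsilon>))"
  have C0: "0 \<le> (\<Sum>j<J. ?N j / (2 ^ j) powr (\<beta> + \<epsilon>))" by (intro sum_nonneg) auto
  have "?N j \<le> C * (2 ^ j) powr (\<beta> + \<epsilon>)" for j
  proof (cases "j \<ge> J")
    case True
    have "2 powr (\<beta> + \<epsilon>) * (2 ^ j) powr (\<beta> + \<epsilon>) \<le> C * (2 ^ j) powr (\<beta> + \<epsilon>)"
      unfolding C_def using C0 by (intro mult_right_mono) auto
    with big[OF True] show ?thesis by linarith
  next
    case False
    have "?N j / (2 ^ j) powr (\<beta> + \<epsilon>) \<le> (\<Sum>j<J. ?N j / (2 ^ j) powr (\<beta> + \<epsilon>))"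
      using False by (intro member_le_sum[of j "{..<J}" "\<lambda>j. ?N j / (2 ^ j) powr (\<beta> + \<epsilon>)"]) auto
    also have "\<dots> \<le> C" by (simp add: C_def)
    finally show ?thesis by (simp add: divide_le_eq)
  qed
  moreover have "C \<ge> 0" using C0 by (simp add: C_def)
  ultimately show ?thesis by blast
qed

section \<open>Local suprema and dyadic annuli\<close>

definition esqrt :: "ennreal \<Rightarrow> ennreal" where
  "esqrt x = (if x = top then top else ennreal (sqrt (enn2real x)))"

lemma esqrt_power2: "(esqrt x)\<^sup>2 = x"
  by (cases x) (auto simp: esqrt_def ennreal_power top_power_ennreal)

lemma le_esqrt: "a\<^sup>2 \<le> x \<Longrightarrow> a \<le> esqrt x"
  by (rule ennreal_power2_le_cancel) (simp add: esqrt_power2)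

lemma ennreal_add_power2_le: "(a + b)\<^sup>2 \<le> 2 * a\<^sup>2 + 2 * (b::ennreal)\<^sup>2"
proof (cases "a = top \<or> b = top")
  case True
  then show ?thesis by (auto simp: top_power_ennreal ennreal_mult_top)
next
  case False
  then obtain r s where rs: "a = ennreal r" "b = ennreal s" "r \<ge> 0" "s \<ge> 0"
    by (cases a; cases b) auto
  have "(r + s)\<^sup>2 \<le> 2 * r\<^sup>2 + 2 * s\<^sup>2"
    using zero_le_power2[of "r - s"] by (simp add: power2_eq_square algebra_simps)
  from ennreal_leI[OF this] have "ennreal ((r + s)\<^sup>2) \<le> 2 * ennreal (r\<^sup>2) + 2 * ennreal (s\<^sup>2)"
    by (simp add: ennreal_mult')
  moreover have "a + b = ennreal (r + s)" using rs by simp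
  ultimately show ?thesis using rs by (simp add: ennreal_power del: ennreal_plus)
qed

section \<open>Dependence on the dilation parameter\<close>

lemma integrable_inv_fourier2_kernel:
  fixes P :: "'a::euclidean_space \<times> 'a \<Rightarrow> complex"
  assumes "integrable lborel P"
  shows "integrable lborel (\<lambda>p. P p * wave (x \<bullet> (fst p + snd p)))"
proof (rule Bochner_Integration.integrable_bound[OF assms])
  have [measurable]: "P \<in> borel_measurable borel" using assms by auto
  show "(\<lambda>p. P p * wave (x \<bullet> (fst p + snd p))) \<in> borel_measurable lborel"
    by simp
qed (auto simp: norm_mult)

lemma inv_fourier2_diff:
  assumes "integrable lborel P" "integrable lborel Q"
  shows "inv_fourier2 (\<lambda>p. P p - Q p) x = inv_fourier2 P x - inv_fourier2 Q x"
  unfolding inv_fourier2_def left_diff_distrib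
  by (rule Bochner_Integration.integral_diff) (intro integrable_inv_fourier2_kernel assms)+

lemma inv_fourier2_sum:
  assumes "\<And>i. i \<in> I \<Longrightarrow> integrable lborel (P i)"
  shows "inv_fourier2 (\<lambda>p. \<Sum>i\<in>I. P i p) x = (\<Sum>i\<in>I. inv_fourier2 (P i) x)"
  unfolding inv_fourier2_def sum_distrib_right
  by (rule Bochner_Integration.integral_sum) (intro integrable_inv_fourier2_kernel assms)

lemma borel_measurable_uncurried:
  assumes "(\<lambda>q. N (fst q) (snd q)) \<in> borel_measurable borel"
    and "f \<in> borel_measurable M" "g \<in> borel_measurable M"
  shows "(\<lambda>x. N (f x :: 'a::second_countable_topology) (g x :: 'b::second_countable_topology)) \<in> borel_measurable M"
  using measurable_compose[OF borel_measurable_Pair[OF assms(2,3)] assms(1)] by simp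

text \<open>Fundamental theorem of calculus in s for each frequency, then Fubini. The bound is put
  on the product \<open>W p * N s p\<close>, so the radial derivative has to be controlled only
  where \<open>W\<close> is non-zero, that is, on one annulus.\<close>

lemma inv_fourier2_increment:
  fixes W :: "'a::euclidean_space \<times> 'a \<Rightarrow> complex" and M N :: "real \<Rightarrow> 'a \<times> 'a \<Rightarrow> complex"
  assumes W: "integrable lborel W" and "\<alpha> \<le> \<beta>"
    and der: "\<And>s p. ((\<lambda>s. M s p) has_vector_derivative N s p) (at s)"
    and cont: "continuous_on UNIV (\<lambda>q. N (fst q) (snd q))"
    and bound: "\<And>s p. s \<in> {\<alpha>..\<beta>} \<Longrightarrow> norm (W p * N s p) \<le> K * norm (W p)"
    and M: "integrable lborel (\<lambda>p. W p * M \<alpha> p)" "integrable lborel (\<lambda>p. W p * M \<beta> p)"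
  shows "enorm (product_mult W (M \<beta>) x - product_mult W (M \<alpha>) x)
     \<le> (\<integral>\<^sup>+s. indicator {\<alpha>..\<beta>} s * enorm (product_mult W (N s) x) \<partial>lborel)"
proof -
  have [measurable]: "W \<in> borel_measurable borel" using W by auto
  have "(\<lambda>q. N (fst q) (snd q)) \<in> borel_measurable borel"
    by (rule borel_measurable_continuous_onI[OF cont])
  note N = borel_measurable_uncurried[OF this]
  define e where "e p = wave (x \<bullet> (fst p + snd p))" for p :: "'a \<times> 'a"
  have [measurable]: "e \<in> borel_measurable borel" unfolding e_def by measurable
  have e [simp]: "norm (e p) = 1" for p unfolding e_def by simp
  have inv: "inv_fourier2 P x = (LINT p|lborel. P p * e p)" for P by (simp add: inv_fourier2_def e_def)
  have ftc: "M \<beta> p - M \<alpha> p = (LINT s|lborel. indicator {\<alpha>..\<beta>} s *\<^sub>R N s p)" for p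
  proof (rule integral_FTC_atLeastAtMost[OF \<open>\<alpha> \<le> \<beta>\<close>, symmetric])
    show "((\<lambda>s. M s p) has_vector_derivative N s p) (at s within {\<alpha>..\<beta>})" for s
      using der by (rule has_vector_derivative_at_within)
    show "continuous_on {\<alpha>..\<beta>} (\<lambda>s. N s p)"
    proof -
      have "continuous_on {\<alpha>..\<beta>} (\<lambda>s. (s, p))" by (intro continuous_intros)
      from continuous_on_compose2[OF cont this] show ?thesis by simp
    qed
  qed
  have int: "integrable (lborel \<Otimes>\<^sub>M lborel) (\<lambda>(p, s). W p * (indicator {\<alpha>..\<beta>} s *\<^sub>R N s p) * e p)"
  proof (rule Bochner_Integration.integrable_bound)
    have "integrable lborel (\<lambda>s. complex_of_real (indicator {\<alpha>..\<beta>} s))"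
      using \<open>\<alpha> \<le> \<beta>\<close> by (intro integrable_of_real integrable_real_indicator) auto
    from integrable_mult_right[OF integrable_tensor[OF W this], of "of_real K"]
    show "integrable (lborel \<Otimes>\<^sub>M lborel) (\<lambda>q. of_real K * (W (fst q) * complex_of_real (indicator {\<alpha>..\<beta>} (snd q))))"
      unfolding lborel_prod .
    have [measurable]: "(\<lambda>q. N (snd q) (fst q)) \<in> borel_measurable (lborel \<Otimes>\<^sub>M lborel)"
      by (rule N) auto
    show "(\<lambda>(p, s). W p * (indicator {\<alpha>..\<beta>} s *\<^sub>R N s p) * e p) \<in> borel_measurable (lborel \<Otimes>\<^sub>M lborel)"
      unfolding split_beta' by measurable
    have "norm (W p * N s p) \<le> \<bar>K\<bar> * norm (W p)" if "s \<in> {\<alpha>..\<beta>}" for p s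
      using bound[OF that, of p] by (meson abs_ge_self mult_right_mono norm_ge_zero order_trans)
    then show "AE q in lborel \<Otimes>\<^sub>M lborel. norm (case q of (p, s) \<Rightarrow> W p * (indicator {\<alpha>..\<beta>} s *\<^sub>R N s p) * e p)
        \<le> norm (of_real K * (W (fst q) * complex_of_real (indicator {\<alpha>..\<beta>} (snd q))))"
      by (auto simp: norm_mult indicator_def intro!: AE_I2)
  qed
  have "product_mult W (M \<beta>) x - product_mult W (M \<alpha>) x
      = (LINT p|lborel. LINT s|lborel. W p * (indicator {\<alpha>..\<beta>} s *\<^sub>R N s p) * e p)"
  proof -
    have "product_mult W (M \<beta>) x - product_mult W (M \<alpha>) x
       = inv_fourier2 (\<lambda>p. W p * M \<beta> p - W p * M \<alpha> p) x"
      by (rule inv_fourier2_diff[OF M(2,1), symmetric])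
    also have "(\<lambda>p. W p * M \<beta> p - W p * M \<alpha> p) = (\<lambda>p. W p * (LINT s|lborel. indicator {\<alpha>..\<beta>} s *\<^sub>R N s p))"
      by (simp add: ftc[symmetric] right_diff_distrib)
    finally show ?thesis by (simp only: inv integral_mult_left_zero integral_mult_right_zero)
  qed
  also have "\<dots> = (LINT s|lborel. LINT p|lborel. W p * (indicator {\<alpha>..\<beta>} s *\<^sub>R N s p) * e p)"
    by (rule lborel_pair.Fubini_integral[symmetric]) (rule int)
  also have "\<dots> = (LINT s|lborel. indicator {\<alpha>..\<beta>} s *\<^sub>R product_mult W (N s) x)"
    by (intro Bochner_Integration.integral_cong refl) (auto simp: inv indicator_def)
  finally have "enorm (product_mult W (M \<beta>) x - product_mult W (M \<alpha>) x)
     \<le> (\<integral>\<^sup>+s. enorm (indicator {\<alpha>..\<beta>} s *\<^sub>R product_mult W (N s) x) \<partial>lborel)"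
    by (simp only: ennreal_norm_integral_le)
  also have "\<dots> = (\<integral>\<^sup>+s. indicator {\<alpha>..\<beta>} s * enorm (product_mult W (N s) x) \<partial>lborel)"
    by (intro nn_integral_cong) (simp add: indicator_def)
  finally show ?thesis .
qed

text \<open>The parameters enter through \<open>f\<close> and \<open>g\<close>, so that one
  statement covers measurability in x alone, in s alone and in both jointly.\<close>

lemma measurable_inv_fourier2_param:
  fixes W :: "'a::euclidean_space \<times> 'a \<Rightarrow> complex" and N :: "real \<Rightarrow> 'a \<times> 'a \<Rightarrow> complex"
  assumes [measurable]: "W \<in> borel_measurable borel"
    and N: "(\<lambda>q. N (fst q) (snd q)) \<in> borel_measurable borel"
    and [measurable]: "f \<in> borel_measurable M" "g \<in> borel_measurable M"
  shows "(\<lambda>q. inv_fourier2 (\<lambda>p. W p * N (f q) p) (g q)) \<in> borel_measurable M"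
proof -
  have [measurable]: "(\<lambda>q. N (f (fst q)) (snd q)) \<in> borel_measurable (M \<Otimes>\<^sub>M lborel)"
    by (rule borel_measurable_uncurried[OF N]) measurable
  have "(\<lambda>(q, p). W p * N (f q) p * wave (g q \<bullet> (fst p + snd p))) \<in> borel_measurable (M \<Otimes>\<^sub>M lborel)"
    unfolding split_beta' by measurable
  then show ?thesis
    unfolding inv_fourier2_def by (rule lborel.borel_measurable_lebesgue_integral)
qed

text \<open>The right-hand side of |\<phi>(t)|^2 <= 2 |\<phi>(c)|^2 + 2 \<delta> \<integral>
  |\<phi>'|^2 over the interval around c. It is free of t, and being an explicit integral it is
  measurable in x and can be integrated by Tonelli.\<close>

definition local_majorant :: "('a::euclidean_space \<times> 'a \<Rightarrow> complex) \<Rightarrow> (real \<Rightarrow> 'a \<times> 'a \<Rightarrow> complex) \<Rightarrow>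
    (real \<Rightarrow> 'a \<times> 'a \<Rightarrow> complex) \<Rightarrow> real \<Rightarrow> real \<Rightarrow> 'a \<Rightarrow> ennreal" where
  "local_majorant W M N \<delta> c x = 2 * (enorm (product_mult W (M c) x))\<^sup>2 +
     2 * (ennreal \<delta> * (\<integral>\<^sup>+s. indicator {c - \<delta>..c + \<delta>} s * (enorm (product_mult W (N s) x))\<^sup>2 \<partial>lborel))"

text \<open>A one-dimensional Sobolev embedding in \<open>t\<close>: the fundamental theorem of calculus followed by
  Cauchy-Schwarz.\<close>

lemma local_majorant_bound:
  fixes W :: "'a::euclidean_space \<times> 'a \<Rightarrow> complex" and M N :: "real \<Rightarrow> 'a \<times> 'a \<Rightarrow> complex"
  assumes W: "integrable lborel W" and t: "t \<in> {c - \<delta>..c + \<delta>}"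
    and der: "\<And>s p. ((\<lambda>s. M s p) has_vector_derivative N s p) (at s)"
    and cont: "continuous_on UNIV (\<lambda>q. N (fst q) (snd q))"
    and bound: "\<And>s p. s \<in> {c - \<delta>..c + \<delta>} \<Longrightarrow> norm (W p * N s p) \<le> K * norm (W p)"
    and M: "integrable lborel (\<lambda>p. W p * M c p)" "integrable lborel (\<lambda>p. W p * M t p)"
  shows "(enorm (product_mult W (M t) x))\<^sup>2 \<le> local_majorant W M N \<delta> c x"
proof -
  have [measurable]: "W \<in> borel_measurable borel" using W by auto
  have Nm: "(\<lambda>q. N (fst q) (snd q)) \<in> borel_measurable borel"
    by (rule borel_measurable_continuous_onI[OF cont])
  define \<phi> where "\<phi> s = product_mult W (M s) x" for s
  define \<psi> where "\<psi> s = enorm (product_mult W (N s) x)" for s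
  have [measurable]: "\<psi> \<in> borel_measurable borel"
    unfolding \<psi>_def using measurable_inv_fourier2_param[OF _ Nm, of W "\<lambda>s. s" borel "\<lambda>_. x"] by measurable
  \<comment> \<open>Ordering the endpoints treats t before and after c at once; the interval has
    length |t - c|, at most \<delta>.\<close>
  define \<alpha> \<beta> where "\<alpha> = min c t" and "\<beta> = max c t"
  have sub: "{\<alpha>..\<beta>} \<subseteq> {c - \<delta>..c + \<delta>}" using t by (auto simp: \<alpha>_def \<beta>_def)
  have "enorm (\<phi> \<beta> - \<phi> \<alpha>) \<le> (\<integral>\<^sup>+s. indicator {\<alpha>..\<beta>} s * \<psi> s \<partial>lborel)"
    unfolding \<phi>_def \<psi>_def
  proof (rule inv_fourier2_increment[OF W _ der cont])
    show "norm (W p * N s p) \<le> K * norm (W p)" if "s \<in> {\<alpha>..\<beta>}" for s p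
      using bound that sub by blast
  qed (use M in \<open>auto simp: \<alpha>_def \<beta>_def min_def max_def\<close>)
  also have "norm (\<phi> \<beta> - \<phi> \<alpha>) = norm (\<phi> t - \<phi> c)"
    by (auto simp: \<alpha>_def \<beta>_def min_def max_def norm_minus_commute)
  finally have "enorm (\<phi> t - \<phi> c) \<le> (\<integral>\<^sup>+s. indicator {\<alpha>..\<beta>} s * \<psi> s \<partial>lborel)" .
  \<comment> \<open>The indicator is doubled: one copy is the Cauchy-Schwarz partner and contributes
    the length of the interval.\<close>
  then have "(enorm (\<phi> t - \<phi> c))\<^sup>2 \<le> (\<integral>\<^sup>+s. indicator {\<alpha>..\<beta>} s * (indicator {\<alpha>..\<beta>} s * \<psi> s) \<partial>lborel)\<^sup>2"
    by (intro power_mono) (auto simp: mult.assoc[symmetric] simp flip: indicator_inter_arith)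
  also have "\<dots> \<le> (\<integral>\<^sup>+s. (indicator {\<alpha>..\<beta>} s)\<^sup>2 \<partial>lborel) * (\<integral>\<^sup>+s. (indicator {\<alpha>..\<beta>} s * \<psi> s)\<^sup>2 \<partial>lborel)"
    by (rule Cauchy_Schwarz_nn_integral) measurable
  also have "\<dots> \<le> ennreal \<delta> * (\<integral>\<^sup>+s. indicator {c - \<delta>..c + \<delta>} s * (\<psi> s)\<^sup>2 \<partial>lborel)"
  proof (rule mult_mono)
    have "(\<integral>\<^sup>+s. (indicator {\<alpha>..\<beta>} s)\<^sup>2 \<partial>lborel) = (\<integral>\<^sup>+s. indicator {\<alpha>..\<beta>} s \<partial>lborel)"
      by (intro nn_integral_cong) (simp add: indicator_def)
    also have "\<dots> = ennreal (\<beta> - \<alpha>)" by (simp add: \<alpha>_def \<beta>_def)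
    also have "\<dots> \<le> ennreal \<delta>" using t by (intro ennreal_leI) (auto simp: \<alpha>_def \<beta>_def)
    finally show "(\<integral>\<^sup>+s. (indicator {\<alpha>..\<beta>} s)\<^sup>2 \<partial>lborel) \<le> ennreal \<delta>" .
    show "(\<integral>\<^sup>+s. (indicator {\<alpha>..\<beta>} s * \<psi> s)\<^sup>2 \<partial>lborel) \<le> (\<integral>\<^sup>+s. indicator {c - \<delta>..c + \<delta>} s * (\<psi> s)\<^sup>2 \<partial>lborel)"
      using sub by (intro nn_integral_mono) (auto simp: indicator_def)
  qed auto
  finally have I: "(enorm (\<phi> t - \<phi> c))\<^sup>2 \<le> ennreal \<delta> * (\<integral>\<^sup>+s. indicator {c - \<delta>..c + \<delta>} s * (\<psi> s)\<^sup>2 \<partial>lborel)" .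
  have "enorm (\<phi> t) \<le> enorm (\<phi> c) + enorm (\<phi> t - \<phi> c)"
    using norm_triangle_ineq[of "\<phi> c" "\<phi> t - \<phi> c"] by (simp flip: ennreal_plus)
  then have "(enorm (\<phi> t))\<^sup>2 \<le> (enorm (\<phi> c) + enorm (\<phi> t - \<phi> c))\<^sup>2"
    by (intro power_mono) auto
  also have "\<dots> \<le> 2 * (enorm (\<phi> c))\<^sup>2 + 2 * (enorm (\<phi> t - \<phi> c))\<^sup>2"
    by (rule ennreal_add_power2_le)
  also have "\<dots> \<le> local_majorant W M N \<delta> c x"
    unfolding local_majorant_def \<phi>_def[symmetric] \<psi>_def[symmetric] by (intro add_left_mono mult_left_mono I) auto
  finally show ?thesis by (simp add: \<phi>_def)
qed

lemma local_majorant_measurable: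
  fixes W :: "'a::euclidean_space \<times> 'a \<Rightarrow> complex" and M N :: "real \<Rightarrow> 'a \<times> 'a \<Rightarrow> complex"
  assumes [measurable]: "W \<in> borel_measurable borel"
    and M: "M c \<in> borel_measurable borel"
    and N: "(\<lambda>q. N (fst q) (snd q)) \<in> borel_measurable borel"
  shows "local_majorant W M N \<delta> c \<in> borel_measurable borel"
proof -
  have "(\<lambda>q. M c (snd q)) \<in> borel_measurable (borel :: (real \<times> 'a \<times> 'a) measure)"
    using M by measurable
  then have [measurable]: "product_mult W (M c) \<in> borel_measurable borel"
    using measurable_inv_fourier2_param[of W "\<lambda>_. M c" "\<lambda>x. 0" borel "\<lambda>x. x"] by simp
  have [measurable]: "(\<lambda>q. inv_fourier2 (\<lambda>p. W p * N (snd q) p) (fst q)) \<in> borel_measurable (borel \<Otimes>\<^sub>M lborel)"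
    by (rule measurable_inv_fourier2_param[OF _ N]) measurable
  have [measurable]: "(\<lambda>x. \<integral>\<^sup>+s. indicator {c - \<delta>..c + \<delta>} s * (enorm (product_mult W (N s) x))\<^sup>2 \<partial>lborel) \<in> borel_measurable borel"
    by (rule lborel.borel_measurable_nn_integral) (simp add: split_beta')
  show ?thesis unfolding local_majorant_def by measurable
qed

text \<open>Tonelli in (x, s). The constant 4 \<delta>^2 is 2 from squaring a sum, times \<delta>
  from Cauchy-Schwarz, times the length 2 \<delta> of the interval.\<close>

lemma nn_integral_local_majorant:
  fixes W :: "'a::euclidean_space \<times> 'a \<Rightarrow> complex" and M N :: "real \<Rightarrow> 'a \<times> 'a \<Rightarrow> complex"
  assumes [measurable]: "W \<in> borel_measurable borel"
    and M: "M c \<in> borel_measurable borel"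
    and N: "(\<lambda>q. N (fst q) (snd q)) \<in> borel_measurable borel"
    and X0: "energy (product_mult W (M c)) \<le> X0"
    and X1: "\<And>s. s \<in> {c - \<delta>..c + \<delta>} \<Longrightarrow> energy (product_mult W (N s)) \<le> X1"
    and "\<delta> \<ge> 0"
  shows "(\<integral>\<^sup>+x. local_majorant W M N \<delta> c x \<partial>lborel) \<le> 2 * X0 + ennreal (4 * \<delta>\<^sup>2) * X1"
proof -
  have "(\<lambda>q. M c (snd q)) \<in> borel_measurable (borel :: (real \<times> 'a \<times> 'a) measure)"
    using M by measurable
  then have [measurable]: "product_mult W (M c) \<in> borel_measurable borel"
    using measurable_inv_fourier2_param[of W "\<lambda>_. M c" "\<lambda>x. 0" borel "\<lambda>x. x"] by simp
  have meas: "(\<lambda>q. inv_fourier2 (\<lambda>p. W p * N (snd q) p) (fst q)) \<in> borel_measurable (lborel \<Otimes>\<^sub>M lborel)"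
    by (rule measurable_inv_fourier2_param[OF _ N]) measurable
  define \<Psi> where "\<Psi> x s = indicator {c - \<delta>..c + \<delta>} s * (enorm (product_mult W (N s) x))\<^sup>2" for x s
  have \<Psi>: "case_prod \<Psi> \<in> borel_measurable (lborel \<Otimes>\<^sub>M lborel)"
    unfolding \<Psi>_def split_beta' using meas by measurable
  have [measurable]: "(\<lambda>x. \<integral>\<^sup>+s. \<Psi> x s \<partial>lborel) \<in> borel_measurable borel"
    using lborel.borel_measurable_nn_integral[OF \<Psi>] by simp
  have "(\<integral>\<^sup>+x. \<integral>\<^sup>+s. \<Psi> x s \<partial>lborel \<partial>lborel) = (\<integral>\<^sup>+s. \<integral>\<^sup>+x. \<Psi> x s \<partial>lborel \<partial>lborel)"
    by (rule lborel_pair.Fubini'[symmetric]) (rule \<Psi>)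
  also have "\<dots> \<le> (\<integral>\<^sup>+s. indicator {c - \<delta>..c + \<delta>} s * X1 \<partial>lborel)"
  proof (rule nn_integral_mono)
    fix s
    have "(\<lambda>x. product_mult W (N s) x) \<in> borel_measurable borel"
      by (rule measurable_inv_fourier2_param[OF _ N]) measurable
    then have "(\<integral>\<^sup>+x. \<Psi> x s \<partial>lborel) = indicator {c - \<delta>..c + \<delta>} s * energy (product_mult W (N s))"
      unfolding \<Psi>_def energy_def by (intro nn_integral_cmult) measurable
    then show "(\<integral>\<^sup>+x. \<Psi> x s \<partial>lborel) \<le> indicator {c - \<delta>..c + \<delta>} s * X1"
      using X1[of s] by (auto simp: indicator_def)
  qed
  also have "\<dots> = ennreal (2 * \<delta>) * X1"
    using \<open>\<delta> \<ge> 0\<close> by (simp add: nn_integral_multc)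
  finally have I: "(\<integral>\<^sup>+x. \<integral>\<^sup>+s. \<Psi> x s \<partial>lborel \<partial>lborel) \<le> ennreal (2 * \<delta>) * X1" .
  have "(\<integral>\<^sup>+x. local_majorant W M N \<delta> c x \<partial>lborel) =
      2 * energy (product_mult W (M c)) + 2 * (ennreal \<delta> * (\<integral>\<^sup>+x. \<integral>\<^sup>+s. \<Psi> x s \<partial>lborel \<partial>lborel))"
    unfolding local_majorant_def \<Psi>_def[symmetric] energy_def
    by (subst nn_integral_add) (auto simp: nn_integral_cmult)
  also have "\<dots> \<le> 2 * X0 + 2 * (ennreal \<delta> * (ennreal (2 * \<delta>) * X1))"
    by (intro add_mono mult_left_mono X0 I) auto
  also have "2 * (ennreal \<delta> * (ennreal (2 * \<delta>) * X1)) = ennreal (4 * \<delta>\<^sup>2) * X1"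
  proof -
    have "ennreal (4 * \<delta>\<^sup>2) = ennreal 2 * (ennreal \<delta> * ennreal (2 * \<delta>))"
      using \<open>\<delta> \<ge> 0\<close> by (simp add: power2_eq_square flip: ennreal_mult ennreal_mult'' ennreal_numeral)
    then show ?thesis by (simp add: mult.assoc)
  qed
  finally show ?thesis .
qed

text \<open>Sharp frequency cut-offs suffice, because they do not depend on the dilation parameter \<open>t\<close>.\<close>

definition annulus :: "nat \<Rightarrow> ('a::euclidean_space \<times> 'a) set" where
  "annulus j = {p. 2 ^ j \<le> 1 + norm (fst p) + norm (snd p) \<and> 1 + norm (fst p) + norm (snd p) < 2 * 2 ^ j}"

lemma annulus_measurable [measurable]: "annulus j \<in> sets borel"
  unfolding annulus_def by measurable

text \<open>The half-open shells are consecutive, and shell 0 starts at 1, the least value of 1 +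
  |\<xi>| + |\<eta>|; so they partition the whole frequency space.\<close>

lemma sum_indicator_annulus:
  "(\<Sum>j<n. indicator (annulus j) p :: complex) = (if 1 + norm (fst p) + norm (snd p) < 2 ^ n then 1 else 0)"
proof (induction n)
  case (Suc n)
  have le: "(2::real) ^ n \<le> 2 * 2 ^ n" by simp
  show ?case unfolding sum.lessThan_Suc Suc
    by (auto simp: annulus_def indicator_def intro: less_le_trans[OF _ le])
next
  case 0
  have "0 \<le> norm (fst p) + norm (snd p)" by simp
  then show ?case by (simp add: not_less)
qed

text \<open>At each frequency the partial sums are eventually constant and stay below |P|, so
  dominated convergence applies. The inequality holds at every x, hence survives a supremum over
  t.\<close>

lemma norm_inv_fourier2_le_annuli:
  fixes P :: "'a::euclidean_space \<times> 'a \<Rightarrow> complex"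
  assumes P: "integrable lborel P"
  shows "enorm (inv_fourier2 P x) \<le> (\<Sum>j. enorm (inv_fourier2 (\<lambda>p. indicator (annulus j) p * P p) x))"
proof -
  have [measurable]: "P \<in> borel_measurable borel" using P by auto
  have Pj: "integrable lborel (\<lambda>p. indicator (annulus j) p * P p)" for j
    by (rule Bochner_Integration.integrable_bound[OF P]) (auto simp: norm_mult indicator_def)
  define e where "e p = wave (x \<bullet> (fst p + snd p))" for p :: "'a \<times> 'a"
  have [measurable]: "e \<in> borel_measurable borel" unfolding e_def by measurable
  have e [simp]: "norm (e p) = 1" for p unfolding e_def by simp
  have inv: "inv_fourier2 Q x = (LINT p|lborel. Q p * e p)" for Q by (simp add: inv_fourier2_def e_def)
  have "(\<lambda>n. LINT p|lborel. (\<Sum>j<n. indicator (annulus j) p * P p) * e p) \<longlonglongrightarrow> (LINT p|lborel. P p * e p)"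
  proof (rule integral_dominated_convergence[where w="\<lambda>p. norm (P p)"])
    show "AE p in lborel. (\<lambda>n. (\<Sum>j<n. indicator (annulus j) p * P p) * e p) \<longlonglongrightarrow> P p * e p"
    proof (rule AE_I2, rule Lim_transform_eventually[OF tendsto_const])
      fix p :: "'a \<times> 'a"
      obtain n0 where n0: "1 + norm (fst p) + norm (snd p) < 2 ^ n0"
        using real_arch_pow[of 2 "1 + norm (fst p) + norm (snd p)"] by auto
      have "1 + norm (fst p) + norm (snd p) < 2 ^ n" if "n \<ge> n0" for n
        using n0 power_increasing[OF that, of "2::real"] by linarith
      then show "\<forall>\<^sub>F n in sequentially. P p * e p = (\<Sum>j<n. indicator (annulus j) p * P p) * e p"
        unfolding sum_distrib_right[symmetric] sum_indicator_annulus
        by (auto simp: eventually_sequentially intro!: exI[of _ n0])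
    qed
    show "AE p in lborel. norm ((\<Sum>j<n. indicator (annulus j) p * P p) * e p) \<le> norm (P p)" for n
      unfolding sum_distrib_right[symmetric] sum_indicator_annulus by (auto simp: norm_mult)
  qed (use P in auto)
  then have "(\<lambda>n. inv_fourier2 (\<lambda>p. \<Sum>j<n. indicator (annulus j) p * P p) x) \<longlonglongrightarrow> inv_fourier2 P x"
    by (simp only: inv)
  then have "(\<lambda>n. enorm (inv_fourier2 (\<lambda>p. \<Sum>j<n. indicator (annulus j) p * P p) x)) \<longlonglongrightarrow> enorm (inv_fourier2 P x)"
    by (intro tendsto_ennrealI tendsto_norm)
  moreover have "enorm (inv_fourier2 (\<lambda>p. \<Sum>j<n. indicator (annulus j) p * P p) x)
      \<le> (\<Sum>j. enorm (inv_fourier2 (\<lambda>p. indicator (annulus j) p * P p) x))" for n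
  proof -
    have "enorm (inv_fourier2 (\<lambda>p. \<Sum>j<n. indicator (annulus j) p * P p) x)
       \<le> ennreal (\<Sum>j<n. norm (inv_fourier2 (\<lambda>p. indicator (annulus j) p * P p) x))"
      unfolding inv_fourier2_sum[OF Pj] by (intro ennreal_leI norm_sum)
    also have "\<dots> = (\<Sum>j<n. enorm (inv_fourier2 (\<lambda>p. indicator (annulus j) p * P p) x))"
      by simp
    also have "\<dots> \<le> (\<Sum>j. enorm (inv_fourier2 (\<lambda>p. indicator (annulus j) p * P p) x))"
      by (rule sum_le_suminf) auto
    finally show ?thesis .
  qed
  ultimately show ?thesis
    using LIMSEQ_le_const2 by blast
qed

text \<open>Cauchy-Schwarz for counting measure with weights r^j. It plays the part of Minkowski's
  inequality: a series of squares can be integrated term by term, at the price r^(-2j).\<close>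

lemma suminf_power2_le_weighted:
  fixes a :: "nat \<Rightarrow> ennreal" and r :: real
  assumes "0 < r"
  shows "(\<Sum>j. a j)\<^sup>2 \<le> (\<Sum>j. (ennreal (r ^ j))\<^sup>2) * (\<Sum>j. (ennreal ((1 / r) ^ j))\<^sup>2 * (a j)\<^sup>2)"
proof -
  have "ennreal (r ^ j) * (ennreal ((1 / r) ^ j) * a j) = a j" for j
  proof -
    have "ennreal (r ^ j) * ennreal ((1 / r) ^ j) = 1"
      using assms by (simp flip: ennreal_mult power_mult_distrib)
    then show ?thesis by (simp flip: mult.assoc)
  qed
  then have "(\<Sum>j. a j)\<^sup>2 = (\<integral>\<^sup>+j. ennreal (r ^ j) * (ennreal ((1 / r) ^ j) * a j) \<partial>count_space UNIV)\<^sup>2"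
    by (simp add: nn_integral_count_space_nat)
  also have "\<dots> \<le> (\<integral>\<^sup>+j. (ennreal (r ^ j))\<^sup>2 \<partial>count_space UNIV) * (\<integral>\<^sup>+j. (ennreal ((1 / r) ^ j) * a j)\<^sup>2 \<partial>count_space UNIV)"
    by (rule Cauchy_Schwarz_nn_integral) auto
  finally show ?thesis by (simp add: nn_integral_count_space_nat power_mult_distrib)
qed

section \<open>The maximal estimate\<close>

text \<open>Takes the transform as its argument, so that the main estimate can be stated for
  arbitrary integrable functions on the frequency side.\<close>

definition sobolev_energy :: "real \<Rightarrow> ('a::euclidean_space \<Rightarrow> complex) \<Rightarrow> ennreal" where
  "sobolev_energy s U = energy (\<lambda>\<xi>. (1 + (norm \<xi>)\<^sup>2) powr (- s / 2) *\<^sub>R U \<xi>)"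

lemma neg_sobolev_norm_power2: "(neg_sobolev_norm s f)\<^sup>2 = sobolev_energy s (fourier f)"
  by (simp add: neg_sobolev_norm_def L2_norm_power2 sobolev_energy_def)

lemma norm_le_weighted:
  assumes "s \<ge> 0" "1 + (norm \<xi>)\<^sup>2 \<le> Y"
  shows "norm z \<le> Y powr (s / 2) * norm ((1 + (norm \<xi>)\<^sup>2) powr (- s / 2) *\<^sub>R z)"
proof -
  have pos: "1 + (norm \<xi>)\<^sup>2 > 0" by (simp add: add_pos_nonneg)
  have "norm z = (1 + (norm \<xi>)\<^sup>2) powr (s / 2) * norm ((1 + (norm \<xi>)\<^sup>2) powr (- s / 2) *\<^sub>R z)"
    using pos by (simp add: powr_minus)
  also have "\<dots> \<le> Y powr (s / 2) * norm ((1 + (norm \<xi>)\<^sup>2) powr (- s / 2) *\<^sub>R z)"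
    using assms pos by (intro mult_right_mono powr_mono2) auto
  finally show ?thesis .
qed

text \<open>On annulus j both 1 + |\<xi>|^2 and 1 + |\<eta>|^2 are at most Y = 4 * 4^j, so putting
  in the Sobolev weights costs Y^((s1+s2)/2) before squaring. The first frequency lies in a ball of
  radius 2 * 2^j, and its volume is the last factor.\<close>

lemma annulus_energy:
  fixes U V :: "'a::euclidean_space \<Rightarrow> complex" and Q :: "'a \<times> 'a \<Rightarrow> complex"
  assumes [measurable]: "U \<in> borel_measurable borel" "V \<in> borel_measurable borel"
    and int: "integrable lborel (\<lambda>p. indicator (annulus j) p * (U (fst p) * V (snd p)) * Q p)"
    and "A \<ge> 0" and bound: "\<And>p. p \<in> annulus j \<Longrightarrow> norm (Q p) \<le> A" and s: "s1 \<ge> 0" "s2 \<ge> 0"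
  shows "energy (inv_fourier2 (\<lambda>p. indicator (annulus j) p * (U (fst p) * V (snd p)) * Q p))
    \<le> ennreal (A\<^sup>2 * ((4 * 4 ^ j) powr (s1 + s2) * (unit_ball_vol (real DIM('a)) * (2 * 2 ^ j) ^ DIM('a))))
       * (sobolev_energy s1 U * sobolev_energy s2 V)"
proof -
  define Y :: real where "Y = 4 * 4 ^ j"
  have Y: "Y > 0" by (simp add: Y_def)
  define u where "u \<xi> = norm ((1 + (norm \<xi>)\<^sup>2) powr (- s1 / 2) *\<^sub>R U \<xi>)" for \<xi>
  define v where "v \<xi> = norm ((1 + (norm \<xi>)\<^sup>2) powr (- s2 / 2) *\<^sub>R V \<xi>)" for \<xi>
  have [measurable]: "u \<in> borel_measurable borel" "v \<in> borel_measurable borel"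
    unfolding u_def v_def by measurable
  define K where "K = A * Y powr ((s1 + s2) / 2)"
  have K0: "K \<ge> 0" using \<open>A \<ge> 0\<close> by (simp add: K_def)
  have Ybound: "1 + (norm \<xi>)\<^sup>2 \<le> Y" if "1 + norm \<xi> < 2 * 2 ^ j" for \<xi> :: 'a
  proof -
    have "1 + (norm \<xi>)\<^sup>2 \<le> (1 + norm \<xi>)\<^sup>2" by (simp add: power2_eq_square algebra_simps)
    also have "\<dots> \<le> (2 * 2 ^ j)\<^sup>2" using that by (intro power_mono) auto
    also have "\<dots> = 4 * ((2::real) ^ j)\<^sup>2" by (simp add: power_mult_distrib)
    also have "((2::real) ^ j)\<^sup>2 = 4 ^ j" by (simp add: power2_eq_square flip: power_mult_distrib)
    also have "4 * 4 ^ j = Y" by (simp add: Y_def)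
    finally show ?thesis .
  qed
  have "energy (inv_fourier2 (\<lambda>p. indicator (annulus j) p * (U (fst p) * V (snd p)) * Q p))
     \<le> (ennreal K)\<^sup>2 * emeasure lborel (cball (0::'a) (2 * 2 ^ j)) * (\<integral>\<^sup>+\<xi>. (ennreal (u \<xi>))\<^sup>2 \<partial>lborel) * (\<integral>\<^sup>+\<eta>. (ennreal (v \<eta>))\<^sup>2 \<partial>lborel)"
  proof (rule energy_inv_fourier2[OF int])
    fix \<xi> \<eta> :: 'a
    show "enorm (indicator (annulus j) (\<xi>, \<eta>) * (U (fst (\<xi>, \<eta>)) * V (snd (\<xi>, \<eta>))) * Q (\<xi>, \<eta>))
       \<le> ennreal K * indicator (cball 0 (2 * 2 ^ j)) \<xi> * (ennreal (u \<xi>) * ennreal (v \<eta>))"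
    proof (cases "(\<xi>, \<eta>) \<in> annulus j")
      case True
      then have lt: "1 + norm \<xi> < 2 * 2 ^ j" "1 + norm \<eta> < 2 * 2 ^ j"
        by (auto simp: annulus_def) (smt (verit) norm_ge_zero)+
      have "norm (U \<xi> * V \<eta> * Q (\<xi>, \<eta>)) \<le> (Y powr (s1 / 2) * u \<xi>) * (Y powr (s2 / 2) * v \<eta>) * A"
        unfolding norm_mult u_def v_def
        by (intro mult_mono norm_le_weighted s Ybound lt bound True mult_nonneg_nonneg) auto
      also have "\<dots> = K * (u \<xi> * v \<eta>)"
        by (simp add: K_def add_divide_distrib powr_add)
      finally have "norm (U \<xi> * V \<eta> * Q (\<xi>, \<eta>)) \<le> K * (u \<xi> * v \<eta>)" .
      moreover have "\<xi> \<in> cball 0 (2 * 2 ^ j)" using lt by simp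
      ultimately show ?thesis using True K0
        by (simp add: ennreal_leI u_def v_def flip: ennreal_mult)
    qed simp
  qed auto
  also have "emeasure lborel (cball (0::'a) (2 * 2 ^ j)) = ennreal (unit_ball_vol (real DIM('a)) * (2 * 2 ^ j) ^ DIM('a))"
    by (rule emeasure_cball) simp
  also have "(\<integral>\<^sup>+\<xi>. (ennreal (u \<xi>))\<^sup>2 \<partial>lborel) = sobolev_energy s1 U"
    by (simp only: sobolev_energy_def energy_def u_def)
  also have "(\<integral>\<^sup>+\<xi>. (ennreal (v \<xi>))\<^sup>2 \<partial>lborel) = sobolev_energy s2 V"
    by (simp only: sobolev_energy_def energy_def v_def)
  also have "(ennreal K)\<^sup>2 = ennreal (A\<^sup>2 * Y powr (s1 + s2))"
    using K0 by (simp add: ennreal_power K_def power_mult_distrib) (simp add: power2_eq_square flip: powr_add)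
  also have "ennreal (A\<^sup>2 * Y powr (s1 + s2)) * ennreal (unit_ball_vol (real DIM('a)) * (2 * 2 ^ j) ^ DIM('a))
      = ennreal (A\<^sup>2 * (Y powr (s1 + s2) * (unit_ball_vol (real DIM('a)) * (2 * 2 ^ j) ^ DIM('a))))"
    by (subst ennreal_mult[symmetric]) (simp_all add: mult.assoc)
  finally show ?thesis by (simp only: Y_def mult.assoc)
qed

lemma integrable_mult_bounded_on:
  fixes W Q :: "'a::euclidean_space \<Rightarrow> complex"
  assumes W: "integrable lborel W" and [measurable]: "Q \<in> borel_measurable borel"
    and bound: "\<And>p. norm (W p * Q p) \<le> K * norm (W p)"
  shows "integrable lborel (\<lambda>p. W p * Q p)"
proof (rule Bochner_Integration.integrable_bound[OF integrable_mult_right[OF W, of "of_real K"]])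
  have [measurable]: "W \<in> borel_measurable borel" using W by auto
  show "(\<lambda>p. W p * Q p) \<in> borel_measurable lborel" by simp
  have "norm (W p * Q p) \<le> norm (of_real K * W p)" for p
    using bound[of p] mult_right_mono[OF abs_ge_self[of K] norm_ge_zero[of "W p"]] by (simp add: norm_mult)
  then show "AE p in lborel. norm (W p * Q p) \<le> norm (of_real K * W p)" by simp
qed

text \<open>Balance of the exponents of 2^j: \<gamma>/2 from the weights r^(-2j), \<beta> +
  \<gamma>/4 from the covering, -2a from the multiplier, 2s from the Sobolev weights, d from the
  volume; the total is -\<gamma>/4. The factors free of j are 2^(2a), 2^(2s) and 2^d.\<close>

lemma dyadic_exponent:
  fixes a \<beta> s \<gamma> :: real and d j :: nat
  assumes \<gamma>: "\<gamma> = 2 * a - real d - \<beta> - 2 * s"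
  shows "((1 / 2 powr (- \<gamma> / 4)) ^ j)\<^sup>2 * ((2 ^ j) powr (\<beta> + \<gamma> / 4) * (((2 ^ j / 2) powr (- a))\<^sup>2 * ((4 * 4 ^ j) powr s * (2 * 2 ^ j) ^ d)))
     = 2 powr (2 * a + 2 * s + real d) * (2 powr (- \<gamma> / 4)) ^ j"
proof -
  define x where "x = real j"
  have p: "(2::real) ^ j = 2 powr x" by (simp add: x_def powr_realpow)
  have "(4::real) ^ j = (2 ^ j)\<^sup>2" by (simp flip: power_mult_distrib add: power2_eq_square)
  also have "\<dots> = 2 powr (2 * x)" unfolding p by (simp add: power2_eq_square flip: powr_add)
  finally have 4: "4 * (4::real) ^ j = 2 powr (2 * x + 2)" by (simp add: powr_add)
  have pw: "(2 powr z) ^ n = (2::real) powr (real n * z)" for z n by (simp add: powr_power)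
  have "1 / 2 powr (- \<gamma> / 4) = 2 powr (\<gamma> / 4)"
    using powr_minus_divide[of 2 "- \<gamma> / 4"] by simp
  then have 1: "((1 / 2 powr (- \<gamma> / 4)) ^ j)\<^sup>2 = 2 powr (x * \<gamma> / 2)"
    by (simp only: pw) (simp add: x_def mult.commute)
  have "(2 powr x / 2) = 2 powr (x - 1)" by (simp add: powr_diff)
  then have 2: "((2 powr x / 2) powr (- a))\<^sup>2 = 2 powr (- 2 * a * (x - 1))"
    by (simp only: pw powr_powr) (simp add: algebra_simps)
  have "2 * 2 powr x = 2 powr (x + 1)" by (simp add: powr_add)
  then have 3: "(2 * 2 powr x) ^ d = 2 powr (real d * (x + 1))"
    by (simp only: pw)
  have 5: "(2 powr (- \<gamma> / 4)) ^ j = 2 powr (- \<gamma> / 4 * x)"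
    by (simp only: pw x_def) (simp add: mult.commute)
  have "x * \<gamma> / 2 + (x * (\<beta> + \<gamma> / 4) + (- 2 * a * (x - 1) + ((2 * x + 2) * s + real d * (x + 1))))
      = (2 * a + 2 * s + real d) + (- \<gamma> / 4 * x)"
    unfolding \<gamma> by (simp add: field_simps)
  then show ?thesis
    unfolding 1 4 5 p 2 3 powr_powr by (simp only: powr_add[symmetric])
qed

lemma dilate_eq: "dilate t m p = m (t *\<^sub>R p)"
  by (simp add: dilate_def case_prod_beta scaleR_prod_def)

text \<open>The empty list of directions gives the bound on m, the singletons those on the partial
  derivatives; summed with |p . b| <= |p| they bound the radial derivative. Evaluation at the origin
  shows that the constants are nonnegative.\<close>

lemma admissible_bounds:
  fixes m :: "'a::euclidean_space \<times> 'a \<Rightarrow> complex"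
  assumes "admissible a 1 m"
  obtains C0 C1 where "C0 \<ge> 0" "C1 \<ge> 0"
    "\<And>p. norm (m p) \<le> C0 * (1 + norm (fst p) + norm (snd p)) powr (- a)"
    "\<And>t p. norm (radial_deriv m t p) \<le> norm p * (C1 * (1 + norm (t *\<^sub>R fst p) + norm (t *\<^sub>R snd p)) powr (- a))"
proof -
  have *: "\<exists>C\<ge>0. \<forall>p. norm (partial_derivs vs m p) \<le> C * (1 + norm (fst p) + norm (snd p)) powr (- a)"
    if "set vs \<subseteq> Basis" "length vs \<le> 1" for vs
  proof -
    have "\<exists>C. \<forall>\<xi> \<eta>. norm (partial_derivs vs m (\<xi>, \<eta>)) \<le> C * (1 + norm \<xi> + norm \<eta>) powr (- a)"
      using assms that unfolding admissible_def by simp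
    then obtain C where C: "\<And>\<xi> \<eta>. norm (partial_derivs vs m (\<xi>, \<eta>)) \<le> C * (1 + norm \<xi> + norm \<eta>) powr (- a)"
      by blast
    have "0 \<le> C" using order.trans[OF norm_ge_zero C[of 0 0]] by simp
    then show ?thesis using C by (metis prod.collapse)
  qed
  obtain C0 where C0: "C0 \<ge> 0" "\<And>p. norm (m p) \<le> C0 * (1 + norm (fst p) + norm (snd p)) powr (- a)"
    using *[of "[]"] by auto
  have "\<exists>C\<ge>0. \<forall>p. norm (partial_deriv b m p) \<le> C * (1 + norm (fst p) + norm (snd p)) powr (- a)" if "b \<in> Basis" for b
    using *[of "[b]"] that by simp
  then obtain C where C: "\<And>b. b \<in> Basis \<Longrightarrow> C b \<ge> 0"
    "\<And>b p. b \<in> Basis \<Longrightarrow> norm (partial_deriv b m p) \<le> C b * (1 + norm (fst p) + norm (snd p)) powr (- a)"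
    by metis
  show ?thesis
  proof (rule that[OF C0(1) _ C0(2)])
    show "(\<Sum>b\<in>Basis. C b) \<ge> 0" by (intro sum_nonneg C)
    fix t and p :: "'a \<times> 'a"
    let ?y = "(1 + norm (t *\<^sub>R fst p) + norm (t *\<^sub>R snd p)) powr (- a)"
    have "norm (radial_deriv m t p) \<le> (\<Sum>b\<in>Basis. norm ((p \<bullet> b) *\<^sub>R partial_deriv b m (t *\<^sub>R p)))"
      unfolding radial_deriv_def by (rule norm_sum)
    also have "\<dots> \<le> (\<Sum>b\<in>Basis. norm p * (C b * ?y))"
      unfolding norm_scaleR using C(2)[of _ "t *\<^sub>R p"]
      by (intro sum_mono mult_mono) (auto simp: Basis_le_norm)
    finally show "norm (radial_deriv m t p) \<le> norm p * ((\<Sum>b\<in>Basis. C b) * ?y)"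
      by (simp add: sum_distrib_left sum_distrib_right)
  qed
qed

text \<open>For each annulus a majorant without t is integrated; the fixed-t energy is multiplied by
  the number of covering intervals, and the dyadic exponents leave a geometric series of ratio
  2^(-\<gamma>/4).\<close>

lemma maximal_estimate:
  fixes m :: "'a::euclidean_space \<times> 'a \<Rightarrow> complex" and E :: "real set"
  assumes E: "E \<subseteq> {1..2}" and dim: "upper_minkowski_dim E = ereal \<beta>"
    and m: "admissible a 1 m" and s: "s1 \<ge> 0" "s2 \<ge> 0"
    and lt: "s1 + s2 < (2 * a - real DIM('a) - \<beta>) / 2"
  shows "\<exists>C\<ge>0. \<forall>U V. integrable lborel U \<and> integrable lborel V \<longrightarrow>
    (\<integral>\<^sup>+x. (maximal_mult m E U V x)\<^sup>2 \<partial>lborel)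
      \<le> ennreal C * (sobolev_energy s1 U * sobolev_energy s2 V)"
proof -
  define \<gamma> where "\<gamma> = 2 * a - real DIM('a) - \<beta> - 2 * (s1 + s2)"
  have \<gamma>: "\<gamma> > 0" using lt by (simp add: \<gamma>_def field_simps)
  have a: "a > 0" using m unfolding admissible_def by (meson le_less_trans divide_nonneg_nonneg of_nat_0_le_iff zero_le_numeral)
  have Ck: "Ck 1 m" using m by (simp add: admissible_def)
  obtain C0 C1 where C: "C0 \<ge> 0" "C1 \<ge> 0"
    and C0: "\<And>p. norm (m p) \<le> C0 * (1 + norm (fst p) + norm (snd p)) powr (- a)"
    and C1: "\<And>t p. norm (radial_deriv m t p) \<le> norm p * (C1 * (1 + norm (t *\<^sub>R fst p) + norm (t *\<^sub>R snd p)) powr (- a))"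
    using admissible_bounds[OF m] by blast
  obtain CN where CN: "CN \<ge> 0" "\<And>j. real (covering_number E (1 / (2 * 2 ^ j))) \<le> CN * (2 ^ j) powr (\<beta> + \<gamma> / 4)"
    using covering_number_le[OF dim, of "\<gamma> / 4"] \<gamma> by auto
  \<comment> \<open>Chosen so that \<delta> times the bound 2 * 2^j for |p| on annulus j is exactly
    1, and so that \<delta> <= 1/2 keeps every t near a centre at least 1/2.\<close>
  define \<delta> where "\<delta> j = 1 / (2 * 2 ^ j :: real)" for j :: nat
  have \<delta>: "\<delta> j > 0" "\<delta> j \<le> 1 / 2" for j
    by (auto simp: \<delta>_def)
  have "\<forall>j. \<exists>S. finite S \<and> S \<subseteq> E \<and> card S \<le> covering_number E (\<delta> j) \<and> E \<subseteq> (\<Union>c\<in>S. {c - \<delta> j..c + \<delta> j})"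
    using covering_exists[OF E] \<delta> by blast
  then obtain S where S: "\<And>j. finite (S j)" "\<And>j. S j \<subseteq> E" "\<And>j. card (S j) \<le> covering_number E (\<delta> j)"
    "\<And>j. E \<subseteq> (\<Union>c\<in>S j. {c - \<delta> j..c + \<delta> j})"
    by metis
  define M where "M t p = m (t *\<^sub>R p)" for t p
  define N where "N t p = radial_deriv m t p" for t p
  have cont_m: "continuous_on UNIV m" using Ck_continuous[OF Ck] .
  then have [measurable]: "m \<in> borel_measurable borel" by (rule borel_measurable_continuous_onI)
  have [measurable]: "M t \<in> borel_measurable borel" for t unfolding M_def by measurable
  have der: "((\<lambda>s. M s p) has_vector_derivative N s p) (at s)" for s p
    unfolding M_def N_def by (rule has_vector_derivative_radial[OF Ck])
  have contN: "continuous_on UNIV (\<lambda>q. N (fst q) (snd q))"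
    unfolding N_def by (rule continuous_radial_deriv[OF Ck])
  have measN: "(\<lambda>q. N (fst q) (snd q)) \<in> borel_measurable borel"
    by (rule borel_measurable_continuous_onI[OF contN])
  \<comment> \<open>Size of (1 + |t \<xi>| + |t \<eta>|)^(-a) on annulus j; the halving comes from t
    >= 1/2.\<close>
  define \<rho> where "\<rho> j = (2 ^ j / 2 :: real) powr (- a)" for j :: nat
  have low: "(1 + norm (t *\<^sub>R fst p) + norm (t *\<^sub>R snd p)) powr (- a) \<le> \<rho> j"
    if "p \<in> annulus j" "t \<ge> 1 / 2" for t j and p :: "'a \<times> 'a"
  proof -
    have "2 ^ j / 2 \<le> 1 / 2 * (1 + norm (fst p) + norm (snd p))" using that by (simp add: annulus_def)
    also have "\<dots> \<le> 1 + t * norm (fst p) + t * norm (snd p)"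
      using mult_right_mono[OF that(2) norm_ge_zero[of "fst p"]] mult_right_mono[OF that(2) norm_ge_zero[of "snd p"]]
      by (simp add: algebra_simps)
    also have "\<dots> = 1 + norm (t *\<^sub>R fst p) + norm (t *\<^sub>R snd p)" using that by simp
    finally show ?thesis unfolding \<rho>_def using a by (intro powr_mono2') auto
  qed
  have Mbound: "norm (M t p) \<le> C0 * \<rho> j" if "p \<in> annulus j" "t \<ge> 1 / 2" for t j p
  proof -
    have "norm (M t p) \<le> C0 * (1 + norm (t *\<^sub>R fst p) + norm (t *\<^sub>R snd p)) powr (- a)"
      using C0[of "t *\<^sub>R p"] by (simp add: M_def)
    also have "\<dots> \<le> C0 * \<rho> j" using low[OF that] C by (intro mult_left_mono)
    finally show ?thesis .
  qed
  have Nbound: "norm (N t p) \<le> 2 * 2 ^ j * C1 * \<rho> j" if "p \<in> annulus j" "t \<ge> 1 / 2" for t j p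
  proof -
    have "norm p \<le> norm (fst p) + norm (snd p)" using norm_Pair_le[of "fst p" "snd p"] by simp
    also have "\<dots> \<le> 2 * 2 ^ j" using that by (simp add: annulus_def)
    finally have "norm p \<le> 2 * 2 ^ j" .
    then have "norm p * (C1 * (1 + norm (t *\<^sub>R fst p) + norm (t *\<^sub>R snd p)) powr (- a)) \<le> (2 * 2 ^ j) * (C1 * \<rho> j)"
      using low[OF that] C by (intro mult_mono mult_left_mono) auto
    with C1[of t p] show ?thesis by (simp add: N_def)
  qed
  have \<rho>0: "\<rho> j \<ge> 0" for j by (simp add: \<rho>_def)
  \<comment> \<open>A crude bound that serves integrability only.\<close>
  have Mglobal: "norm (M t p) \<le> C0" for t p
  proof -
    have "(1 + norm (t *\<^sub>R fst p) + norm (t *\<^sub>R snd p)) powr (- a) \<le> 1 powr (- a)"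
      using a by (intro powr_mono2') auto
    then have "C0 * (1 + norm (t *\<^sub>R fst p) + norm (t *\<^sub>R snd p)) powr (- a) \<le> C0 * 1"
      using C by (intro mult_left_mono) auto
    with C0[of "t *\<^sub>R p"] show ?thesis by (simp add: M_def)
  qed
  define v where "v = unit_ball_vol (real DIM('a))"
  have v0: "v \<ge> 0" by (simp add: v_def unit_ball_vol_nonneg)
  define G where "G j = (4 * 4 ^ j) powr (s1 + s2) * (v * (2 * 2 ^ j) ^ DIM('a))" for j :: nat
  have G0: "G j \<ge> 0" for j using v0 by (simp add: G_def)
  \<comment> \<open>With this ratio the weights r^(-2j) cost 2^(j \<gamma>/2), which leaves decay
    r^j after the covering loss.\<close>
  define r where "r = 2 powr (- \<gamma> / 4)"
  have r: "0 < r" "r < 1"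
    using \<gamma> powr_less_mono[of "- \<gamma> / 4" 0 2] by (auto simp: r_def)
  \<comment> \<open>2 C0^2 comes from the value at the centre, 4 C1^2 from the derivative term once
    \<delta>^2 (2 * 2^j)^2 = 1 has been used.\<close>
  define B where "B = 2 * C0\<^sup>2 + 4 * C1\<^sup>2"
  define D where "D = CN * (B * (v * 2 powr (2 * a + 2 * (s1 + s2) + real DIM('a))))"
  have B0: "B \<ge> 0" by (simp add: B_def)
  have D0: "D \<ge> 0" using CN B0 v0 by (simp add: D_def)
  have step: "(\<integral>\<^sup>+x. (maximal_mult m E U V x)\<^sup>2 \<partial>lborel)
      \<le> ennreal (1 / (1 - r\<^sup>2) * (D / (1 - r))) * (sobolev_energy s1 U * sobolev_energy s2 V)"
    if U: "integrable lborel U" and V: "integrable lborel V" for U V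
  proof -
    have [measurable]: "U \<in> borel_measurable borel" "V \<in> borel_measurable borel" using U V by auto
    define X where "X = sobolev_energy s1 U * sobolev_energy s2 V"
    define W where "W j p = indicator (annulus j) p * (U (fst p) * V (snd p))" for j p
    have UV: "integrable lborel (\<lambda>p. U (fst p) * V (snd p))" by (rule integrable_tensor[OF U V])
    have W: "integrable lborel (W j)" for j
      unfolding W_def
      by (rule Bochner_Integration.integrable_bound[OF UV]) (auto simp: norm_mult indicator_def)
    have [measurable]: "W j \<in> borel_measurable borel" for j using W[of j] by auto
    have W0: "W j p = 0" if "p \<notin> annulus j" for j p using that by (simp add: W_def)
    have WMbound: "norm (W j p * M t p) \<le> C0 * norm (W j p)" for j t p
      using mult_left_mono[OF Mglobal[of t p] norm_ge_zero[of "W j p"]] by (simp add: norm_mult mult.commute)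
    have WM: "integrable lborel (\<lambda>p. W j p * M t p)" for j t
      by (rule integrable_mult_bounded_on[OF W _ WMbound]) measurable
    have WNbound: "norm (W j p * N t p) \<le> (2 * 2 ^ j * C1 * \<rho> j) * norm (W j p)" if "t \<ge> 1 / 2" for j t p
    proof (cases "p \<in> annulus j")
      case True
      from mult_left_mono[OF Nbound[OF this that] norm_ge_zero[of "W j p"]] show ?thesis
        by (simp add: norm_mult mult.commute)
    qed (simp add: W0)
    have Nt: "N t \<in> borel_measurable borel" for t
      using borel_measurable_uncurried[OF measN, of "\<lambda>_. t" borel "\<lambda>p. p"] by simp
    have WN: "integrable lborel (\<lambda>p. W j p * N t p)" if "t \<ge> 1 / 2" for j t
      by (rule integrable_mult_bounded_on[OF W Nt WNbound[OF that]])
    have near: "t \<ge> 1 / 2" if "c \<in> E" "t \<in> {c - \<delta> j..c + \<delta> j}" for c t j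
    proof -
      have "c \<ge> 1" using that E by auto
      moreover have "c - \<delta> j \<le> t" using that by simp
      ultimately show ?thesis using \<delta>(2)[of j] by linarith
    qed
    \<comment> \<open>A sum over centres in place of a maximum: measurable, free of t, and at least
      the square of the piece for every t in \<open>E\<close>.\<close>
    define H where "H j x = (\<Sum>c\<in>S j. local_majorant (W j) M N (\<delta> j) c x)" for j x
    have Hm [measurable]: "H j \<in> borel_measurable borel" for j
      unfolding H_def by (intro borel_measurable_sum local_majorant_measurable measN) measurable
    have TH: "enorm (product_mult (W j) (M t) x) \<le> esqrt (H j x)" if "t \<in> E" for j t x
    proof (rule le_esqrt)
      obtain c where c: "c \<in> S j" "t \<in> {c - \<delta> j..c + \<delta> j}" using S(4) \<open>t \<in> E\<close> by blast
      have cE: "c \<in> E" using c S(2) by blast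
      have "(enorm (product_mult (W j) (M t) x))\<^sup>2 \<le> local_majorant (W j) M N (\<delta> j) c x"
        by (rule local_majorant_bound[OF W c(2) der contN WNbound WM WM]) (rule near[OF cE])
      also have "\<dots> \<le> H j x"
        unfolding H_def using c(1) S(1) by (intro member_le_sum) auto
      finally show "(enorm (product_mult (W j) (M t) x))\<^sup>2 \<le> H j x" .
    qed
    \<comment> \<open>The splitting into annuli is made for each fixed t; the bound of every piece
      no longer contains t, so the supremum comes for free.\<close>
    have sup: "maximal_mult m E U V x \<le> (\<Sum>j. esqrt (H j x))" for x
    proof (rule SUP_least)
      fix t assume t: "t \<in> E"
      have P: "integrable lborel (\<lambda>p. U (fst p) * V (snd p) * M t p)"
        by (rule integrable_tensor_bounded[OF U V _ Mglobal]) measurable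
      have "enorm (bilinear_mult (dilate t m) U V x)
          = enorm (bilinear_mult (M t) U V x)"
        by (simp add: dilate_eq M_def)
      also have "\<dots> \<le> (\<Sum>j. enorm (inv_fourier2 (\<lambda>p. indicator (annulus j) p * (U (fst p) * V (snd p) * M t p)) x))"
        by (rule norm_inv_fourier2_le_annuli[OF P])
      also have "\<dots> = (\<Sum>j. enorm (product_mult (W j) (M t) x))"
        by (simp only: W_def mult.assoc)
      also have "\<dots> \<le> (\<Sum>j. esqrt (H j x))"
        by (intro suminf_le TH t summableI)
      finally show "enorm (bilinear_mult (dilate t m) U V x) \<le> (\<Sum>j. esqrt (H j x))" .
    qed
    have IH: "(\<integral>\<^sup>+x. H j x \<partial>lborel) \<le> ennreal (real (card (S j)) * (B * ((\<rho> j)\<^sup>2 * G j))) * X" for j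
    proof -
      have "(\<integral>\<^sup>+x. H j x \<partial>lborel) = (\<Sum>c\<in>S j. \<integral>\<^sup>+x. local_majorant (W j) M N (\<delta> j) c x \<partial>lborel)"
        unfolding H_def by (intro nn_integral_sum) (simp add: local_majorant_measurable measN)
      also have "\<dots> \<le> (\<Sum>c\<in>S j. ennreal (B * ((\<rho> j)\<^sup>2 * G j)) * X)"
      proof (rule sum_mono)
        fix c assume "c \<in> S j"
        then have cE: "c \<in> E" using S(2) by blast
        have c12: "c \<ge> 1 / 2" using near[OF cE, of c j] \<delta>(1)[of j] by simp
        have "(\<integral>\<^sup>+x. local_majorant (W j) M N (\<delta> j) c x \<partial>lborel)
            \<le> 2 * (ennreal ((C0 * \<rho> j)\<^sup>2 * G j) * X) + ennreal (4 * (\<delta> j)\<^sup>2) * (ennreal ((2 * 2 ^ j * C1 * \<rho> j)\<^sup>2 * G j) * X)"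
        proof (rule nn_integral_local_majorant)
          show "energy (product_mult (W j) (M c)) \<le> ennreal ((C0 * \<rho> j)\<^sup>2 * G j) * X"
            unfolding W_def G_def v_def X_def
            by (rule annulus_energy) (use WM[of j c] C \<rho>0 Mbound[OF _ c12] s in \<open>auto simp: W_def\<close>)
          show "energy (product_mult (W j) (N s)) \<le> ennreal ((2 * 2 ^ j * C1 * \<rho> j)\<^sup>2 * G j) * X"
            if "s \<in> {c - \<delta> j..c + \<delta> j}" for s
            unfolding W_def G_def v_def X_def
            by (rule annulus_energy) (use WN[OF near[OF cE that], of j] C \<rho>0 Nbound[OF _ near[OF cE that]] s in \<open>auto simp: W_def\<close>)
        qed (use \<delta>(1)[of j] measN in auto)
        also have "\<dots> = ennreal (2 * ((C0 * \<rho> j)\<^sup>2 * G j) + 4 * (\<delta> j)\<^sup>2 * ((2 * 2 ^ j * C1 * \<rho> j)\<^sup>2 * G j)) * X"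
        proof -
          have "2 * (ennreal p * X) + ennreal d * (ennreal q * X) = ennreal (2 * p + d * q) * X" if "p \<ge> 0" "d \<ge> 0" "q \<ge> 0" for p d q
            using that by (simp add: ennreal_mult' distrib_right mult.assoc)
          then show ?thesis using G0[of j] by simp
        qed
        also have "2 * ((C0 * \<rho> j)\<^sup>2 * G j) + 4 * (\<delta> j)\<^sup>2 * ((2 * 2 ^ j * C1 * \<rho> j)\<^sup>2 * G j) = B * ((\<rho> j)\<^sup>2 * G j)"
        proof -
          \<comment> \<open>Here the short interval cancels the factor 2^j lost to the
            derivative.\<close>
          have "(\<delta> j)\<^sup>2 * (2 * 2 ^ j)\<^sup>2 = 1"
            unfolding \<delta>_def power_mult_distrib[symmetric] by simp
          moreover have "4 * (\<delta> j)\<^sup>2 * ((2 * 2 ^ j * C1 * \<rho> j)\<^sup>2 * G j) = ((\<delta> j)\<^sup>2 * (2 * 2 ^ j)\<^sup>2) * (4 * C1\<^sup>2 * ((\<rho> j)\<^sup>2 * G j))"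
            by (simp only: power_mult_distrib mult_ac)
          ultimately have "4 * (\<delta> j)\<^sup>2 * ((2 * 2 ^ j * C1 * \<rho> j)\<^sup>2 * G j) = 4 * C1\<^sup>2 * ((\<rho> j)\<^sup>2 * G j)"
            by (simp only: mult_1)
          then show ?thesis by (simp add: B_def power_mult_distrib algebra_simps)
        qed
        finally show "(\<integral>\<^sup>+x. local_majorant (W j) M N (\<delta> j) c x \<partial>lborel) \<le> ennreal (B * ((\<rho> j)\<^sup>2 * G j)) * X" .
      qed
      also have "\<dots> = ennreal (real (card (S j)) * (B * ((\<rho> j)\<^sup>2 * G j))) * X"
        by (simp add: ennreal_mult' mult.assoc ennreal_of_nat_eq_real_of_nat)
      finally show ?thesis .
    qed
    have IH': "(ennreal ((1 / r) ^ j))\<^sup>2 * (\<integral>\<^sup>+x. H j x \<partial>lborel) \<le> ennreal (D * r ^ j) * X" for j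
    proof -
      have "real (card (S j)) \<le> CN * (2 ^ j) powr (\<beta> + \<gamma> / 4)"
        using CN(2)[of j] S(3)[of j] unfolding \<delta>_def by linarith
      then have "real (card (S j)) * (B * ((\<rho> j)\<^sup>2 * G j)) \<le> (CN * (2 ^ j) powr (\<beta> + \<gamma> / 4)) * (B * ((\<rho> j)\<^sup>2 * G j))"
        using B0 G0 by (intro mult_right_mono) auto
      then have "((1 / r) ^ j)\<^sup>2 * (real (card (S j)) * (B * ((\<rho> j)\<^sup>2 * G j)))
          \<le> ((1 / r) ^ j)\<^sup>2 * ((CN * (2 ^ j) powr (\<beta> + \<gamma> / 4)) * (B * ((\<rho> j)\<^sup>2 * G j)))"
        by (intro mult_left_mono) auto
      \<comment> \<open>All factors that depend on j are gathered into the left-hand side of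
        \<open>dyadic_exponent\<close>.\<close>
      also have "\<dots> = CN * (B * (v * (((1 / r) ^ j)\<^sup>2 * ((2 ^ j) powr (\<beta> + \<gamma> / 4) * ((\<rho> j)\<^sup>2 * ((4 * 4 ^ j) powr (s1 + s2) * (2 * 2 ^ j) ^ DIM('a)))))))"
        by (simp only: G_def mult.assoc mult.left_commute mult.commute)
      also have "\<dots> = D * r ^ j"
        unfolding r_def \<rho>_def dyadic_exponent[OF \<gamma>_def] by (simp add: D_def)
      finally have le: "((1 / r) ^ j)\<^sup>2 * (real (card (S j)) * (B * ((\<rho> j)\<^sup>2 * G j))) \<le> D * r ^ j" .
      have "(ennreal ((1 / r) ^ j))\<^sup>2 * (\<integral>\<^sup>+x. H j x \<partial>lborel)
          \<le> (ennreal ((1 / r) ^ j))\<^sup>2 * (ennreal (real (card (S j)) * (B * ((\<rho> j)\<^sup>2 * G j))) * X)"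
        by (intro mult_left_mono IH) auto
      also have "\<dots> = ennreal (((1 / r) ^ j)\<^sup>2 * (real (card (S j)) * (B * ((\<rho> j)\<^sup>2 * G j)))) * X"
      proof -
        have "(ennreal ((1 / r) ^ j))\<^sup>2 = ennreal (((1 / r) ^ j)\<^sup>2)"
          using r by (subst ennreal_power) auto
        moreover have "ennreal (((1 / r) ^ j)\<^sup>2) * ennreal (real (card (S j)) * (B * ((\<rho> j)\<^sup>2 * G j)))
            = ennreal (((1 / r) ^ j)\<^sup>2 * (real (card (S j)) * (B * ((\<rho> j)\<^sup>2 * G j))))"
          using B0 G0[of j] by (subst ennreal_mult[symmetric]) auto
        ultimately show ?thesis by (simp only: mult.assoc[symmetric])
      qed
      also have "\<dots> \<le> ennreal (D * r ^ j) * X" by (intro mult_right_mono ennreal_leI le) auto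
      finally show ?thesis .
    qed
    have "(\<integral>\<^sup>+x. (maximal_mult m E U V x)\<^sup>2 \<partial>lborel)
        \<le> (\<integral>\<^sup>+x. (\<Sum>j. (ennreal (r ^ j))\<^sup>2) * (\<Sum>j. (ennreal ((1 / r) ^ j))\<^sup>2 * H j x) \<partial>lborel)"
    proof (rule nn_integral_mono)
      fix x
      have "(maximal_mult m E U V x)\<^sup>2 \<le> (\<Sum>j. esqrt (H j x))\<^sup>2"
        by (intro power_mono sup) auto
      also have "\<dots> \<le> (\<Sum>j. (ennreal (r ^ j))\<^sup>2) * (\<Sum>j. (ennreal ((1 / r) ^ j))\<^sup>2 * (esqrt (H j x))\<^sup>2)"
        by (rule suminf_power2_le_weighted[OF r(1)])
      finally show "(maximal_mult m E U V x)\<^sup>2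
          \<le> (\<Sum>j. (ennreal (r ^ j))\<^sup>2) * (\<Sum>j. (ennreal ((1 / r) ^ j))\<^sup>2 * H j x)"
        by (simp only: esqrt_power2)
    qed
    also have "\<dots> = (\<Sum>j. (ennreal (r ^ j))\<^sup>2) * (\<integral>\<^sup>+x. (\<Sum>j. (ennreal ((1 / r) ^ j))\<^sup>2 * H j x) \<partial>lborel)"
      by (rule nn_integral_cmult) measurable
    also have "(\<integral>\<^sup>+x. (\<Sum>j. (ennreal ((1 / r) ^ j))\<^sup>2 * H j x) \<partial>lborel) = (\<Sum>j. (ennreal ((1 / r) ^ j))\<^sup>2 * (\<integral>\<^sup>+x. H j x \<partial>lborel))"
      by (subst nn_integral_suminf) (auto simp: nn_integral_cmult)
    also have "(\<Sum>j. (ennreal (r ^ j))\<^sup>2) * (\<Sum>j. (ennreal ((1 / r) ^ j))\<^sup>2 * (\<integral>\<^sup>+x. H j x \<partial>lborel))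
        \<le> (\<Sum>j. (ennreal (r ^ j))\<^sup>2) * (\<Sum>j. ennreal (D * r ^ j) * X)"
      by (intro mult_left_mono suminf_le IH' summableI) auto
    also have "(\<Sum>j. ennreal (D * r ^ j) * X) = ennreal (D / (1 - r)) * X"
    proof -
      have "(\<Sum>j. ennreal (D * r ^ j)) = ennreal (\<Sum>j. D * r ^ j)"
        using r D0 by (intro suminf_ennreal2) (auto intro!: summable_mult summable_geometric)
      also have "(\<Sum>j. D * r ^ j) = D / (1 - r)"
        using r by (simp add: suminf_mult suminf_geometric summable_geometric)
      finally show ?thesis by simp
    qed
    also have "(\<Sum>j. (ennreal (r ^ j))\<^sup>2) = ennreal (1 / (1 - r\<^sup>2))"
    proof -
      have r2: "r\<^sup>2 < 1" using r by (simp add: power_less_one_iff)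
      have "(ennreal (r ^ j))\<^sup>2 = ennreal ((r\<^sup>2) ^ j)" for j
        using r by (subst ennreal_power) (auto simp: power_mult[symmetric] mult.commute)
      then have "(\<Sum>j. (ennreal (r ^ j))\<^sup>2) = ennreal (\<Sum>j. (r\<^sup>2) ^ j)"
        using r r2 by (simp only:, intro suminf_ennreal2) (auto intro!: summable_geometric)
      then show ?thesis using r r2 by (simp add: suminf_geometric)
    qed
    also have "ennreal (1 / (1 - r\<^sup>2)) * (ennreal (D / (1 - r)) * X) = ennreal (1 / (1 - r\<^sup>2) * (D / (1 - r))) * X"
      using r D0 by (subst ennreal_mult) (simp_all only: mult.assoc, simp_all add: power_le_one)
    finally show ?thesis by (simp only: X_def)
  qed
  have "0 \<le> 1 / (1 - r\<^sup>2) * (D / (1 - r))"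
    using r D0 by (simp add: power_le_one)
  with step show ?thesis by blast
qed

section \<open>Extension to \<open>L\<^sup>2 \<times> L\<^sup>2\<close>\<close>

text \<open>Real-valued, so that linear arithmetic and limits of products are at hand. Meaningful
  for square integrable functions only, since \<open>enn2real\<close> sends infinity to 0.\<close>

definition renergy :: "('a::euclidean_space \<Rightarrow> 'b::real_normed_vector) \<Rightarrow> real" where
  "renergy f = enn2real (energy f)"

abbreviation rdist2 :: "('a::euclidean_space \<Rightarrow> 'b::real_normed_vector) \<Rightarrow> ('a \<Rightarrow> 'b) \<Rightarrow> real" where
  "rdist2 f g \<equiv> renergy (\<lambda>x. f x - g x)"

lemma renergy_nonneg [simp]: "0 \<le> renergy f" by (simp add: renergy_def)

lemma energy_eq_renergy: "in_L2 f \<Longrightarrow> energy f = ennreal (renergy f)"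
  by (simp add: renergy_def in_L2_iff)

lemma renergy_le: "energy f \<le> ennreal r \<Longrightarrow> 0 \<le> r \<Longrightarrow> renergy f \<le> r"
  unfolding renergy_def by (metis enn2real_ennreal enn2real_mono ennreal_less_top)

lemma renergy_minus_commute: "rdist2 f g = rdist2 g f"
  by (simp add: renergy_def energy_minus_commute[of f g])

lemma renergy_diff_triangle:
  fixes f g h :: "'a::euclidean_space \<Rightarrow> 'b::{real_normed_vector,second_countable_topology}"
  assumes "in_L2 f" "in_L2 g" "in_L2 h"
  shows "rdist2 f h \<le> 2 * rdist2 f g + 2 * rdist2 g h"
proof (rule renergy_le)
  have "edist2 f h \<le> 2 * edist2 f g + 2 * edist2 g h"
    using assms by (intro energy_diff_triangle in_L2_measurable)
  also have "\<dots> = ennreal (2 * rdist2 f g + 2 * rdist2 g h)"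
    using assms by (simp add: energy_eq_renergy in_L2_diff ennreal_mult')
  finally show "edist2 f h \<le> ennreal (2 * rdist2 f g + 2 * rdist2 g h)" .
qed simp

lemma in_L2_0: "in_L2 (\<lambda>x::'a::euclidean_space. 0 :: complex)"
  by (rule test_fun_in_L2[OF test_fun_0])

lemma renergy_le_diff:
  fixes f g :: "'a::euclidean_space \<Rightarrow> complex"
  assumes "in_L2 f" "in_L2 g"
  shows "renergy f \<le> 2 * rdist2 f g + 2 * renergy g"
  using renergy_diff_triangle[OF assms in_L2_0] by simp

lemma tendsto_renergy_0_iff:
  assumes "\<And>n. in_L2 (f n)"
  shows "(\<lambda>n. energy (f n)) \<longlonglongrightarrow> 0 \<longleftrightarrow> (\<lambda>n. renergy (f n)) \<longlonglongrightarrow> 0"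
proof -
  have "(\<lambda>n. ennreal (renergy (f n))) \<longlonglongrightarrow> ennreal 0 \<longleftrightarrow> (\<lambda>n. renergy (f n)) \<longlonglongrightarrow> 0"
    by (rule tendsto_ennreal_iff) auto
  then show ?thesis using assms by (simp add: energy_eq_renergy)
qed

text \<open>The rate (1/8)^n is the one that \<open>L2_complete_rate\<close> asks for.\<close>

lemma test_fun_approx_rate:
  assumes "in_L2 f"
  obtains u where "\<And>n. test_fun (u n)" "\<And>n. rdist2 (u n) f \<le> (1/8) ^ n"
proof -
  have "\<exists>\<phi>. test_fun \<phi> \<and> rdist2 \<phi> f \<le> (1/8) ^ n" for n
  proof -
    obtain \<phi> where "test_fun \<phi>" "edist2 \<phi> f < ennreal ((1/8) ^ n)"
      using L2_approx_in_L2[OF assms] unfolding L2_approx_def by (metis zero_less_divide_1_iff zero_less_numeral zero_less_power)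
    then show ?thesis by (intro exI[of _ \<phi>] conjI renergy_le less_imp_le) auto
  qed
  then obtain u where "\<And>n. test_fun (u n) \<and> rdist2 (u n) f \<le> (1/8) ^ n" by metis
  with that show ?thesis by blast
qed

lemma ennreal_diff_power2_le:
  fixes a b d1 d2 :: ennreal
  assumes "a \<le> b + (d1 + d2)" "b \<le> a + (d1 + d2)" "a < top" "b < top"
  shows "(enorm (enn2real a - enn2real b))\<^sup>2 \<le> 2 * d1\<^sup>2 + 2 * d2\<^sup>2"
proof (cases "d1 = top \<or> d2 = top")
  case True
  then show ?thesis by (auto simp: top_power_ennreal ennreal_mult_top)
next
  case False
  obtain r s p q where rs: "a = ennreal r" "b = ennreal s" "r \<ge> 0" "s \<ge> 0"
    and pq: "d1 = ennreal p" "d2 = ennreal q" "p \<ge> 0" "q \<ge> 0"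
    using assms(3,4) False by (cases a; cases b; cases d1; cases d2) auto
  have "r \<le> s + (p + q)" "s \<le> r + (p + q)"
    using assms(1,2) rs pq by (simp_all flip: ennreal_plus)
  then have "enorm (r - s) \<le> d1 + d2"
    using pq by (simp add: abs_le_iff flip: ennreal_plus)
  then have "(enorm (r - s))\<^sup>2 \<le> (d1 + d2)\<^sup>2" by (intro power_mono) auto
  also have "\<dots> \<le> 2 * d1\<^sup>2 + 2 * d2\<^sup>2" by (rule ennreal_add_power2_le)
  finally show ?thesis using rs by simp
qed

text \<open>Two-sided sublinearity and the estimate make \<alpha>, the real-valued form of
  \<open>A\<close>, Lipschitz on bounded sets of pairs of test functions. Density then extends it by
  completeness, and the same Lipschitz bound for the extension gives uniqueness, the norm inequality
  and continuity.\<close>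

lemma bounded_L2_L2_L2I:
  fixes A :: "('a::euclidean_space \<Rightarrow> complex) \<Rightarrow> ('a \<Rightarrow> complex) \<Rightarrow> 'a \<Rightarrow> ennreal"
  assumes meas: "\<And>f g. test_fun f \<Longrightarrow> test_fun g \<Longrightarrow> A f g \<in> borel_measurable borel"
    and est: "\<And>f g. test_fun f \<Longrightarrow> test_fun g \<Longrightarrow> (\<integral>\<^sup>+x. (A f g x)\<^sup>2 \<partial>lborel) \<le> ennreal C * (energy f * energy g)"
    and fin: "\<And>f g x. test_fun f \<Longrightarrow> test_fun g \<Longrightarrow> A f g x < top"
    and sub: "\<And>f g f' g' x. test_fun f \<Longrightarrow> test_fun g \<Longrightarrow> test_fun f' \<Longrightarrow> test_fun g' \<Longrightarrow>
       A f g x \<le> A f' g' x + (A (\<lambda>x. f x - f' x) g x + A f' (\<lambda>x. g x - g' x) x)"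
    and sub': "\<And>f g f' g' x. test_fun f \<Longrightarrow> test_fun g \<Longrightarrow> test_fun f' \<Longrightarrow> test_fun g' \<Longrightarrow>
       A f' g' x \<le> A f g x + (A (\<lambda>x. f x - f' x) g x + A f' (\<lambda>x. g x - g' x) x)"
    and C: "C \<ge> 0"
  shows "bounded_L2_L2_L2 A"
proof -
  define \<alpha> where "\<alpha> f g x = enn2real (A f g x)" for f g x
  have \<alpha>m: "\<alpha> f g \<in> borel_measurable borel" if "test_fun f" "test_fun g" for f g
    using meas[OF that] unfolding \<alpha>_def by measurable
  have \<alpha>e: "energy (\<alpha> f g) \<le> ennreal (C * (renergy f * renergy g))" if "test_fun f" "test_fun g" for f g
  proof -
    have "energy (\<alpha> f g) = (\<integral>\<^sup>+x. (A f g x)\<^sup>2 \<partial>lborel)"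
    proof -
      have "enorm (\<alpha> f g x) = A f g x" for x using fin[OF that, of x] by (simp add: \<alpha>_def)
      then show ?thesis by (simp add: energy_def)
    qed
    also have "\<dots> \<le> ennreal C * (energy f * energy g)" by (rule est[OF that])
    also have "\<dots> = ennreal (C * (renergy f * renergy g))"
      using that C by (simp add: energy_eq_renergy test_fun_in_L2 ennreal_mult)
    finally show ?thesis .
  qed
  have \<alpha>L2: "in_L2 (\<alpha> f g)" if "test_fun f" "test_fun g" for f g
    using \<alpha>e[OF that] \<alpha>m[OF that] by (auto simp: in_L2_iff intro: le_less_trans)
  \<comment> \<open>The pointwise difference is at most A (f - f') g + A f' (g - g'); the factor 2
    comes from squaring this sum.\<close>
  have \<alpha>d: "rdist2 (\<alpha> f g) (\<alpha> f' g') \<le> 2 * C * (rdist2 f f' * renergy g + renergy f' * rdist2 g g')"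
    if t: "test_fun f" "test_fun g" "test_fun f'" "test_fun g'" for f g f' g'
  proof (rule renergy_le)
    have t1: "test_fun (\<lambda>x. f x - f' x)" and t2: "test_fun (\<lambda>x. g x - g' x)" using t by (auto intro: test_fun_diff)
    have [measurable]: "A (\<lambda>x. f x - f' x) g \<in> borel_measurable borel" "A f' (\<lambda>x. g x - g' x) \<in> borel_measurable borel"
      using t1 t2 t meas by auto
    have "edist2 (\<alpha> f g) (\<alpha> f' g') \<le> (\<integral>\<^sup>+x. 2 * (A (\<lambda>x. f x - f' x) g x)\<^sup>2 + 2 * (A f' (\<lambda>x. g x - g' x) x)\<^sup>2 \<partial>lborel)"
      unfolding energy_def \<alpha>_def
      by (intro nn_integral_mono ennreal_diff_power2_le sub sub' fin t)
    also have "\<dots> = 2 * (\<integral>\<^sup>+x. (A (\<lambda>x. f x - f' x) g x)\<^sup>2 \<partial>lborel) + 2 * (\<integral>\<^sup>+x. (A f' (\<lambda>x. g x - g' x) x)\<^sup>2 \<partial>lborel)"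
      by (simp add: nn_integral_add nn_integral_cmult)
    also have "\<dots> \<le> 2 * (ennreal C * (edist2 f f' * energy g)) + 2 * (ennreal C * (energy f' * edist2 g g'))"
      by (intro add_mono mult_left_mono est t t1 t2) auto
    also have "\<dots> = ennreal (2 * (C * (rdist2 f f' * renergy g)) + 2 * (C * (renergy f' * rdist2 g g')))"
      using C t t1 t2 by (simp add: energy_eq_renergy test_fun_in_L2 ennreal_mult)
    also have "2 * (C * (rdist2 f f' * renergy g)) + 2 * (C * (renergy f' * rdist2 g g'))
       = 2 * C * (rdist2 f f' * renergy g + renergy f' * rdist2 g g')" by (simp add: algebra_simps)
    finally show "edist2 (\<alpha> f g) (\<alpha> f' g') \<le> ennreal (2 * C * (rdist2 f f' * renergy g + renergy f' * rdist2 g g'))" .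
  qed (use C in auto)
  \<comment> \<open>A relation: h is the L2 limit of \<alpha> along some test sequences tending to f
    and g. It avoids fixing sequences in advance, and constant sequences relate test functions to
    their own \<alpha>.\<close>
  define P where "P f g h \<longleftrightarrow> in_L2 h \<and> (\<exists>u v. (\<forall>n::nat. test_fun (u n) \<and> test_fun (v n)) \<and>
     (\<lambda>n. rdist2 (u n) f) \<longlonglongrightarrow> 0 \<and> (\<lambda>n. rdist2 (v n) g) \<longlonglongrightarrow> 0 \<and>
     (\<lambda>n. rdist2 (\<alpha> (u n) (v n)) h) \<longlonglongrightarrow> 0)" for f g :: "'a \<Rightarrow> complex" and h :: "'a \<Rightarrow> real"
  have P_test: "P f g (\<alpha> f g)" if "test_fun f" "test_fun g" for f g
    unfolding P_def using that \<alpha>L2[OF that]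
    by (intro conjI exI[of _ "\<lambda>_. f"] exI[of _ "\<lambda>_. g"]) (auto simp: renergy_def energy_def)
  \<comment> \<open>The bound for test functions passes to the limit. Inserting the approximants
    costs 4 * 2 C on the outside and 4 * 2 within each product, hence 64 C.\<close>
  have Lip: "rdist2 h h' \<le> 64 * C * (rdist2 f f' * renergy g + renergy f' * rdist2 g g')"
    if P: "P f g h" "P f' g' h'" and L2: "in_L2 f" "in_L2 g" "in_L2 f'" "in_L2 g'" for f g f' g' h h'
  proof -
    from P(1) obtain u v where uv: "\<And>n. test_fun (u n)" "\<And>n. test_fun (v n)"
      and lim: "(\<lambda>n. rdist2 (u n) f) \<longlonglongrightarrow> 0" "(\<lambda>n. rdist2 (v n) g) \<longlonglongrightarrow> 0"
        "(\<lambda>n. rdist2 (\<alpha> (u n) (v n)) h) \<longlonglongrightarrow> 0"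
      unfolding P_def by blast
    from P(2) obtain u' v' where uv': "\<And>n. test_fun (u' n)" "\<And>n. test_fun (v' n)"
      and lim': "(\<lambda>n. rdist2 (u' n) f') \<longlonglongrightarrow> 0" "(\<lambda>n. rdist2 (v' n) g') \<longlonglongrightarrow> 0"
        "(\<lambda>n. rdist2 (\<alpha> (u' n) (v' n)) h') \<longlonglongrightarrow> 0"
      unfolding P_def by blast
    have hL2: "in_L2 h" "in_L2 h'" using P by (auto simp: P_def)
    note uv = uv uv' and lim = lim lim'
    note uvL2 = uv[THEN test_fun_in_L2]
    define R where "R n = 2 * rdist2 (\<alpha> (u n) (v n)) h + 4 * (2 * C *
        ((2 * rdist2 (u n) f + 4 * rdist2 f f' + 4 * rdist2 (u' n) f') * (2 * rdist2 (v n) g + 2 * renergy g)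
        + (2 * rdist2 (u' n) f' + 2 * renergy f') * (2 * rdist2 (v n) g + 4 * rdist2 g g' + 4 * rdist2 (v' n) g')))
        + 4 * rdist2 (\<alpha> (u' n) (v' n)) h'" for n
    have "rdist2 h h' \<le> R n" for n
    proof -
      have d3: "rdist2 a b \<le> 2 * rdist2 a c + 4 * rdist2 c d + 4 * rdist2 b d"
        if "in_L2 a" "in_L2 b" "in_L2 c" "in_L2 d" for a b c d :: "'a \<Rightarrow> complex"
        using renergy_diff_triangle[OF that(1,3,2)] renergy_diff_triangle[OF that(3,4,2)] renergy_minus_commute[of b d] by simp
      have "rdist2 h h' \<le> 2 * rdist2 h (\<alpha> (u n) (v n)) + 2 * rdist2 (\<alpha> (u n) (v n)) h'"
        by (intro renergy_diff_triangle hL2 \<alpha>L2 uv)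
      moreover have "rdist2 (\<alpha> (u n) (v n)) h' \<le> 2 * rdist2 (\<alpha> (u n) (v n)) (\<alpha> (u' n) (v' n)) + 2 * rdist2 (\<alpha> (u' n) (v' n)) h'"
        by (intro renergy_diff_triangle hL2 \<alpha>L2 uv)
      moreover have "rdist2 (\<alpha> (u n) (v n)) (\<alpha> (u' n) (v' n)) \<le> 2 * C * (rdist2 (u n) (u' n) * renergy (v n) + renergy (u' n) * rdist2 (v n) (v' n))"
        by (intro \<alpha>d uv)
      moreover have "2 * C * (rdist2 (u n) (u' n) * renergy (v n) + renergy (u' n) * rdist2 (v n) (v' n))
         \<le> 2 * C * ((2 * rdist2 (u n) f + 4 * rdist2 f f' + 4 * rdist2 (u' n) f') * (2 * rdist2 (v n) g + 2 * renergy g)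
        + (2 * rdist2 (u' n) f' + 2 * renergy f') * (2 * rdist2 (v n) g + 4 * rdist2 g g' + 4 * rdist2 (v' n) g'))"
        using C by (intro mult_left_mono add_mono mult_mono d3 renergy_le_diff uvL2 L2) auto
      ultimately show ?thesis
        unfolding R_def renergy_minus_commute[of h "\<alpha> (u n) (v n)"] by linarith
    qed
    moreover have "R \<longlonglongrightarrow> 2 * 0 + 4 * (2 * C *
        ((2 * 0 + 4 * rdist2 f f' + 4 * 0) * (2 * 0 + 2 * renergy g)
        + (2 * 0 + 2 * renergy f') * (2 * 0 + 4 * rdist2 g g' + 4 * 0))) + 4 * 0" (is "_ \<longlonglongrightarrow> ?l")
      unfolding R_def by (intro tendsto_intros lim)
    ultimately have "rdist2 h h' \<le> ?l"
      by (intro LIMSEQ_le_const) auto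
    then show ?thesis by (simp add: algebra_simps)
  qed
  have ex: "\<exists>h. P f g h" if fg: "in_L2 f" "in_L2 g" for f g
  proof -
    obtain u where u: "\<And>n. test_fun (u n)" "\<And>n. rdist2 (u n) f \<le> (1/8) ^ n"
      using test_fun_approx_rate[OF fg(1)] by blast
    obtain v where v: "\<And>n. test_fun (v n)" "\<And>n. rdist2 (v n) g \<le> (1/8) ^ n"
      using test_fun_approx_rate[OF fg(2)] by blast
    have diff: "rdist2 (w k) (w n) \<le> 4 * (1/8) ^ n"
      if w: "\<And>n. test_fun (w n)" "\<And>n. rdist2 (w n) q \<le> (1/8) ^ n" and q: "in_L2 q" and "n \<le> k" for w q k and n :: nat
    proof -
      have "rdist2 (w k) (w n) \<le> 2 * rdist2 (w k) q + 2 * rdist2 q (w n)"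
        by (intro renergy_diff_triangle q test_fun_in_L2 w)
      moreover have "(1/8::real) ^ k \<le> (1/8) ^ n" using \<open>n \<le> k\<close> by (intro power_decreasing) auto
      ultimately show ?thesis using w(2)[of k] w(2)[of n] renergy_minus_commute[of q "w n"] by linarith
    qed
    have bd: "renergy (w n) \<le> 2 + 2 * renergy q"
      if w: "\<And>n. test_fun (w n)" "\<And>n. rdist2 (w n) q \<le> (1/8) ^ n" and q: "in_L2 q" for w q and n :: nat
    proof -
      have "renergy (w n) \<le> 2 * rdist2 (w n) q + 2 * renergy q"
        by (intro renergy_le_diff q test_fun_in_L2 w)
      moreover have "(1/8::real) ^ n \<le> 1" by (intro power_le_one) auto
      ultimately show ?thesis using w(2)[of n] by linarith
    qed
    \<comment> \<open>Consecutive approximants are within 4 * (1/8)^n and have energy at most 2 plus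
      twice that of the limit; \<alpha>d turns these bounds into K (1/8)^n.\<close>
    define K where "K = 2 * C * (4 * (2 + 2 * renergy g) + (2 + 2 * renergy f) * 4)"
    have K: "K \<ge> 0" using C by (simp add: K_def)
    have cauchy: "edist2 (\<alpha> (u k) (v k)) (\<alpha> (u n) (v n)) \<le> ennreal (K * (1/8) ^ n)" if "n \<le> k" for n k
    proof -
      have "rdist2 (\<alpha> (u k) (v k)) (\<alpha> (u n) (v n))
         \<le> 2 * C * (rdist2 (u k) (u n) * renergy (v k) + renergy (u n) * rdist2 (v k) (v n))"
        by (intro \<alpha>d u v)
      also have "\<dots> \<le> 2 * C * ((4 * (1/8) ^ n) * (2 + 2 * renergy g) + (2 + 2 * renergy f) * (4 * (1/8) ^ n))"
        using C by (intro mult_left_mono add_mono mult_mono diff[OF u fg(1) that] diff[OF v fg(2) that] bd[OF u fg(1)] bd[OF v fg(2)]) auto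
      also have "\<dots> = K * (1/8) ^ n" by (simp add: K_def algebra_simps)
      finally show ?thesis
        by (subst energy_eq_renergy) (auto intro!: in_L2_diff \<alpha>L2 u v ennreal_leI)
    qed
    obtain h where h: "h \<in> borel_measurable borel" "\<And>n. edist2 h (\<alpha> (u n) (v n)) \<le> ennreal (K * (1/8) ^ n)"
      using L2_complete_rate[of "\<lambda>n. \<alpha> (u n) (v n)" K, OF \<alpha>m[OF u(1) v(1)] K cauchy] by blast
    have hL2: "in_L2 h"
    proof -
      have "energy h \<le> 2 * edist2 h (\<alpha> (u 0) (v 0)) + 2 * energy (\<alpha> (u 0) (v 0))"
        using energy_add_le[of "\<lambda>x. h x - \<alpha> (u 0) (v 0) x" "\<alpha> (u 0) (v 0)"] h(1) \<alpha>m[OF u(1) v(1), of 0 0] by simp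
      also have "\<dots> < top"
        using le_less_trans[OF h(2)[of 0] ennreal_less_top] \<alpha>L2[OF u(1) v(1), of 0 0] by (simp add: in_L2_iff ennreal_mult_less_top)
      finally show ?thesis using h(1) by (simp add: in_L2_iff)
    qed
    have p0: "(\<lambda>n. c * (1/8::real) ^ n) \<longlonglongrightarrow> 0" for c
      using tendsto_mult[OF tendsto_const[of c] LIMSEQ_power_zero[of "1/8::real"]] by simp
    have to0: "X \<longlonglongrightarrow> 0" if "\<And>n. 0 \<le> X n" "\<And>n. X n \<le> c * (1/8) ^ n" for X :: "nat \<Rightarrow> real" and c
      by (rule tendsto_sandwich[OF _ _ tendsto_const p0[of c]]) (use that in auto)
    have "P f g h"
      unfolding P_def
    proof (intro conjI hL2, rule exI[of _ u], rule exI[of _ v], intro conjI allI u v)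
      show "(\<lambda>n. rdist2 (u n) f) \<longlonglongrightarrow> 0" by (rule to0[of _ 1]) (use u in auto)
      show "(\<lambda>n. rdist2 (v n) g) \<longlonglongrightarrow> 0" by (rule to0[of _ 1]) (use v in auto)
      show "(\<lambda>n. rdist2 (\<alpha> (u n) (v n)) h) \<longlonglongrightarrow> 0"
        by (rule to0[of _ K]) (use renergy_le[OF h(2)] K renergy_minus_commute[of h] in auto)
    qed
    then show ?thesis by (rule exI[where x=h])
  qed
  define B where "B f g = (SOME h. P f g h)" for f g
  have PB: "P f g (B f g)" if "in_L2 f" "in_L2 g" for f g
    unfolding B_def using ex[OF that] by (rule someI_ex)
  have BL2: "in_L2 (B f g)" if "in_L2 f" "in_L2 g" for f g
    using PB[OF that] by (simp add: P_def)
  \<comment> \<open>Comparing \<open>B f g\<close> with the value that \<open>P_test\<close> relates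
    to the same pair makes the right-hand side of \<open>Lip\<close> vanish, so the two agree almost
    everywhere.\<close>
  have clause1: "AE x in lborel. 0 \<le> B f g x \<and> A f g x = ennreal (B f g x)" if t: "test_fun f" "test_fun g" for f g
  proof -
    have L2: "in_L2 f" "in_L2 g" using t by (auto intro: test_fun_in_L2)
    have "rdist2 (B f g) (\<alpha> f g) \<le> 64 * C * (rdist2 f f * renergy g + renergy f * rdist2 g g)"
      by (rule Lip[OF PB P_test]) (use t L2 in auto)
    also have "\<dots> = 0" by (simp add: renergy_def energy_def)
    finally have "edist2 (B f g) (\<alpha> f g) = 0"
      using energy_eq_renergy[OF in_L2_diff[OF BL2[OF L2] \<alpha>L2[OF t]]] renergy_nonneg[of "\<lambda>x. B f g x - \<alpha> f g x"] by simp
    then have "AE x in lborel. B f g x - \<alpha> f g x = 0"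
      by (intro energy_eq_0_AE borel_measurable_diff in_L2_measurable BL2 L2 \<alpha>L2 t)
    then show ?thesis
    proof eventually_elim
      case (elim x)
      then show ?case using fin[OF t, of x] by (simp add: \<alpha>_def)
    qed
  qed
  \<comment> \<open>Comparison with the pair of zero functions, whose \<alpha> has energy 0 by
    \<alpha>e. One more doubling of 64 C gives 128 C, and the norm needs its root.\<close>
  have clause2: "in_L2 (B f g) \<and> L2_norm (B f g) \<le> ennreal (sqrt (128 * C)) * L2_norm f * L2_norm g" if L2: "in_L2 f" "in_L2 g" for f g
  proof
    let ?z = "\<lambda>x::'a. 0::complex"
    have z: "renergy ?z = 0" by (simp add: renergy_def energy_def)
    have "renergy (\<alpha> ?z ?z) \<le> C * (renergy ?z * renergy ?z)" by (intro renergy_le \<alpha>e test_fun_0) (simp add: z)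
    then have z2: "renergy (\<alpha> ?z ?z) = 0" using renergy_nonneg[of "\<alpha> ?z ?z"] by (simp add: z)
    have "rdist2 (B f g) (\<alpha> ?z ?z) \<le> 64 * C * (rdist2 f ?z * renergy g + renergy ?z * rdist2 g ?z)"
      by (rule Lip[OF PB P_test]) (use L2 test_fun_0 in_L2_0 in auto)
    then have le: "rdist2 (B f g) (\<alpha> ?z ?z) \<le> 64 * C * (renergy f * renergy g)" by (simp add: z)
    have "energy (B f g) \<le> 2 * edist2 (B f g) (\<alpha> ?z ?z) + 2 * energy (\<alpha> ?z ?z)"
      using energy_add_le[of "\<lambda>x. B f g x - \<alpha> ?z ?z x" "\<alpha> ?z ?z"] in_L2_measurable[OF BL2[OF L2]] \<alpha>m[OF test_fun_0 test_fun_0] by simp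
    also have "\<dots> = 2 * ennreal (rdist2 (B f g) (\<alpha> ?z ?z)) + 2 * ennreal (renergy (\<alpha> ?z ?z))"
      by (simp only: energy_eq_renergy[OF \<alpha>L2[OF test_fun_0 test_fun_0]] energy_eq_renergy[OF in_L2_diff[OF BL2[OF L2] \<alpha>L2[OF test_fun_0 test_fun_0]]])
    also have "\<dots> \<le> 2 * ennreal (64 * C * (renergy f * renergy g)) + 2 * ennreal 0"
      unfolding z2 using le by (intro add_mono mult_left_mono ennreal_leI) auto
    also have "\<dots> = ennreal (128 * C) * energy f * energy g"
    proof -
      have "2 * ennreal (64 * C * (renergy f * renergy g)) = ennreal (2 * (64 * C * (renergy f * renergy g)))"
        using C by (subst ennreal_mult) auto
      also have "2 * (64 * C * (renergy f * renergy g)) = 128 * C * renergy f * renergy g" by simp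
      also have "ennreal (128 * C * renergy f * renergy g) = ennreal (128 * C) * ennreal (renergy f) * ennreal (renergy g)"
        using C by (simp only: ennreal_mult renergy_nonneg mult_nonneg_nonneg zero_le_numeral)
      finally show ?thesis using L2 by (simp add: energy_eq_renergy)
    qed
    finally have "energy (B f g) \<le> ennreal (128 * C) * energy f * energy g" .
    moreover have "(ennreal (sqrt (128 * C)))\<^sup>2 = ennreal (128 * C)" using C by (subst ennreal_power) auto
    ultimately have "(L2_norm (B f g))\<^sup>2 \<le> (ennreal (sqrt (128 * C)) * L2_norm f * L2_norm g)\<^sup>2"
      by (simp only: power_mult_distrib L2_norm_power2)
    then show "L2_norm (B f g) \<le> ennreal (sqrt (128 * C)) * L2_norm f * L2_norm g"
      by (rule ennreal_power2_le_cancel)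
  qed (rule BL2[OF L2])
  have clause3: "(\<lambda>n. L2_norm (\<lambda>x. B (u n) (v n) x - B f g x)) \<longlonglongrightarrow> 0"
    if L2: "\<And>n::nat. in_L2 (u n)" "\<And>n. in_L2 (v n)" "in_L2 f" "in_L2 g"
      and u: "(\<lambda>n. L2_norm (\<lambda>x. u n x - f x)) \<longlonglongrightarrow> 0" and v: "(\<lambda>n. L2_norm (\<lambda>x. v n x - g x)) \<longlonglongrightarrow> 0" for u v f g
  proof -
    have u': "(\<lambda>n. rdist2 (u n) f) \<longlonglongrightarrow> 0" and v': "(\<lambda>n. rdist2 (v n) g) \<longlonglongrightarrow> 0"
      using u v L2 by (simp_all add: tendsto_L2_norm_0_iff tendsto_renergy_0_iff in_L2_diff)
    have "(\<lambda>n. rdist2 (B (u n) (v n)) (B f g)) \<longlonglongrightarrow> 0"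
    proof (rule tendsto_sandwich[OF _ _ tendsto_const])
      show "\<forall>\<^sub>F n in sequentially. rdist2 (B (u n) (v n)) (B f g) \<le>
         64 * C * (rdist2 (u n) f * (2 * rdist2 (v n) g + 2 * renergy g) + renergy f * rdist2 (v n) g)"
      proof (intro always_eventually allI)
        fix n
        have "rdist2 (B (u n) (v n)) (B f g) \<le> 64 * C * (rdist2 (u n) f * renergy (v n) + renergy f * rdist2 (v n) g)"
          by (intro Lip PB L2)
        also have "\<dots> \<le> 64 * C * (rdist2 (u n) f * (2 * rdist2 (v n) g + 2 * renergy g) + renergy f * rdist2 (v n) g)"
          using C by (intro mult_left_mono add_mono renergy_le_diff L2) auto
        finally show "rdist2 (B (u n) (v n)) (B f g) \<le>
         64 * C * (rdist2 (u n) f * (2 * rdist2 (v n) g + 2 * renergy g) + renergy f * rdist2 (v n) g)" .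
      qed
      have "(\<lambda>n. 64 * C * (rdist2 (u n) f * (2 * rdist2 (v n) g + 2 * renergy g) + renergy f * rdist2 (v n) g))
         \<longlonglongrightarrow> 64 * C * (0 * (2 * 0 + 2 * renergy g) + renergy f * 0)"
        by (intro tendsto_intros u' v')
      then show "(\<lambda>n. 64 * C * (rdist2 (u n) f * (2 * rdist2 (v n) g + 2 * renergy g) + renergy f * rdist2 (v n) g)) \<longlonglongrightarrow> 0"
        by simp
    qed auto
    then show ?thesis using L2 by (simp add: tendsto_L2_norm_0_iff tendsto_renergy_0_iff in_L2_diff BL2)
  qed
  show ?thesis
    unfolding bounded_L2_L2_L2_def
    by (intro exI[of _ B] exI[of _ "sqrt (128 * C)"] conjI allI impI)
       (use clause1 clause2 clause3 in \<open>blast | simp\<close>)+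
qed

section \<open>The maximal operator on test functions\<close>

lemma maximal_op_eq:
  "maximal_op m E f g x = maximal_mult m E (fourier f) (fourier g) x"
  by (simp add: maximal_op_def bilinear_op_eq)

lemma integrable_bilinear_kernel:
  fixes f g :: "'a::euclidean_space \<Rightarrow> complex"
  assumes "admissible a k m" "test_fun f" "test_fun g"
  shows "integrable lborel (\<lambda>p. fourier f (fst p) * fourier g (snd p) * dilate t m p)"
proof -
  have "continuous_on UNIV m" using assms(1) Ck_continuous by (auto simp: admissible_def)
  then have [measurable]: "m \<in> borel_measurable borel" by (rule borel_measurable_continuous_onI)
  obtain K where K: "\<And>p. norm (m p) \<le> K" using assms(1) by (auto simp: admissible_def bounded_iff)
  show ?thesis
  proof (rule integrable_tensor_bounded)
    show "norm (dilate t m p) \<le> K" for p by (simp add: dilate_eq K)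
    show "dilate t m \<in> borel_measurable borel" unfolding dilate_eq[abs_def] by measurable
  qed (use assms in \<open>auto intro: fourier_test_fun_integrable\<close>)
qed

text \<open>A supremum of continuous functions is lower semicontinuous: its superlevel sets are
  unions of open sets, however large \<open>E\<close> is.\<close>

lemma maximal_op_measurable:
  fixes f g :: "'a::euclidean_space \<Rightarrow> complex"
  assumes "admissible a k m" "test_fun f" "test_fun g"
  shows "maximal_op m E f g \<in> borel_measurable borel"
proof (rule borel_measurableI_greater)
  fix y
  have "open {x. y < enorm (bilinear_mult (dilate t m) (fourier f) (fourier g) x)}" for t
    by (intro open_Collect_less continuous_on_const continuous_on_ennreal continuous_on_norm
        continuous_inv_fourier2 integrable_bilinear_kernel[OF assms])
  then have "open (\<Union>t\<in>E. {x. y < enorm (bilinear_mult (dilate t m) (fourier f) (fourier g) x)})"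
    by blast
  moreover have "{x. y < maximal_op m E f g x} =
      (\<Union>t\<in>E. {x. y < enorm (bilinear_mult (dilate t m) (fourier f) (fourier g) x)})"
    by (auto simp: maximal_op_eq less_SUP_iff)
  ultimately show "{x \<in> space borel. y < maximal_op m E f g x} \<in> sets borel" by simp
qed

text \<open>The multiplier bound is invariant under dilation, so one constant works for all t.
  Finiteness at every x makes the passage to real values lossless.\<close>

lemma maximal_op_finite:
  fixes f g :: "'a::euclidean_space \<Rightarrow> complex"
  assumes "admissible a k m" "test_fun f" "test_fun g"
  shows "maximal_op m E f g x < top"
proof -
  obtain K where K: "\<And>p. norm (m p) \<le> K" using assms(1) by (auto simp: admissible_def bounded_iff)
  have FG: "integrable lborel (\<lambda>p. fourier f (fst p) * fourier g (snd p))"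
    using assms by (intro integrable_tensor fourier_test_fun_integrable)
  define L where "L = (LINT p|lborel. K * norm (fourier f (fst p) * fourier g (snd p)))"
  have "norm (bilinear_mult (dilate t m) (fourier f) (fourier g) x) \<le> L" for t
  proof -
    have "norm (bilinear_mult (dilate t m) (fourier f) (fourier g) x)
        \<le> (LINT p|lborel. norm (fourier f (fst p) * fourier g (snd p) * dilate t m p * wave (x \<bullet> (fst p + snd p))))"
      unfolding inv_fourier2_def by (rule integral_norm_bound)
    also have "\<dots> = (LINT p|lborel. norm (fourier f (fst p) * fourier g (snd p) * dilate t m p))"
      by (simp add: norm_mult)
    also have "\<dots> \<le> L"
      unfolding L_def
    proof (rule integral_mono)
      show "integrable lborel (\<lambda>p. norm (fourier f (fst p) * fourier g (snd p) * dilate t m p))"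
        by (intro integrable_norm integrable_bilinear_kernel[OF assms])
      show "integrable lborel (\<lambda>p. K * norm (fourier f (fst p) * fourier g (snd p)))"
        by (intro integrable_mult_right integrable_norm FG)
      show "norm (fourier f (fst p) * fourier g (snd p) * dilate t m p) \<le> K * norm (fourier f (fst p) * fourier g (snd p))" for p
        using mult_right_mono[OF K[of "t *\<^sub>R p"] norm_ge_zero[of "fourier f (fst p) * fourier g (snd p)"]]
        by (simp add: dilate_eq norm_mult mult.commute)
    qed
    finally show ?thesis .
  qed
  then have "maximal_op m E f g x \<le> ennreal L"
    unfolding maximal_op_eq by (intro SUP_least ennreal_leI)
  then show ?thesis by (rule le_less_trans) simp
qed

text \<open>The polarisation f g - f' g' = (f - f') g + f' (g - g'), carried through the bilinear
  operator.\<close>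

lemma inv_fourier2_bilinear_diff:
  fixes f g f' g' :: "'a::euclidean_space \<Rightarrow> complex"
  assumes m: "admissible a k m" and t: "test_fun f" "test_fun g" "test_fun f'" "test_fun g'"
  defines "T \<equiv> \<lambda>t f g. bilinear_mult (dilate t m) (fourier f) (fourier g)"
  shows "T t f g x - T t f' g' x = T t (\<lambda>x. f x - f' x) g x + T t f' (\<lambda>x. g x - g' x) x"
proof -
  note k = integrable_bilinear_kernel[OF m]
  have F: "fourier (\<lambda>x. f x - f' x) \<xi> = fourier f \<xi> - fourier f' \<xi>" "fourier (\<lambda>x. g x - g' x) \<xi> = fourier g \<xi> - fourier g' \<xi>" for \<xi>
    using t by (simp_all add: fourier_diff test_fun_integrable)
  have "T t (\<lambda>x. f x - f' x) g x = T t f g x - T t f' g x"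
    unfolding T_def F left_diff_distrib by (intro inv_fourier2_diff k t)
  moreover have "T t f' (\<lambda>x. g x - g' x) x = T t f' g x - T t f' g' x"
    unfolding T_def F left_diff_distrib right_diff_distrib by (intro inv_fourier2_diff k t)
  ultimately show ?thesis by simp
qed

text \<open>Both directions carry the same error term, so together they bound the absolute
  difference of the two maximal functions.\<close>

lemma maximal_op_sublinear:
  fixes f g f' g' :: "'a::euclidean_space \<Rightarrow> complex"
  assumes m: "admissible a k m" and t: "test_fun f" "test_fun g" "test_fun f'" "test_fun g'"
  shows "maximal_op m E f g x \<le> maximal_op m E f' g' x + (maximal_op m E (\<lambda>x. f x - f' x) g x + maximal_op m E f' (\<lambda>x. g x - g' x) x)"
    and "maximal_op m E f' g' x \<le> maximal_op m E f g x + (maximal_op m E (\<lambda>x. f x - f' x) g x + maximal_op m E f' (\<lambda>x. g x - g' x) x)"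
proof -
  let ?D = "maximal_op m E (\<lambda>x. f x - f' x) g x + maximal_op m E f' (\<lambda>x. g x - g' x) x"
  define T where "T t f g = bilinear_mult (dilate t m) (fourier f) (fourier g)" for t f g
  have A: "maximal_op m E f g x = (SUP t\<in>E. enorm (T t f g x))" for f g
    by (simp add: maximal_op_eq T_def)
  have up: "enorm (T s f g x) \<le> maximal_op m E f g x" if "s \<in> E" for s f g
    unfolding A using that by (rule SUP_upper)
  have tri: "ennreal (norm a) \<le> ennreal (norm b) + (ennreal (norm c) + ennreal (norm d))"
    if "norm a \<le> norm b + (norm c + norm d)" for a b c d :: complex
    using ennreal_leI[OF that] by simp
  have "enorm (T s f g x) \<le> maximal_op m E f' g' x + ?D"
    and "enorm (T s f' g' x) \<le> maximal_op m E f g x + ?D"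
    if s: "s \<in> E" for s
  proof -
    let ?c = "T s (\<lambda>x. f x - f' x) g x" and ?d = "T s f' (\<lambda>x. g x - g' x) x"
    have eq: "T s f g x - T s f' g' x = ?c + ?d"
      unfolding T_def by (rule inv_fourier2_bilinear_diff[OF m t])
    have "T s f g x = T s f' g' x + (?c + ?d)" "T s f' g' x = T s f g x - (?c + ?d)" using eq by (simp_all add: algebra_simps)
    then have "norm (T s f g x) \<le> norm (T s f' g' x) + (norm ?c + norm ?d)"
      and "norm (T s f' g' x) \<le> norm (T s f g x) + (norm ?c + norm ?d)"
      by (metis add_left_mono norm_triangle_ineq norm_triangle_ineq4 order_trans)+
    from this[THEN tri] show "enorm (T s f g x) \<le> maximal_op m E f' g' x + ?D"
      and "enorm (T s f' g' x) \<le> maximal_op m E f g x + ?D"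
      by (elim order_trans, intro add_mono up[OF s])+
  qed
  then show "maximal_op m E f g x \<le> maximal_op m E f' g' x + ?D"
    and "maximal_op m E f' g' x \<le> maximal_op m E f g x + ?D"
    unfolding A[of f g] A[of f' g'] by (blast intro: SUP_least)+
qed

lemma maximal_op_estimate:
  fixes m :: "'a::euclidean_space \<times> 'a \<Rightarrow> complex"
  assumes "E \<subseteq> {1..2}" "upper_minkowski_dim E = ereal \<beta>" "admissible a 1 m" "s1 \<ge> 0" "s2 \<ge> 0"
    and "s1 + s2 < (2 * a - real DIM('a) - \<beta>) / 2"
  shows "\<exists>C\<ge>0. \<forall>f g. test_fun f \<and> test_fun g \<longrightarrow>
    (\<integral>\<^sup>+x. (maximal_op m E f g x)\<^sup>2 \<partial>lborel)
      \<le> ennreal C * (sobolev_energy s1 (fourier f) * sobolev_energy s2 (fourier g))"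
proof -
  obtain C where "C \<ge> 0" and C: "\<And>U V. integrable lborel U \<and> integrable lborel V \<Longrightarrow>
    (\<integral>\<^sup>+x. (maximal_mult m E U V x)\<^sup>2 \<partial>lborel)
      \<le> ennreal C * (sobolev_energy s1 U * sobolev_energy s2 V)"
    using maximal_estimate[OF assms] by blast
  show ?thesis
    unfolding maximal_op_eq
    by (intro exI[of _ C] conjI allI impI C \<open>C \<ge> 0\<close>) (auto intro: fourier_test_fun_integrable)
qed

lemma sobolev_energy_0_fourier:
  assumes "test_fun f" shows "sobolev_energy 0 (fourier f) \<le> energy f"
proof -
  \<comment> \<open>\<open>x powr 0\<close> equals 1 only for non-zero x.\<close>
  have "1 + (norm \<xi>)\<^sup>2 \<noteq> 0" for \<xi> :: 'a by (simp add: add_nonneg_eq_0_iff)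
  then have "sobolev_energy 0 (fourier f) = energy (fourier f)"
    by (simp add: sobolev_energy_def)
  also have "\<dots> \<le> energy f" by (rule bessel[OF test_fun_integrable[OF assms]])
  finally show ?thesis .
qed

theorem theorem1p1:
  fixes m :: "(real ^ 'd) \<times> (real ^ 'd) \<Rightarrow> complex"
    and E :: "real set"
    and a \<beta> :: real
  assumes "E \<noteq> {}" and "E \<subseteq> {1..2}"
    and "upper_minkowski_dim E = ereal \<beta>"
    and "admissible a 1 m"
    and "2 * a > real CARD('d) + \<beta>"
  shows "(\<forall>s1 s2. 0 \<le> s1 \<and> 0 \<le> s2 \<and> s1 + s2 < (2 * a - real CARD('d) - \<beta>) / 2 \<longrightarrow>
           (\<exists>C::real. \<forall>f g. test_fun f \<and> test_fun g \<longrightarrow>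
              maximal_op m E f g \<in> borel_measurable lborel \<and>
              eL2_norm (maximal_op m E f g)
                \<le> ennreal C * neg_sobolev_norm s1 f * neg_sobolev_norm s2 g))
         \<and> bounded_L2_L2_L2 (maximal_op m E)"
proof (intro conjI allI impI)
  fix s1 s2 :: real
  assume s: "0 \<le> s1 \<and> 0 \<le> s2 \<and> s1 + s2 < (2 * a - real CARD('d) - \<beta>) / 2"
  obtain C where C: "C \<ge> 0" "\<And>f g. test_fun f \<Longrightarrow> test_fun g \<Longrightarrow> (\<integral>\<^sup>+x. (maximal_op m E f g x)\<^sup>2 \<partial>lborel)
      \<le> ennreal C * (sobolev_energy s1 (fourier f) * sobolev_energy s2 (fourier g))"
    using maximal_op_estimate[OF assms(2-4), of s1 s2] s by auto
  have "eL2_norm (maximal_op m E f g) \<le> ennreal (sqrt C) * neg_sobolev_norm s1 f * neg_sobolev_norm s2 g"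
    if t: "test_fun f" "test_fun g" for f g
  proof (rule ennreal_power2_le_cancel)
    \<comment> \<open>The estimate was proved for squares, so the norm inequality holds with the
      root of its constant.\<close>
    have "(ennreal (sqrt C))\<^sup>2 = ennreal C" using C(1) by (subst ennreal_power) auto
    then show "(eL2_norm (maximal_op m E f g))\<^sup>2 \<le> (ennreal (sqrt C) * neg_sobolev_norm s1 f * neg_sobolev_norm s2 g)\<^sup>2"
      using C(2)[OF t] by (simp add: eL2_norm_power2 power_mult_distrib neg_sobolev_norm_power2 mult.assoc)
  qed
  then show "\<exists>C::real. \<forall>f g. test_fun f \<and> test_fun g \<longrightarrow> maximal_op m E f g \<in> borel_measurable lborel \<and>
      eL2_norm (maximal_op m E f g) \<le> ennreal C * neg_sobolev_norm s1 f * neg_sobolev_norm s2 g"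
    using maximal_op_measurable[OF assms(4)] by (intro exI[of _ "sqrt C"]) auto
next
  \<comment> \<open>The exponents s1 = s2 = 0 are allowed because 2a > d + \<beta> is
    strict.\<close>
  obtain C where C: "C \<ge> 0" "\<And>f g. test_fun f \<Longrightarrow> test_fun g \<Longrightarrow> (\<integral>\<^sup>+x. (maximal_op m E f g x)\<^sup>2 \<partial>lborel)
      \<le> ennreal C * (sobolev_energy 0 (fourier f) * sobolev_energy 0 (fourier g))"
    using maximal_op_estimate[OF assms(2-4), of 0 0] assms(5) by auto
  show "bounded_L2_L2_L2 (maximal_op m E)"
  proof (rule bounded_L2_L2_L2I[OF _ _ _ _ _ C(1)])
    fix f g :: "real ^ 'd \<Rightarrow> complex"
    assume t: "test_fun f" "test_fun g"
    have "(\<integral>\<^sup>+x. (maximal_op m E f g x)\<^sup>2 \<partial>lborel) \<le> ennreal C * (sobolev_energy 0 (fourier f) * sobolev_energy 0 (fourier g))"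
      by (rule C(2)[OF t])
    also have "\<dots> \<le> ennreal C * (energy f * energy g)"
      by (intro mult_left_mono mult_mono sobolev_energy_0_fourier t) auto
    finally show "(\<integral>\<^sup>+x. (maximal_op m E f g x)\<^sup>2 \<partial>lborel) \<le> ennreal C * (energy f * energy g)" .
  qed (intro maximal_op_measurable[OF assms(4)] maximal_op_finite[OF assms(4)] maximal_op_sublinear[OF assms(4)]; assumption)+
qed

end
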